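(* Let $v_0,B_0,E_0\in X^0$ be $\mathbb{R}^3$-valued periodic vector fields on $\mathbb{T}^3$ with $\operatorname{div} v_0=\operatorname{div} B_0=0$ and $\hat B_0(0)=0$. Then there exist $T>0$ and a unique mild solution $(v,B,E)\in C([0,T]; X^0\times X^0\times X^0)$ of the full MHD system below with initial data $(v_0,B_0,E_0)$. Moreover, if $v_0,B_0,E_0\in C^\infty$, then $(v,B,E)\in C^\infty([0,T]\times\mathbb{R}^3)$ (viewing the fields as periodic functions on $\mathbb{R}^3$).
   Context: The system (full MHD / Navier–Stokes–Maxwell) for $v,E,B:\mathbb{R}^+\times\mathbb{T}^3\to\mathbb{R}^3$ and scalar pressure $p$, with viscosity $\nu>0$ and conductivity normalized to $\sigma=1$, is: $\partial_t v+v\cdot\nabla v-\nu\Delta v+\nabla p=j\times B$, $\partial_t E-\nabla\times B=-j$, $\partial_t B+\nabla\times E=0$, $\operatorname{div}v=\operatorname{div}B=0$, $j=\sigma(E+v\times B)$, with $v(0)=v_0$, $B(0)=B_0$, $E(0)=E_0$. Periodic functions are expanded as $f(x)=\sum_{n\in\mathbb{Z}^3}\hat f(n)e^{in\cdot x}$, and $X^0:=\{u: \|u\|:=\sum_{n\in\mathbb{Z}^3}|\hat u(n)|<\infty\}$. $\mathbf P$ is the Leray projection onto divergence-free fields, and $E=\tilde E+\bar E$ with $\tilde E=\mathbf P E$, $\bar E=\nabla(-\Delta)^{-1}\operatorname{div}E$. Let $\mathcal L_1(t),\mathcal L_2(t)$ be the Fourier multipliers with symbols $\Phi_1(t,n)=e^{-t/2}\cos(\sqrt{|n|^2-1/4}\,t)$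 and $\Phi_2(t,n)=e^{-t/2}\sin(\sqrt{|n|^2-1/4}\,t)/\sqrt{|n|^2-1/4}$ (the propagators of the damped wave equation $\partial_{tt}w-\Delta w+\partial_t w=0$). A mild solution is a triple $(v,B,E)$ satisfying the Duhamel formulation: $v(t)=e^{t\nu\Delta}v_0-\int_0^t e^{(t-s)\nu\Delta}\mathbf P[\nabla\cdot(v\otimes v)-E\times B-(v\times B)\times B](s)\,ds$; $B(t)=\mathcal L_1(t)B_0+\mathcal L_2(t)(B_0/2+B_1)+\int_0^t\mathcal L_2(t-s)[\nabla\times(v\times B)](s)\,ds$ with $B_1=-\nabla\times E_0$; $\tilde E$ is the Duhamel solution of $\partial_{tt}\tilde E-\Delta\tilde E+\partial_t\tilde E=-\partial_t\mathbf P(v\times B)$ with $\tilde E(0)=\mathbf P E_0$ and $\partial_t\tilde E(0)=\tilde E_1:=\mathbf P(\nabla\times B_0-E_0-v_0\times B_0)$, i.e. $\tilde E(t)=\mathcal L_1(t)\tilde E(0)+\mathcal L_2(t)(\tilde E(0)/2+\tilde E_1)-\int_0^t\mathcal L_2(t-s)\partial_s\mathbf P(v\times B)(s)\,ds$; and $\bar E(t)=e^{-t}\bar E(0)-\int_0^t e^{-(t-s)}\nabla(-\Delta)^{-1}\operatorname{div}(v\times B)(s)\,ds$, with $E=\tilde E+\bar E$.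
   Formalization: The gradient part Ē is taken as ∇Δ^{-1}div E (sign corrected from ∇(-Δ)^{-1}div, which would contradict E=PE+Ē and E(0)=E_0), and the term with ∂_sP(v×B), undefined for merely continuous solutions, is read in integrated-by-parts form. *)

theory Defs
  imports "HOL-Analysis.Analysis"
begin

text \<open>Periodic fields on the torus T^3 are represented by their Fourier coefficients
  c :: int^3 => complex^3, i.e. f(x) = sum_n c(n) e^{i n.x}.\<close>

type_synonym coeffs = "int^3 \<Rightarrow> complex^3"

definition nreal :: "int^3 \<Rightarrow> real^3" where
  "nreal n = (\<chi> i. of_int (n $ i))"

definition ncplx :: "int^3 \<Rightarrow> complex^3" where
  "ncplx n = (\<chi> i. of_int (n $ i))"

definition nsq :: "int^3 \<Rightarrow> real" where
  "nsq n = nreal n \<bullet> nreal n"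

definition cscale :: "complex \<Rightarrow> complex^3 \<Rightarrow> complex^3" where
  "cscale a u = (\<chi> i. a * u $ i)"

definition cdot :: "complex^3 \<Rightarrow> complex^3 \<Rightarrow> complex" where
  "cdot u w = (\<Sum>i\<in>UNIV. u $ i * w $ i)"

definition ccross :: "complex^3 \<Rightarrow> complex^3 \<Rightarrow> complex^3" where
  "ccross u w = vector [u$2 * w$3 - u$3 * w$2, u$3 * w$1 - u$1 * w$3, u$1 * w$2 - u$2 * w$1]"

definition X0 :: "coeffs set" where
  "X0 = {c. (\<lambda>n. norm (c n)) summable_on UNIV}"

definition X0norm :: "coeffs \<Rightarrow> real" where
  "X0norm c = (\<Sum>\<^sub>\<infinity>n. norm (c n))"

definition real_field :: "coeffs \<Rightarrow> bool" where
  "real_field c \<longleftrightarrow> (\<forall>n. c (- n) = (\<chi> i. cnj (c n $ i)))"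

definition div_free :: "coeffs \<Rightarrow> bool" where
  "div_free c \<longleftrightarrow> (\<forall>n. cdot (ncplx n) (c n) = 0)"

definition leray :: "int^3 \<Rightarrow> complex^3 \<Rightarrow> complex^3" where
  "leray n u = u - cscale (cdot (ncplx n) u / of_real (nsq n)) (ncplx n)"

text \<open>Gradient part: the projection nabla Delta^{-1} div, symbol n n^T/|n|^2 (zero at n = 0).\<close>
definition gradpart :: "int^3 \<Rightarrow> complex^3 \<Rightarrow> complex^3" where
  "gradpart n u = cscale (cdot (ncplx n) u / of_real (nsq n)) (ncplx n)"

definition curl_m :: "int^3 \<Rightarrow> complex^3 \<Rightarrow> complex^3" where
  "curl_m n u = cscale \<i> (ccross (ncplx n) u)"

definition omega :: "int^3 \<Rightarrow> complex" where
  "omega n = csqrt (of_real (nsq n - 1/4))"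

text \<open>Damped wave propagators Phi_1, Phi_2 (complex square root makes n = 0 correct).\<close>
definition Phi1 :: "real \<Rightarrow> int^3 \<Rightarrow> complex" where
  "Phi1 t n = of_real (exp (-t/2)) * cos (omega n * of_real t)"

definition Phi2 :: "real \<Rightarrow> int^3 \<Rightarrow> complex" where
  "Phi2 t n = of_real (exp (-t/2)) * sin (omega n * of_real t) / omega n"

definition dPhi2 :: "real \<Rightarrow> int^3 \<Rightarrow> complex" where
  "dPhi2 t n = Phi1 t n - Phi2 t n / 2"

definition conv :: "(complex^3 \<Rightarrow> complex^3 \<Rightarrow> complex^3) \<Rightarrow> coeffs \<Rightarrow> coeffs \<Rightarrow> coeffs" where
  "conv b f g n = (\<Sum>\<^sub>\<infinity>m. b (f m) (g (n - m)))"

definition cross_f :: "coeffs \<Rightarrow> coeffs \<Rightarrow> coeffs" where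
  "cross_f f g = conv ccross f g"

definition div_tensor :: "coeffs \<Rightarrow> coeffs" where
  "div_tensor v n = cscale \<i> (\<Sum>\<^sub>\<infinity>m. cscale (cdot (ncplx n) (v m)) (v (n - m)))"

definition heat :: "real \<Rightarrow> real \<Rightarrow> int^3 \<Rightarrow> complex" where
  "heat \<nu> t n = of_real (exp (- \<nu> * t * nsq n))"

text \<open>Mild solution on [0,T] (Duhamel formulation, coefficientwise).  The term
  -int_0^t L2(t-s) d/ds P(v x B)(s) ds is understood in its integrated-by-parts form
  L2(t) P(v x B)(0) - int_0^t (L1 - L2/2)(t-s) P(v x B)(s) ds.\<close>
definition mild_solution ::
  "real \<Rightarrow> real \<Rightarrow> coeffs \<Rightarrow> coeffs \<Rightarrow> coeffs \<Rightarrow>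
   (real \<Rightarrow> coeffs) \<Rightarrow> (real \<Rightarrow> coeffs) \<Rightarrow> (real \<Rightarrow> coeffs) \<Rightarrow> bool" where
  "mild_solution \<nu> T v0 B0 E0 v B E \<longleftrightarrow>
     (\<forall>t\<in>{0..T}. \<forall>n.
        v t n = cscale (heat \<nu> t n) (v0 n)
          - integral {0..t} (\<lambda>s. cscale (heat \<nu> (t - s) n)
               (leray n (div_tensor (v s) n - cross_f (E s) (B s) n
                          - cross_f (cross_f (v s) (B s)) (B s) n)))
      \<and> B t n = cscale (Phi1 t n) (B0 n)
          + cscale (Phi2 t n) (cscale (1/2) (B0 n) - curl_m n (E0 n))
          + integral {0..t} (\<lambda>s. cscale (Phi2 (t - s) n) (curl_m n (cross_f (v s) (B s) n)))
      \<and> E t n =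
          (cscale (Phi1 t n) (leray n (E0 n))
           + cscale (Phi2 t n) (cscale (1/2) (leray n (E0 n))
               + leray n (curl_m n (B0 n) - E0 n - cross_f v0 B0 n))
           + cscale (Phi2 t n) (leray n (cross_f v0 B0 n))
           - integral {0..t} (\<lambda>s. cscale (dPhi2 (t - s) n) (leray n (cross_f (v s) (B s) n))))
        + (cscale (of_real (exp (-t))) (gradpart n (E0 n))
           - integral {0..t} (\<lambda>s. cscale (of_real (exp (-(t - s)))) (gradpart n (cross_f (v s) (B s) n)))))"

definition cont_X0 :: "real \<Rightarrow> (real \<Rightarrow> coeffs) \<Rightarrow> bool" where
  "cont_X0 T u \<longleftrightarrow> (\<forall>t\<in>{0..T}. u t \<in> X0 \<and> real_field (u t)) \<and>
     (\<forall>t0\<in>{0..T}. ((\<lambda>t. X0norm (\<lambda>n. u t n - u t0 n)) \<longlongrightarrow> 0) (at t0 within {0..T}))"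

definition realize :: "coeffs \<Rightarrow> real^3 \<Rightarrow> real^3" where
  "realize c x = (\<chi> i. Re (\<Sum>\<^sub>\<infinity>n. c n $ i * cis (nreal n \<bullet> x)))"

fun Ck_on :: "nat \<Rightarrow> 'a::euclidean_space set \<Rightarrow> ('a \<Rightarrow> 'b::real_normed_vector) \<Rightarrow> bool" where
  "Ck_on 0 S f \<longleftrightarrow> continuous_on S f"
| "Ck_on (Suc k) S f \<longleftrightarrow> (\<exists>f'. (\<forall>x\<in>S. (f has_derivative f' x) (at x within S))
       \<and> (\<forall>i\<in>Basis. Ck_on k S (\<lambda>x. f' x i)))"

definition smooth_on :: "'a::euclidean_space set \<Rightarrow> ('a \<Rightarrow> 'b::real_normed_vector) \<Rightarrow> bool" where
  "smooth_on S f \<longleftrightarrow> (\<forall>k. Ck_on k S f)"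

end

theory Submission
  imports Defs
begin

text \<open>The three Duhamel formulas are one equation \<open>z = lin + \<integral> kern (t - s) (nonlin (z s)) ds\<close> for the triple
  \<open>z = (v, B, E)\<close>, with a quadratic plus cubic convolution nonlinearity and kernels bounded by
  \<open>1 + |n| exp (- \<nu> \<tau> |n|^2)\<close>.  Frequency by frequency, their time integrals against \<open>exp (\<lambda> s)\<close> are at most
  \<open>eps \<lambda> * exp (\<lambda> t)\<close> with \<open>eps \<lambda>\<close> tending to 0.  Hence on sets bounded in l1 the Duhamel map contracts for the norm
  \<open>sup {exp (- \<lambda> t) * |z t n|}\<close>, which gives uniqueness on the whole interval and convergence of the Picard iteration.
  The iterates stay below time-independent majorants \<open>U n\<close> defined by a scalar recursion.  The same smallness
  condition bounds the recursion in every l1 space with submultiplicative weight, so \<open>U\<close> decreases rapidly when the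
  data do, without shortening the time interval.  Time derivatives are then read off the Duhamel formula, and
  smooth data have rapidly decreasing coefficients because iterated finite differences of a smooth
  periodic field are bounded.\<close>

section \<open>Absolutely summable families and convolution\<close>

text \<open>The kernel bound comes from balancing derivative losses. In the velocity equation the
  divergence costs a factor |n|, which the heat kernel returns only after integration in time. In
  the magnetic equation the curl costs |n| too, but |n| \<open>Phi2\<close> is bounded. In the
  electric equation a time derivative falls on P(v x B); integration by parts moves it to the
  propagator and leaves the bounded kernel \<open>dPhi2\<close>. So all three equations fit the same
  estimate. Contraction in the supremum over frequencies suits the products, since an l1 family
  convolved with a bounded one is bounded, but by itself it would lose summability of the limit. The
  time-independent majorants restore it: coefficientwise continuity and convergence under one
  summable bound yield continuity in l1 by dominated convergence. Real-valuedness is treated as a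
  symmetry: conjugation combined with n -> -n commutes with every symbol and product of the system,
  hence is kept by each Picard iterate and by the limit.\<close>

abbreviation l1 :: "('i \<Rightarrow> 'a::real_normed_vector) \<Rightarrow> bool" where
  "l1 f \<equiv> (\<lambda>n. norm (f n)) summable_on UNIV"

definition l1norm :: "('i \<Rightarrow> 'a::real_normed_vector) \<Rightarrow> real" where
  "l1norm f = (\<Sum>\<^sub>\<infinity>n. norm (f n))"

lemma l1norm_nonneg [simp]: "0 \<le> l1norm f"
  by (simp add: l1norm_def infsum_nonneg)

lemma norm_le_l1norm:
  assumes "l1 f"
  shows "norm (f n) \<le> l1norm f"
  using finite_sum_le_infsum[OF assms, of "{n}"] by (simp add: l1norm_def)

lemma l1norm_leI:
  assumes "F summable_on UNIV" "\<And>n. norm (f n) \<le> F n"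
  shows "l1 f" "l1norm f \<le> (\<Sum>\<^sub>\<infinity>n. F n)"
proof -
  show 1: "l1 f"
    using assms by (intro Infinite_Sum.abs_summable_on_comparison_test') auto
  show "l1norm f \<le> (\<Sum>\<^sub>\<infinity>n. F n)"
    unfolding l1norm_def using assms 1 by (intro infsum_mono) auto
qed

lemma abs_summable_diff:
  fixes f g :: "'i \<Rightarrow> 'a::real_normed_vector"
  assumes "l1 f" "l1 g"
  shows "l1 (\<lambda>n. f n - g n)"
  by (rule l1norm_leI(1)[OF summable_on_add[OF assms]]) (simp add: norm_triangle_ineq4)

lemma nonneg_summable_iff_finite_sums:
  fixes F :: "'i \<Rightarrow> real"
  assumes "\<And>n. 0 \<le> F n" "\<And>A. finite A \<Longrightarrow> sum F A \<le> c"
  shows "F summable_on UNIV" "(\<Sum>\<^sub>\<infinity>n. F n) \<le> c"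
proof -
  show "F summable_on UNIV"
    by (rule nonneg_bdd_above_summable_on) (use assms in \<open>auto intro!: bdd_aboveI2\<close>)
  then show "(\<Sum>\<^sub>\<infinity>n. F n) \<le> c"
    by (rule infsum_le_finite_sums) (use assms in auto)
qed

text \<open>The constant is explicit so that one \<open>Q\<close> can serve all products of the
  system at once and can enter the scalar recursion for the majorants.\<close>

definition bilinear_with :: "('a::real_normed_vector \<Rightarrow> 'b::real_normed_vector \<Rightarrow> 'c::real_normed_vector) \<Rightarrow> real \<Rightarrow> bool" where
  "bilinear_with b Q \<longleftrightarrow> bounded_bilinear b \<and> 0 \<le> Q \<and> (\<forall>x y. norm (b x y) \<le> Q * norm x * norm y)"

lemma bilinear_withD:
  assumes "bilinear_with b Q"
  shows "bounded_bilinear b" "0 \<le> Q" "norm (b x y) \<le> Q * norm x * norm y"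
  using assms by (auto simp: bilinear_with_def)

lemma bilinear_with_flip:
  assumes "bilinear_with b Q"
  shows "bilinear_with (\<lambda>x y. b y x) Q"
  using assms bounded_bilinear.flip by (auto simp: bilinear_with_def mult_ac)

lemma bilinear_with_mult: "bilinear_with ((*) :: real \<Rightarrow> real \<Rightarrow> real) 1"
  by (auto simp: bilinear_with_def bounded_bilinear_mult norm_mult abs_mult)

lemma bilinear_with_mono:
  assumes "bilinear_with b Q" "Q \<le> Q'"
  shows "bilinear_with b Q'"
proof -
  have "Q * norm x * norm y \<le> Q' * norm x * norm y" for x :: 'a and y :: 'b
    using assms by (intro mult_right_mono) auto
  then show ?thesis using assms unfolding bilinear_with_def
    by (meson order_trans)
qed

lemma bounded_bilinear_bilinear_with:
  assumes "bounded_bilinear b"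
  obtains Q where "bilinear_with b Q"
proof -
  from bounded_bilinear.nonneg_bounded[OF assms]
  obtain K where "0 \<le> K" "\<And>a c. norm (b a c) \<le> norm a * norm c * K" by blast
  then have "bilinear_with b K" using assms by (auto simp: bilinear_with_def mult_ac)
  then show ?thesis by (rule that)
qed

text \<open>The sum of \<open>conv\<close>, but over any abelian group and with factors of different
  types, so that nested products, tensor products and scalar majorants are all covered.\<close>

definition convolve :: "('a \<Rightarrow> 'b \<Rightarrow> 'c) \<Rightarrow> ('i::ab_group_add \<Rightarrow> 'a) \<Rightarrow> ('i \<Rightarrow> 'b) \<Rightarrow> 'i \<Rightarrow> 'c::banach" where
  "convolve b f g n = (\<Sum>\<^sub>\<infinity>m. b (f m) (g (n - m)))"

lemma bij_diff_left: "bij (\<lambda>m. n - m :: 'i::ab_group_add)"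
  by (rule bij_betw_byWitness[where f'="\<lambda>m. n - m"]) auto

lemma convolve_flip: "convolve b f g n = convolve (\<lambda>x y. b y x) g f n"
  unfolding convolve_def
  using infsum_reindex_bij_betw[OF bij_diff_left, of "\<lambda>m. b (f (n - m)) (g m)" n]
  by simp

text \<open>Only one factor is summable, the other merely bounded. This estimate is what later lets
  differences of two solutions be measured by a supremum over frequencies.\<close>

lemma convolve_summable:
  assumes b: "bilinear_with b Q" and f: "l1 f" and g: "\<And>n. norm (g n) \<le> d"
  shows "l1 (\<lambda>m. b (f m) (g (n - m)))"
    and "norm (convolve b f g n) \<le> Q * l1norm f * d"
proof -
  have le: "norm (b (f m) (g (n - m))) \<le> norm (f m) * (Q * d)" for m
  proof -
    have "norm (b (f m) (g (n - m))) \<le> Q * norm (f m) * norm (g (n - m))"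
      using bilinear_withD[OF b] by blast
    also have "\<dots> \<le> Q * norm (f m) * d"
      using bilinear_withD[OF b] g by (intro mult_left_mono) auto
    finally show ?thesis by (simp add: mult_ac)
  qed
  have s: "(\<lambda>m. norm (f m) * (Q * d)) summable_on UNIV"
    by (rule summable_on_cmult_left[OF f])
  show 1: "l1 (\<lambda>m. b (f m) (g (n - m)))"
    by (rule l1norm_leI(1)[OF s le])
  have "norm (convolve b f g n) \<le> (\<Sum>\<^sub>\<infinity>m. norm (b (f m) (g (n - m))))"
    unfolding convolve_def by (rule norm_infsum_bound[OF 1])
  also have "\<dots> \<le> (\<Sum>\<^sub>\<infinity>m. norm (f m) * (Q * d))"
    using l1norm_leI(2)[OF s le] by (simp add: l1norm_def)
  also have "\<dots> = Q * l1norm f * d"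
    using infsum_cmult_left[of "Q * d" "\<lambda>m. norm (f m)" UNIV] f by (simp add: l1norm_def mult_ac)
  finally show "norm (convolve b f g n) \<le> Q * l1norm f * d" .
qed

lemma convolve_bound_right:
  assumes b: "bilinear_with b Q" and "\<And>n. norm (f n) \<le> d" and "l1 g"
  shows "norm (convolve b f g n) \<le> Q * d * l1norm g"
  using convolve_summable(2)[OF bilinear_with_flip[OF b] assms(3,2)] convolve_flip[of b f g n]
  by (simp add: mult_ac)

lemma convolve_diff:
  assumes b: "bilinear_with b Q"
    and "l1 f" "l1 f'" "l1 g" "l1 g'"
  shows "convolve b f g n - convolve b f' g' n
    = convolve b (\<lambda>n. f n - f' n) g n + convolve b f' (\<lambda>n. g n - g' n) n"
proof -
  interpret bounded_bilinear b using b by (rule bilinear_withD)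
  have s: "(\<lambda>m. b (F m) (G (n - m))) summable_on UNIV"
    if "l1 F" "l1 G" for F G
    by (rule abs_summable_summable[OF convolve_summable(1)[OF b that(1) norm_le_l1norm[OF that(2)]]])
  have "convolve b (\<lambda>n. f n - f' n) g n + convolve b f' (\<lambda>n. g n - g' n) n
     = (\<Sum>\<^sub>\<infinity>m. b (f m - f' m) (g (n - m)) + b (f' m) (g (n - m) - g' (n - m)))"
    unfolding convolve_def using assms
    by (intro infsum_add[symmetric] s abs_summable_diff)
  also have "\<dots> = (\<Sum>\<^sub>\<infinity>m. b (f m) (g (n - m)) + - b (f' m) (g' (n - m)))"
    by (simp add: diff_left diff_right)
  also have "\<dots> = convolve b f g n + (\<Sum>\<^sub>\<infinity>m. - b (f' m) (g' (n - m)))"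
    unfolding convolve_def using assms s[of f' g']
    by (intro infsum_add s) (auto simp: summable_on_uminus)
  also have "\<dots> = convolve b f g n - convolve b f' g' n"
    by (simp add: convolve_def infsum_uminus)
  finally show ?thesis ..
qed

lemma convolve_nonneg:
  fixes F G :: "'i::ab_group_add \<Rightarrow> real"
  assumes "\<And>n. 0 \<le> F n" "\<And>n. 0 \<le> G n"
  shows "0 \<le> convolve (*) F G n"
  unfolding convolve_def using assms by (intro infsum_nonneg) auto

lemma nonneg_abs_summable:
  fixes F :: "'i \<Rightarrow> real"
  assumes "\<And>n. 0 \<le> F n" "F summable_on UNIV"
  shows "l1 F" "l1norm F = (\<Sum>\<^sub>\<infinity>n. F n)"
  using assms by (auto simp: l1norm_def)

lemma convolve_real_summable:
  fixes F G :: "'i::ab_group_add \<Rightarrow> real"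
  assumes "\<And>n. 0 \<le> F n" "\<And>n. 0 \<le> G n" "F summable_on UNIV" "G summable_on UNIV"
  shows "(\<lambda>m. F m * G (n - m)) summable_on UNIV"
  by (rule abs_summable_summable[OF convolve_summable(1)[OF bilinear_with_mult nonneg_abs_summable(1)
        norm_le_l1norm[OF nonneg_abs_summable(1)]]]) (use assms in auto)

text \<open>Tonelli for a nonnegative double family: summing over n first only translates the sum of
  \<open>G\<close>, so the double sum factorises.\<close>

lemma convolve_real_l1:
  fixes F G :: "'i::ab_group_add \<Rightarrow> real"
  assumes F: "\<And>n. 0 \<le> F n" and G: "\<And>n. 0 \<le> G n" and "F summable_on UNIV" "G summable_on UNIV"
  shows "convolve (*) F G summable_on UNIV"
    and "(\<Sum>\<^sub>\<infinity>n. convolve (*) F G n) = (\<Sum>\<^sub>\<infinity>n. F n) * (\<Sum>\<^sub>\<infinity>n. G n)"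
proof -
  have bij: "bij (\<lambda>n. n - m :: 'i)" for m
    by (rule bij_betw_byWitness[where f'="\<lambda>n. n + m"]) auto
  have G': "((\<lambda>n. G (n - m)) has_sum (\<Sum>\<^sub>\<infinity>n. G n)) UNIV" for m
    using has_sum_reindex_bij_betw[OF bij, of G m "\<Sum>\<^sub>\<infinity>n. G n"] assms by simp
  have inner: "((\<lambda>n. F m * G (n - m)) has_sum F m * (\<Sum>\<^sub>\<infinity>n. G n)) UNIV" for m
    by (rule has_sum_cmult_right[OF G'])
  have p: "(\<lambda>(m, n). F m * G (n - m)) summable_on UNIV \<times> UNIV"
    by (rule summable_on_SigmaI[where g="\<lambda>m. F m * (\<Sum>\<^sub>\<infinity>n. G n)"])
       (use inner assms in \<open>auto intro: summable_on_cmult_left\<close>)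
  have p': "(\<lambda>(n, m). F m * G (n - m)) summable_on UNIV \<times> UNIV"
    using summable_on_swap[of "\<lambda>(m, n). F m * G (n - m)" UNIV UNIV] p by simp
  show "convolve (*) F G summable_on UNIV"
    using summable_on_Sigma_banach[OF p'] by (simp add: convolve_def[abs_def])
  have "(\<Sum>\<^sub>\<infinity>n. convolve (*) F G n) = (\<Sum>\<^sub>\<infinity>m. \<Sum>\<^sub>\<infinity>n. F m * G (n - m))"
    unfolding convolve_def by (rule infsum_swap_banach[OF p'])
  also have "\<dots> = (\<Sum>\<^sub>\<infinity>m. F m * (\<Sum>\<^sub>\<infinity>n. G n))"
    using inner by (intro infsum_cong) (simp add: infsumI)
  also have "\<dots> = (\<Sum>\<^sub>\<infinity>n. F n) * (\<Sum>\<^sub>\<infinity>n. G n)"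
    using assms by (simp add: infsum_cmult_left)
  finally show "(\<Sum>\<^sub>\<infinity>n. convolve (*) F G n) = (\<Sum>\<^sub>\<infinity>n. F n) * (\<Sum>\<^sub>\<infinity>n. G n)" .
qed

text \<open>Reduces every vector-valued product to a scalar convolution of majorants, for which the
  weighted estimates are proved.\<close>

lemma convolve_majorant:
  fixes F G :: "'i::ab_group_add \<Rightarrow> real"
  assumes b: "bilinear_with b Q"
    and f: "\<And>n. norm (f n) \<le> F n" and g: "\<And>n. norm (g n) \<le> G n"
    and "F summable_on UNIV" "G summable_on UNIV"
  shows "norm (convolve b f g n) \<le> Q * convolve (*) F G n"
proof -
  have F: "0 \<le> F n" "0 \<le> G n" for n using f g norm_ge_zero order_trans by blast+
  note s = convolve_real_summable[of F G n, OF F assms(4,5)]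
  have le: "norm (b (f m) (g (n - m))) \<le> Q * (F m * G (n - m))" for m
  proof -
    have "norm (b (f m) (g (n - m))) \<le> Q * norm (f m) * norm (g (n - m))"
      using bilinear_withD[OF b] by blast
    also have "\<dots> \<le> Q * F m * G (n - m)"
      using bilinear_withD[OF b] f g F by (intro mult_mono) auto
    finally show ?thesis by (simp add: mult_ac)
  qed
  have s': "(\<lambda>m. Q * (F m * G (n - m))) summable_on UNIV"
    by (rule summable_on_cmult_right[OF s])
  have "norm (convolve b f g n) \<le> (\<Sum>\<^sub>\<infinity>m. norm (b (f m) (g (n - m))))"
    unfolding convolve_def by (rule norm_infsum_bound[OF l1norm_leI(1)[OF s' le]])
  also have "\<dots> \<le> (\<Sum>\<^sub>\<infinity>m. Q * (F m * G (n - m)))"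
    using l1norm_leI(2)[OF s' le] by (simp add: l1norm_def)
  also have "\<dots> = Q * convolve (*) F G n"
    unfolding convolve_def using s by (rule infsum_cmult_right)
  finally show ?thesis .
qed

lemma convolve_l1:
  assumes b: "bilinear_with b Q" and f: "l1 f" and g: "l1 g"
  shows "l1 (convolve b f g)"
    and "l1norm (convolve b f g) \<le> Q * l1norm f * l1norm g"
proof -
  note r = convolve_real_l1[of "\<lambda>n. norm (f n)" "\<lambda>n. norm (g n)", OF norm_ge_zero norm_ge_zero f g]
  have le: "norm (convolve b f g n) \<le> Q * convolve (*) (\<lambda>n. norm (f n)) (\<lambda>n. norm (g n)) n" for n
    by (rule convolve_majorant[OF b order_refl order_refl f g])
  have s: "(\<lambda>n. Q * convolve (*) (\<lambda>n. norm (f n)) (\<lambda>n. norm (g n)) n) summable_on UNIV"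
    by (rule summable_on_cmult_right[OF r(1)])
  show "l1 (convolve b f g)" by (rule l1norm_leI(1)[OF s le])
  have "l1norm (convolve b f g) \<le> (\<Sum>\<^sub>\<infinity>n. Q * convolve (*) (\<lambda>n. norm (f n)) (\<lambda>n. norm (g n)) n)"
    by (rule l1norm_leI(2)[OF s le])
  also have "\<dots> = Q * l1norm f * l1norm g"
    using r by (simp add: infsum_cmult_right l1norm_def mult_ac)
  finally show "l1norm (convolve b f g) \<le> Q * l1norm f * l1norm g" .
qed

lemma convolve_real_mono:
  fixes F G F' G' :: "'i::ab_group_add \<Rightarrow> real"
  assumes "\<And>n. 0 \<le> F n" "\<And>n. 0 \<le> G n" "\<And>n. F n \<le> F' n" "\<And>n. G n \<le> G' n"
    and "F' summable_on UNIV" "G' summable_on UNIV"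
  shows "convolve (*) F G n \<le> convolve (*) F' G' n"
  using convolve_majorant[OF bilinear_with_mult, of F F' G G' n] assms by simp

section \<open>Weighted l1 spaces with submultiplicative weights\<close>

definition submult_weight :: "('i::ab_group_add \<Rightarrow> real) \<Rightarrow> bool" where
  "submult_weight w \<longleftrightarrow> (\<forall>n. 1 \<le> w n) \<and> (\<forall>m n. w (m + n) \<le> w m * w n)"

lemma submult_weightD:
  assumes "submult_weight w"
  shows "1 \<le> w n" "0 \<le> w n" "w (m + n) \<le> w m * w n"
  using assms unfolding submult_weight_def by (auto intro: order_trans[of 0 1])

lemma submult_weight_1: "submult_weight (\<lambda>_. 1)"
  by (simp add: submult_weight_def)

lemma weighted_summable_imp_summable:
  assumes "submult_weight w" "\<And>n. 0 \<le> F n" "(\<lambda>n. w n * F n) summable_on UNIV"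
  shows "F summable_on UNIV"
proof (rule summable_on_comparison_test[OF assms(3)])
  fix n
  show "F n \<le> w n * F n"
    using mult_right_mono[OF submult_weightD(1)[OF assms(1)] assms(2)] by simp
qed (use assms in auto)

text \<open>Since n = m + (n - m), submultiplicativity distributes the weight over the two factors;
  after that the unweighted product formula applies.\<close>

lemma convolve_weighted:
  fixes F G :: "'i::ab_group_add \<Rightarrow> real"
  assumes w: "submult_weight w" and F: "\<And>n. 0 \<le> F n" and G: "\<And>n. 0 \<le> G n"
    and sF: "(\<lambda>n. w n * F n) summable_on UNIV" and sG: "(\<lambda>n. w n * G n) summable_on UNIV"
  shows "(\<lambda>n. w n * convolve (*) F G n) summable_on UNIV"
    and "(\<Sum>\<^sub>\<infinity>n. w n * convolve (*) F G n) \<le> (\<Sum>\<^sub>\<infinity>n. w n * F n) * (\<Sum>\<^sub>\<infinity>n. w n * G n)"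
proof -
  note w' = submult_weightD[OF w]
  have nn: "0 \<le> w n * F n" "0 \<le> w n * G n" for n using w' F G by auto
  note l1 = convolve_real_l1[of "\<lambda>n. w n * F n" "\<lambda>n. w n * G n", OF nn sF sG]
  note sF' = weighted_summable_imp_summable[OF w F sF] and sG' = weighted_summable_imp_summable[OF w G sG]
  have le: "w n * convolve (*) F G n \<le> convolve (*) (\<lambda>n. w n * F n) (\<lambda>n. w n * G n) n" for n
  proof -
    have "w n * convolve (*) F G n = (\<Sum>\<^sub>\<infinity>m. w n * (F m * G (n - m)))"
      unfolding convolve_def
      by (rule infsum_cmult_right[symmetric]) (use convolve_real_summable[OF F G sF' sG'] in auto)
    also have "\<dots> \<le> (\<Sum>\<^sub>\<infinity>m. w m * F m * (w (n - m) * G (n - m)))"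
    proof (rule infsum_mono)
      show "(\<lambda>m. w n * (F m * G (n - m))) summable_on UNIV"
        by (rule summable_on_cmult_right[OF convolve_real_summable[OF F G sF' sG']])
      show "(\<lambda>m. w m * F m * (w (n - m) * G (n - m))) summable_on UNIV"
        using convolve_real_summable[of "\<lambda>n. w n * F n" "\<lambda>n. w n * G n", OF nn sF sG] .
      fix m
      have "w n \<le> w m * w (n - m)" using w'(3)[of m "n - m"] by simp
      then have "w n * (F m * G (n - m)) \<le> w m * w (n - m) * (F m * G (n - m))"
        using F G by (intro mult_right_mono) auto
      then show "w n * (F m * G (n - m)) \<le> w m * F m * (w (n - m) * G (n - m))"
        by (simp add: mult_ac)
    qed
    finally show ?thesis by (simp add: convolve_def)
  qed
  have nn': "0 \<le> w n * convolve (*) F G n" for n using w' convolve_nonneg[of F G, OF F G] by auto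
  show s: "(\<lambda>n. w n * convolve (*) F G n) summable_on UNIV"
    by (rule summable_on_comparison_test[OF l1(1) le nn'])
  have "(\<Sum>\<^sub>\<infinity>n. w n * convolve (*) F G n) \<le> (\<Sum>\<^sub>\<infinity>n. convolve (*) (\<lambda>n. w n * F n) (\<lambda>n. w n * G n) n)"
    by (rule infsum_mono[OF s l1(1) le])
  then show "(\<Sum>\<^sub>\<infinity>n. w n * convolve (*) F G n) \<le> (\<Sum>\<^sub>\<infinity>n. w n * F n) * (\<Sum>\<^sub>\<infinity>n. w n * G n)"
    using l1(2) by simp
qed

section \<open>Termwise continuity and differentiation of infinite sums\<close>

lemma continuous_on_infsum:
  fixes f :: "'i \<Rightarrow> 'b::topological_space \<Rightarrow> 'c::banach"
  assumes "\<And>i. continuous_on S (f i)" "\<And>i x. x \<in> S \<Longrightarrow> norm (f i x) \<le> V i" "V summable_on UNIV"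
  shows "continuous_on S (\<lambda>x. \<Sum>\<^sub>\<infinity>i. f i x)"
proof (rule uniform_limit_theorem)
  show "uniform_limit S (\<lambda>X y. \<Sum>x\<in>X. f x y) (\<lambda>y. \<Sum>\<^sub>\<infinity>x. f x y) (finite_subsets_at_top UNIV)"
    by (rule Weierstrass_m_test_general) (use assms in auto)
  show "\<forall>\<^sub>F n in finite_subsets_at_top UNIV. continuous_on S (\<lambda>y. \<Sum>x\<in>n. f x y)"
    by (intro always_eventually allI continuous_on_sum assms)
qed (rule finite_subsets_at_top_neq_bot)

lemma infsum_tail_small:
  fixes V :: "'i \<Rightarrow> real"
  assumes "V summable_on UNIV" "\<And>i. 0 \<le> V i" "0 < e"
  obtains F where "finite F" "(\<Sum>\<^sub>\<infinity>i\<in>-F. V i) < e"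
proof -
  obtain F where F: "finite F" "dist (sum V F) (\<Sum>\<^sub>\<infinity>i. V i) \<le> e/2"
    using infsum_finite_approximation[OF assms(1), of "e/2"] assms(3) by auto
  have "(\<Sum>\<^sub>\<infinity>i. V i) = (\<Sum>\<^sub>\<infinity>i\<in>F. V i) + (\<Sum>\<^sub>\<infinity>i\<in>-F. V i)"
    using infsum_Un_disjoint[of V F "-F"] summable_on_subset_banach[OF assms(1)] by auto
  then have "(\<Sum>\<^sub>\<infinity>i\<in>-F. V i) = (\<Sum>\<^sub>\<infinity>i. V i) - sum V F" using F by simp
  also have "\<dots> < e" using F(2) assms(3) unfolding dist_real_def by linarith
  finally show ?thesis using that F by blast
qed

text \<open>A finite part is differentiated term by term. On the tail, the increment of each term
  and its linear part are both at most \<open>V i\<close> times the length of the step; the former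
  is the mean value inequality, for which \<open>S\<close> is convex.\<close>

lemma has_derivative_infsum:
  fixes f :: "'i \<Rightarrow> 'a::real_normed_vector \<Rightarrow> 'b::banach"
  assumes S: "convex S"
    and d: "\<And>i x. x \<in> S \<Longrightarrow> (f i has_derivative f' i x) (at x within S)"
    and V: "\<And>i x h. x \<in> S \<Longrightarrow> norm (f' i x h) \<le> V i * norm h"
    and sV: "V summable_on UNIV" and Vnn: "\<And>i. 0 \<le> V i"
    and sf: "\<And>x. x \<in> S \<Longrightarrow> (\<lambda>i. f i x) summable_on UNIV"
    and x: "x \<in> S"
  shows "((\<lambda>x. \<Sum>\<^sub>\<infinity>i. f i x) has_derivative (\<lambda>h. \<Sum>\<^sub>\<infinity>i. f' i x h)) (at x within S)"
proof -
  have sf': "l1 (\<lambda>i. f' i x h)" for h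
    by (rule l1norm_leI(1)[OF summable_on_cmult_left[OF sV] V[OF x]])
  have bl: "bounded_linear (f' i x)" for i using d[OF x] has_derivative_bounded_linear by blast
  have lin: "bounded_linear (\<lambda>h. \<Sum>\<^sub>\<infinity>i. f' i x h)"
  proof (rule bounded_linear_intro[where K="\<Sum>\<^sub>\<infinity>i. V i"])
    fix h k :: 'a and r :: real
    show "(\<Sum>\<^sub>\<infinity>i. f' i x (h + k)) = (\<Sum>\<^sub>\<infinity>i. f' i x h) + (\<Sum>\<^sub>\<infinity>i. f' i x k)"
      using infsum_add[OF abs_summable_summable[OF sf'] abs_summable_summable[OF sf']]
      by (simp add: linear_add[OF bounded_linear.linear[OF bl]])
    show "(\<Sum>\<^sub>\<infinity>i. f' i x (r *\<^sub>R h)) = r *\<^sub>R (\<Sum>\<^sub>\<infinity>i. f' i x h)"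
      by (simp add: linear_scale[OF bounded_linear.linear[OF bl]] infsum_scaleR_right)
    have "norm (\<Sum>\<^sub>\<infinity>i. f' i x h) \<le> l1norm (\<lambda>i. f' i x h)"
      unfolding l1norm_def by (rule norm_infsum_bound[OF sf'])
    also have "\<dots> \<le> (\<Sum>\<^sub>\<infinity>i. V i * norm h)"
      by (rule l1norm_leI(2)[OF summable_on_cmult_left[OF sV] V[OF x]])
    also have "\<dots> = norm h * (\<Sum>\<^sub>\<infinity>i. V i)"
      using sV by (subst infsum_cmult_left) (auto simp: mult_ac)
    finally show "norm (\<Sum>\<^sub>\<infinity>i. f' i x h) \<le> norm h * (\<Sum>\<^sub>\<infinity>i. V i)" .
  qed
  show ?thesis
    unfolding has_derivative_within_alt2
  proof (intro conjI lin allI impI)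
    fix e :: real assume e: "0 < e"
    \<comment> \<open>Each tail term has a remainder of at most 2 \<open>V i\<close> times the step,
      so a tail below e/4 contributes e/2 and leaves e/2 for the finite part.\<close>
    obtain F where F: "finite F" "(\<Sum>\<^sub>\<infinity>i\<in>-F. V i) < e/4"
      using infsum_tail_small[OF sV Vnn, of "e/4"] e by auto
    have "((\<lambda>x. \<Sum>i\<in>F. f i x) has_derivative (\<lambda>h. \<Sum>i\<in>F. f' i x h)) (at x within S)"
      by (rule has_derivative_sum) (use d x in auto)
    then have ev: "\<forall>\<^sub>F y in at x within S. norm ((\<Sum>i\<in>F. f i y) - (\<Sum>i\<in>F. f i x) - (\<Sum>i\<in>F. f' i x (y - x)))
        \<le> e/2 * norm (y - x)"
      using e unfolding has_derivative_within_alt2 by (meson half_gt_zero)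
    have inS: "\<forall>\<^sub>F y in at x within S. y \<in> S"
      by (simp add: eventually_at_filter)
    show "\<forall>\<^sub>F y in at x within S. norm ((\<Sum>\<^sub>\<infinity>i. f i y) - (\<Sum>\<^sub>\<infinity>i. f i x) - (\<Sum>\<^sub>\<infinity>i. f' i x (y - x)))
        \<le> e * norm (y - x)"
      using ev inS
    proof eventually_elim
      case (elim y)
      define D where "D i = f i y - f i x - f' i x (y - x)" for i
      have Dle: "norm (D i) \<le> (2 * norm (y - x)) * V i" for i
      proof -
        have "norm (f i y - f i x) \<le> V i * norm (y - x)"
          using elim(2) x by (intro differentiable_bound[OF S d] onorm_bound V Vnn)
        then have "norm (D i) \<le> V i * norm (y - x) + V i * norm (y - x)"
          unfolding D_def using V[OF x, of i "y - x"] norm_triangle_ineq4[of "f i y - f i x" "f' i x (y - x)"]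
          by linarith
        then show ?thesis by (simp add: mult_ac)
      qed
      have sV2: "(\<lambda>i. (2 * norm (y - x)) * V i) summable_on A" for A
        by (rule summable_on_cmult_right[OF summable_on_subset_banach[OF sV]]) auto
      have sD: "(\<lambda>i. norm (D i)) summable_on A" for A
        using Infinite_Sum.abs_summable_on_comparison_test'[OF sV2 Dle] .
      have "(\<Sum>\<^sub>\<infinity>i. f i y) - (\<Sum>\<^sub>\<infinity>i. f i x) - (\<Sum>\<^sub>\<infinity>i. f' i x (y - x)) = (\<Sum>\<^sub>\<infinity>i. D i)"
      proof -
        have "((\<lambda>i. f i y + - f i x + - f' i x (y - x)) has_sum
            ((\<Sum>\<^sub>\<infinity>i. f i y) + - (\<Sum>\<^sub>\<infinity>i. f i x) + - (\<Sum>\<^sub>\<infinity>i. f' i x (y - x)))) UNIV"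
          using elim x sf abs_summable_summable[OF sf']
          by (intro has_sum_add) (auto simp: has_sum_uminus)
        then show ?thesis by (simp add: D_def[abs_def] infsumI)
      qed
      also have "\<dots> = (\<Sum>i\<in>F. D i) + (\<Sum>\<^sub>\<infinity>i\<in>-F. D i)"
        using infsum_Un_disjoint[of D F "-F"] abs_summable_summable[OF sD] F by auto
      finally have eq: "(\<Sum>\<^sub>\<infinity>i. f i y) - (\<Sum>\<^sub>\<infinity>i. f i x) - (\<Sum>\<^sub>\<infinity>i. f' i x (y - x))
        = (\<Sum>i\<in>F. D i) + (\<Sum>\<^sub>\<infinity>i\<in>-F. D i)" .
      have "norm (\<Sum>\<^sub>\<infinity>i\<in>-F. D i) \<le> (\<Sum>\<^sub>\<infinity>i\<in>-F. norm (D i))"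
        by (rule norm_infsum_bound[OF sD])
      also have "\<dots> \<le> (\<Sum>\<^sub>\<infinity>i\<in>-F. (2 * norm (y - x)) * V i)"
        by (rule infsum_mono[OF sD sV2 Dle])
      also have "\<dots> = (2 * norm (y - x)) * (\<Sum>\<^sub>\<infinity>i\<in>-F. V i)"
        by (rule infsum_cmult_right) (rule summable_on_subset_banach[OF sV], simp)
      also have "\<dots> \<le> (2 * norm (y - x)) * (e/4)"
        using F(2) by (intro mult_left_mono) auto
      finally have "norm (\<Sum>\<^sub>\<infinity>i\<in>-F. D i) \<le> e/2 * norm (y - x)" by (simp add: mult_ac)
      moreover have "norm (\<Sum>i\<in>F. D i) \<le> e/2 * norm (y - x)"
        using elim(1) by (simp add: D_def sum_subtractf)
      ultimately have "norm ((\<Sum>i\<in>F. D i) + (\<Sum>\<^sub>\<infinity>i\<in>-F. D i)) \<le> e/2 * norm (y - x) + e/2 * norm (y - x)"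
        by (intro norm_triangle_mono)
      then show ?case unfolding eq by simp
    qed
  qed
qed

section \<open>Abstract Duhamel equations with parabolic or bounded kernels\<close>

text \<open>Shaped like \<open>cont_X0\<close> without the reality condition, so that the two
  notions match by unfolding.\<close>

definition cont_l1 :: "real \<Rightarrow> (real \<Rightarrow> 'i \<Rightarrow> 'a::banach) \<Rightarrow> bool" where
  "cont_l1 T z \<longleftrightarrow> (\<forall>t\<in>{0..T}. l1 (z t)) \<and>
     (\<forall>t0\<in>{0..T}. ((\<lambda>t. l1norm (\<lambda>n. z t n - z t0 n)) \<longlongrightarrow> 0) (at t0 within {0..T}))"

lemma l1norm_triangle:
  assumes "l1 f" "l1 g"
  shows "l1norm f \<le> l1norm g + l1norm (\<lambda>n. f n - g n)"
proof -
  have "l1norm f \<le> (\<Sum>\<^sub>\<infinity>n. norm (g n) + norm (f n - g n))"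
    by (rule l1norm_leI(2)[OF summable_on_add])
       (use assms abs_summable_diff norm_triangle_sub in auto)
  also have "\<dots> = l1norm g + l1norm (\<lambda>n. f n - g n)"
    unfolding l1norm_def using assms abs_summable_diff by (intro infsum_add) auto
  finally show ?thesis .
qed

lemma l1norm_minus_commute: "l1norm (\<lambda>n. f n - g n) = l1norm (\<lambda>n. g n - f n)"
  by (simp add: l1norm_def norm_minus_commute)

lemma cont_l1_coeff:
  assumes "cont_l1 T z"
  shows "continuous_on {0..T} (\<lambda>t. z t n)"
  unfolding continuous_on_def
proof
  fix t0 assume t0: "t0 \<in> {0..T}"
  have lim: "((\<lambda>t. l1norm (\<lambda>n. z t n - z t0 n)) \<longlongrightarrow> 0) (at t0 within {0..T})"
    using assms t0 by (auto simp: cont_l1_def)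
  show "((\<lambda>t. z t n) \<longlongrightarrow> z t0 n) (at t0 within {0..T})"
  proof (rule Lim_transform2[OF tendsto_const], rule Lim_null_comparison[OF _ lim])
    show "\<forall>\<^sub>F t in at t0 within {0..T}. norm (z t0 n - z t n) \<le> l1norm (\<lambda>n. z t n - z t0 n)"
      unfolding eventually_at_filter
    proof (intro always_eventually allI impI)
      fix t assume "t \<in> {0..T}"
      then have "l1 (\<lambda>n. z t n - z t0 n)"
        using assms t0 by (intro abs_summable_diff) (auto simp: cont_l1_def)
      from norm_le_l1norm[OF this, of n]
      show "norm (z t0 n - z t n) \<le> l1norm (\<lambda>n. z t n - z t0 n)"
        by (simp add: norm_minus_commute)
    qed
  qed
qed

lemma cont_l1_bounded:
  assumes "cont_l1 T z"
  obtains B where "0 \<le> B" "\<And>t. t \<in> {0..T} \<Longrightarrow> l1norm (z t) \<le> B"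
proof -
  have "continuous_on {0..T} (\<lambda>t. l1norm (z t))"
    unfolding continuous_on_def
  proof
    fix t0 assume t0: "t0 \<in> {0..T}"
    have lim: "((\<lambda>t. l1norm (\<lambda>n. z t n - z t0 n)) \<longlongrightarrow> 0) (at t0 within {0..T})"
      using assms t0 by (auto simp: cont_l1_def)
    show "((\<lambda>t. l1norm (z t)) \<longlongrightarrow> l1norm (z t0)) (at t0 within {0..T})"
    proof (rule Lim_transform2[OF tendsto_const], rule Lim_null_comparison[OF _ lim])
      show "\<forall>\<^sub>F t in at t0 within {0..T}.
          norm (l1norm (z t0) - l1norm (z t)) \<le> l1norm (\<lambda>n. z t n - z t0 n)"
        unfolding eventually_at_filter
      proof (intro always_eventually allI impI)
        fix t assume "t \<in> {0..T}"
        then have l: "l1 (z t)" "l1 (z t0)" using assms t0 by (auto simp: cont_l1_def)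
        show "norm (l1norm (z t0) - l1norm (z t)) \<le> l1norm (\<lambda>n. z t n - z t0 n)"
          using l1norm_triangle[OF l] l1norm_triangle[OF l(2,1)] l1norm_minus_commute[of "z t" "z t0"]
          by simp
      qed
    qed
  qed
  then have "bounded ((\<lambda>t. l1norm (z t)) ` {0..T})"
    using compact_continuous_image compact_imp_bounded by blast
  then obtain B where B: "\<forall>x\<in>(\<lambda>t. l1norm (z t)) ` {0..T}. norm x \<le> B"
    unfolding bounded_iff by blast
  show ?thesis
  proof (rule that[of "max 0 B"])
    fix t assume "t \<in> {0..T}"
    then have "norm (l1norm (z t)) \<le> B" using B by blast
    then show "l1norm (z t) \<le> max 0 B" by simp
  qed simp
qed

text \<open>Dominated convergence: under a summable bound independent of time, the l1 distance is a
  uniformly convergent sum of continuous functions. Continuity in l1 thus becomes a matter of single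
  coefficients.\<close>

lemma cont_l1_majorant:
  fixes z :: "real \<Rightarrow> 'i \<Rightarrow> 'a::banach"
  assumes "\<And>n. continuous_on {0..T} (\<lambda>t. z t n)"
    and b: "\<And>t n. t \<in> {0..T} \<Longrightarrow> norm (z t n) \<le> U n" and U: "U summable_on UNIV"
  shows "cont_l1 T z" and "t \<in> {0..T} \<Longrightarrow> l1norm (z t) \<le> (\<Sum>\<^sub>\<infinity>n. U n)"
proof -
  show "l1norm (z t) \<le> (\<Sum>\<^sub>\<infinity>n. U n)" if "t \<in> {0..T}"
    by (rule l1norm_leI(2)[OF U b[OF that]])
  show "cont_l1 T z"
    unfolding cont_l1_def
  proof (intro conjI ballI)
    fix t assume "t \<in> {0..T}"
    then show "l1 (z t)" by (intro l1norm_leI(1)[OF U] b)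
  next
    fix t0 assume t0: "t0 \<in> {0..T}"
    have U2: "(\<lambda>n. 2 * U n) summable_on UNIV" by (rule summable_on_cmult_right[OF U])
    have "continuous_on {0..T} (\<lambda>t. \<Sum>\<^sub>\<infinity>n. norm (z t n - z t0 n))"
    proof (rule continuous_on_infsum[OF _ _ U2])
      show "continuous_on {0..T} (\<lambda>t. norm (z t i - z t0 i))" for i
        by (intro continuous_intros assms)
      show "norm (norm (z t i - z t0 i)) \<le> 2 * U i" if "t \<in> {0..T}" for t i
        using norm_triangle_ineq4[of "z t i" "z t0 i"] b[OF that, of i] b[OF t0, of i] by simp
    qed
    then have "((\<lambda>t. \<Sum>\<^sub>\<infinity>n. norm (z t n - z t0 n)) \<longlongrightarrow> (\<Sum>\<^sub>\<infinity>n. norm (z t0 n - z t0 n))) (at t0 within {0..T})"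
      using t0 unfolding continuous_on_def by blast
    then show "((\<lambda>t. l1norm (\<lambda>n. z t n - z t0 n)) \<longlongrightarrow> 0) (at t0 within {0..T})"
      by (simp add: l1norm_def)
  qed
qed

text \<open>Arithmetic-geometric mean inequality. With a = nu and b = lam the left side is the
  integral of the parabolic kernel x exp (-nu tau x^2) against exp (-lam tau) over all positive
  tau.\<close>

lemma frac_le_inverse_sqrt:
  assumes "0 \<le> x" "0 < a" "0 < b"
  shows "x / (a * x\<^sup>2 + b) \<le> 1 / sqrt (a * b)"
proof -
  have "x * sqrt (a * b) = (sqrt a * x) * sqrt b" by (simp add: real_sqrt_mult)
  also have "\<dots> \<le> ((sqrt a * x)\<^sup>2 + (sqrt b)\<^sup>2) / 2"
    using sum_squares_bound[of "sqrt a * x" "sqrt b"] by simp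
  also have "\<dots> \<le> a * x\<^sup>2 + b"
    using assms by (simp add: power_mult_distrib)
  finally have "x * sqrt (a * b) \<le> a * x\<^sup>2 + b" .
  moreover have "0 < a * x\<^sup>2 + b" using assms by (simp add: add_nonneg_pos)
  ultimately show ?thesis using assms by (simp add: field_simps)
qed

lemma has_vector_derivative_quadratic_remainder:
  fixes f :: "real \<Rightarrow> 'a::real_normed_vector"
  assumes "\<And>y. y \<in> S \<Longrightarrow> norm (f y) \<le> c * (y - t)\<^sup>2" and "t \<in> S" "0 \<le> c"
  shows "(f has_vector_derivative 0) (at t within S)"
  unfolding has_vector_derivative_def has_derivative_within_alt2
proof (intro conjI allI impI)
  have f0: "f t = 0" using assms(1)[OF assms(2)] by simp
  fix e :: real assume e: "0 < e"
  have "((\<lambda>y. c * \<bar>y - t\<bar>) \<longlongrightarrow> c * \<bar>t - t\<bar>) (at t within S)" by (intro tendsto_intros)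
  then have "\<forall>\<^sub>F y in at t within S. c * \<bar>y - t\<bar> < e" using e by (intro order_tendstoD) auto
  moreover have "\<forall>\<^sub>F y in at t within S. y \<in> S" by (simp add: eventually_at_filter)
  ultimately show "\<forall>\<^sub>F y in at t within S. norm (f y - f t - (y - t) *\<^sub>R 0) \<le> e * norm (y - t)"
  proof eventually_elim
    case (elim y)
    have "norm (f y) \<le> (c * \<bar>y - t\<bar>) * \<bar>y - t\<bar>"
      using assms(1)[OF elim(2)] by (simp add: power2_eq_square)
    also have "\<dots> \<le> e * \<bar>y - t\<bar>" using elim by (intro mult_right_mono) auto
    finally show ?case by (simp add: f0)
  qed
qed simp

lemma duhamel_integral_derivative:
  fixes G :: "real \<Rightarrow> 'a::banach"
  assumes phi: "\<And>x. (\<phi> has_real_derivative \<phi>' x) (at x)" and phi': "continuous_on UNIV \<phi>'"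
    and G: "continuous_on {0..T} G" and t: "t \<in> {0..T}"
  shows "((\<lambda>t. integral {0..t} (\<lambda>s. \<phi> (t - s) *\<^sub>R G s)) has_vector_derivative
      (\<phi> 0 *\<^sub>R G t + integral {0..t} (\<lambda>s. \<phi>' (t - s) *\<^sub>R G s))) (at t within {0..T})"
proof -
  have phic: "continuous_on A \<phi>" for A
    by (rule continuous_on_subset[of UNIV]) (auto simp: continuous_on_eq_continuous_at intro: DERIV_isCont[OF phi])
  have int: "(\<lambda>s. (\<phi> (y - s) - c) *\<^sub>R G s) integrable_on {a..b}" if "0 \<le> a" "b \<le> T" for y a b c
    by (intro integrable_continuous_interval continuous_intros continuous_on_compose2[OF phic]
        continuous_on_subset[OF G]) (use that in auto)
  have int0: "(\<lambda>s. \<phi> (y - s) *\<^sub>R G s) integrable_on {a..b}" if "0 \<le> a" "b \<le> T" for y a b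
    using int[OF that, of y 0] by simp
  have intG: "G integrable_on {a..b}" if "0 \<le> a" "b \<le> T" for a b
    by (intro integrable_continuous_interval continuous_on_subset[OF G]) (use that in auto)
  define A where "A y = integral {0..t} (\<lambda>s. \<phi> (y - s) *\<^sub>R G s)" for y
  \<comment> \<open>An integral over the short interval between t and y, up to sign. There the
    kernel differs from \<open>\<phi> 0\<close> by at most a multiple of |y - t|, so
    \<open>R\<close> is quadratic in y - t.\<close>
  define R where "R y = integral {0..y} (\<lambda>s. (\<phi> (y - s) - \<phi> 0) *\<^sub>R G s)
      - integral {0..t} (\<lambda>s. (\<phi> (y - s) - \<phi> 0) *\<^sub>R G s)" for y
  have A: "(A has_vector_derivative integral {0..t} (\<lambda>s. \<phi>' (t - s) *\<^sub>R G s)) (at t within {0..T})"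
    unfolding A_def[abs_def] cbox_interval[symmetric]
  proof (rule leibniz_rule_vector_derivative)
    fix x s assume "x \<in> cbox 0 T" "s \<in> cbox 0 t"
    have "((\<lambda>x. x - s) has_real_derivative 1) (at x within cbox 0 T)"
      by (auto intro!: derivative_eq_intros)
    from DERIV_chain2[OF phi this]
    have "((\<lambda>x. \<phi> (x - s)) has_real_derivative \<phi>' (x - s)) (at x within cbox 0 T)" by simp
    then show "((\<lambda>x. \<phi> (x - s) *\<^sub>R G s) has_vector_derivative \<phi>' (x - s) *\<^sub>R G s) (at x within cbox 0 T)"
      using has_vector_derivative_scaleR[OF _ has_vector_derivative_const] by fastforce
  next
    show "continuous_on (cbox 0 T \<times> cbox 0 t) (\<lambda>(x, s). \<phi>' (x - s) *\<^sub>R G s)"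
      unfolding split_beta
      by (intro continuous_intros continuous_on_compose2[OF phi'] continuous_on_compose2[OF G]) (use t in auto)
  qed (use t int0 in auto)
  have G1: "((\<lambda>y. \<phi> 0 *\<^sub>R integral {0..y} G) has_vector_derivative \<phi> 0 *\<^sub>R G t) (at t within {0..T})"
    using bounded_linear.has_vector_derivative[OF bounded_linear_scaleR_right
        integral_has_vector_derivative[OF G t]] .
  have eq: "integral {0..y} (\<lambda>s. \<phi> (y - s) *\<^sub>R G s)
      = A y + (\<phi> 0 *\<^sub>R integral {0..y} G - \<phi> 0 *\<^sub>R integral {0..t} G) + R y" if "y \<in> {0..T}" for y
  proof -
    have "integral {0..a} (\<lambda>s. (\<phi> (y - s) - \<phi> 0) *\<^sub>R G s)
       = integral {0..a} (\<lambda>s. \<phi> (y - s) *\<^sub>R G s) - \<phi> 0 *\<^sub>R integral {0..a} G" if "a \<le> T" for a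
      unfolding scaleR_diff_left using that int0[of 0 a y] intG[of 0 a]
      by (subst integral_diff) (auto intro: integrable_cmul)
    then show ?thesis using t that by (simp add: R_def A_def)
  qed
  have "bounded (\<phi>' ` {-T..T})" "bounded (G ` {0..T})"
    using compact_continuous_image[OF G] compact_continuous_image[OF continuous_on_subset[OF phi'], of "{-T..T}"]
    by (auto intro: compact_imp_bounded)
  then obtain K g where K': "\<forall>x\<in>\<phi>' ` {-T..T}. norm x \<le> K" and g': "\<forall>x\<in>G ` {0..T}. norm x \<le> g"
    unfolding bounded_iff by blast
  have K: "norm (\<phi>' x) \<le> K" if "x \<in> {-T..T}" for x using K' that by blast
  have g: "norm (G x) \<le> g" if "x \<in> {0..T}" for x using g' that by blast
  have K0: "0 \<le> K" using order_trans[OF norm_ge_zero K[of 0]] t by simp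
  have g0: "0 \<le> g" using order_trans[OF norm_ge_zero g[of t]] t by simp
  have lip: "norm (\<phi> x - \<phi> 0) \<le> K * norm (x - 0)" if "x \<in> {-T..T}" for x
    by (rule field_differentiable_bound[where S="{-T..T}" and f'=\<phi>'])
       (use that t K in \<open>auto intro: has_field_derivative_at_within phi\<close>)
  have piece: "norm (integral {a..b} (\<lambda>s. (\<phi> (y - s) - \<phi> 0) *\<^sub>R G s)) \<le> (K * g) * (b - a)\<^sup>2"
    if "0 \<le> a" "a \<le> b" "b \<le> T" "y \<in> {a..b}" for a b y
  proof -
    have "norm (integral {a..b} (\<lambda>s. (\<phi> (y - s) - \<phi> 0) *\<^sub>R G s)) \<le> (K * (b - a) * g) * (b - a)"
    proof (rule integral_bound[OF that(2)])
      show "continuous_on {a..b} (\<lambda>s. (\<phi> (y - s) - \<phi> 0) *\<^sub>R G s)"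
        by (intro continuous_intros continuous_on_compose2[OF phic] continuous_on_subset[OF G]) (use that in auto)
      fix s assume s: "s \<in> {a..b}"
      have "norm (\<phi> (y - s) - \<phi> 0) \<le> K * norm (y - s - 0)"
        using that s by (intro lip) auto
      also have "\<dots> \<le> K * (b - a)" using that s K0 by (intro mult_left_mono) auto
      finally show "norm ((\<phi> (y - s) - \<phi> 0) *\<^sub>R G s) \<le> K * (b - a) * g"
        using g[of s] that s K0 unfolding norm_scaleR real_norm_def
        by (intro mult_mono) auto
    qed
    then show ?thesis by (simp add: power2_eq_square mult_ac)
  qed
  have R: "(R has_vector_derivative 0) (at t within {0..T})"
  proof (rule has_vector_derivative_quadratic_remainder[where c="K * g"])
    fix y assume y: "y \<in> {0..T}"
    show "norm (R y) \<le> (K * g) * (y - t)\<^sup>2"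
    proof (cases "t \<le> y")
      case True
      have "R y = integral {t..y} (\<lambda>s. (\<phi> (y - s) - \<phi> 0) *\<^sub>R G s)"
        using Henstock_Kurzweil_Integration.integral_combine[of 0 t y "\<lambda>s. (\<phi> (y - s) - \<phi> 0) *\<^sub>R G s"]
          True t y int[of 0 y y] by (simp add: R_def algebra_simps)
      then show ?thesis using piece[of t y y] True t y by simp
    next
      case False
      have "R y = - integral {y..t} (\<lambda>s. (\<phi> (y - s) - \<phi> 0) *\<^sub>R G s)"
        using Henstock_Kurzweil_Integration.integral_combine[of 0 y t "\<lambda>s. (\<phi> (y - s) - \<phi> 0) *\<^sub>R G s"]
          False t y int[of 0 t y] by (simp add: R_def algebra_simps)
      then show ?thesis using piece[of y t y] False t y by (simp add: power2_commute)
    qed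
  qed (use t K0 g0 in auto)
  have "((\<lambda>y. A y + (\<phi> 0 *\<^sub>R integral {0..y} G - \<phi> 0 *\<^sub>R integral {0..t} G) + R y) has_vector_derivative
      (integral {0..t} (\<lambda>s. \<phi>' (t - s) *\<^sub>R G s) + (\<phi> 0 *\<^sub>R G t - 0) + 0)) (at t within {0..T})"
    by (intro has_vector_derivative_add has_vector_derivative_diff A G1 R has_vector_derivative_const)
  then have "((\<lambda>t. integral {0..t} (\<lambda>s. \<phi> (t - s) *\<^sub>R G s)) has_vector_derivative
      (integral {0..t} (\<lambda>s. \<phi>' (t - s) *\<^sub>R G s) + (\<phi> 0 *\<^sub>R G t - 0) + 0)) (at t within {0..T})"
    by (rule has_vector_derivative_transform[OF t, rotated]) (rule eq)
  then show ?thesis by (simp add: add.commute)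
qed

text \<open>The kernel is a sum of scalar functions of time times multipliers constant in time, so
  that time derivatives touch scalars only, while the bound concerns the sum as a whole. The cubic
  term is encoded by \<open>p\<close> nested inside \<open>r\<close>.\<close>

locale duhamel =
  fixes nu C Q :: real
    and I :: "'k set" and phi :: "'k \<Rightarrow> real \<Rightarrow> int^3 \<Rightarrow> real"
    and M :: "'k \<Rightarrow> int^3 \<Rightarrow> 'w::banach \<Rightarrow> 'a::banach"
    and q :: "'a \<Rightarrow> 'a \<Rightarrow> 'w" and p :: "'a \<Rightarrow> 'a \<Rightarrow> 'c::banach" and r :: "'c \<Rightarrow> 'a \<Rightarrow> 'w"
    and lin :: "real \<Rightarrow> int^3 \<Rightarrow> 'a" and L :: "int^3 \<Rightarrow> real"
  assumes nu: "0 < nu" and C: "0 \<le> C"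
    and q: "bilinear_with q Q" and p: "bilinear_with p Q" and r: "bilinear_with r Q"
    and M: "\<And>i n. i \<in> I \<Longrightarrow> bounded_linear (M i n)"
    and phi: "\<And>i n. i \<in> I \<Longrightarrow> \<exists>f'. continuous_on UNIV f' \<and>
        (\<forall>\<tau>. ((\<lambda>\<tau>. phi i \<tau> n) has_real_derivative f' \<tau>) (at \<tau>))"
    and kernel_bound: "\<And>\<tau> n w. 0 \<le> \<tau> \<Longrightarrow> norm (\<Sum>i\<in>I. phi i \<tau> n *\<^sub>R M i n w)
        \<le> C * (1 + norm (nreal n) * exp (- nu * \<tau> * (norm (nreal n))\<^sup>2)) * norm w"
    and lin_cont: "\<And>n. continuous_on {0..} (\<lambda>t. lin t n)"
    and lin_bound: "\<And>t n. 0 \<le> t \<Longrightarrow> norm (lin t n) \<le> L n"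
    and L: "L summable_on UNIV"
begin

definition kern :: "real \<Rightarrow> int^3 \<Rightarrow> 'w \<Rightarrow> 'a" where
  "kern \<tau> n w = (\<Sum>i\<in>I. phi i \<tau> n *\<^sub>R M i n w)"

definition nonlin :: "(int^3 \<Rightarrow> 'a) \<Rightarrow> int^3 \<Rightarrow> 'w" where
  "nonlin z n = convolve q z z n + convolve r (convolve p z z) z n"

definition Psi :: "(real \<Rightarrow> int^3 \<Rightarrow> 'a) \<Rightarrow> real \<Rightarrow> int^3 \<Rightarrow> 'a" where
  "Psi z t n = lin t n + integral {0..t} (\<lambda>s. kern (t - s) n (nonlin (z s) n))"

text \<open>One summand for each part of \<open>kernel_bound\<close>: integrated against exp (-lam
  tau), the bounded part gives 1 / lam and the parabolic part at most 1 / sqrt (nu lam), whatever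
  the frequency.\<close>

definition eps :: "real \<Rightarrow> real" where
  "eps lam = C * (1 / lam + 1 / sqrt (nu * lam))"

lemma eps_nonneg: "0 < lam \<Longrightarrow> 0 \<le> eps lam"
  using C nu by (simp add: eps_def)

lemma eps_small:
  assumes "0 < e"
  obtains lam where "0 < lam" "eps lam \<le> e"
proof -
  have "((\<lambda>lam. C * (1 / lam + 1 / sqrt (nu * lam))) \<longlongrightarrow> C * (0 + 0)) at_top"
  proof (intro tendsto_intros)
    show "((/) 1 \<longlongrightarrow> (0::real)) at_top"
      using tendsto_inverse_0_at_top[OF filterlim_ident] by (simp add: inverse_eq_divide[abs_def])
    have "filterlim (\<lambda>lam. nu * lam) at_top at_top"
      by (rule filterlim_tendsto_pos_mult_at_top[OF tendsto_const nu filterlim_ident])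
    then have "filterlim (\<lambda>lam. sqrt (nu * lam)) at_top at_top"
      by (rule filterlim_compose[OF sqrt_at_top])
    then show "((\<lambda>lam. 1 / sqrt (nu * lam)) \<longlongrightarrow> 0) at_top"
      using tendsto_inverse_0_at_top by (simp add: inverse_eq_divide[symmetric])
  qed
  then have "\<forall>\<^sub>F lam in at_top. eps lam < e"
    using assms by (intro order_tendstoD) (simp_all add: eps_def[abs_def])
  then have "\<forall>\<^sub>F lam in at_top. eps lam < e \<and> 0 < lam"
    using eventually_gt_at_top by (rule eventually_conj)
  then obtain lam where "eps lam < e" "0 < lam"
    using eventually_happens'[OF trivial_limit_at_top_linorder] by blast
  then show ?thesis using that by force
qed

lemma kern_diff: "kern \<tau> n v - kern \<tau> n w = kern \<tau> n (v - w)"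
  unfolding kern_def sum_subtractf[symmetric]
  by (intro sum.cong refl)
     (simp add: scaleR_diff_right[symmetric] linear_diff[OF bounded_linear.linear[OF M]])

lemma phi_cont:
  assumes "i \<in> I"
  shows "continuous_on A (\<lambda>\<tau>. phi i \<tau> n)"
proof -
  obtain f' where "\<And>\<tau>. ((\<lambda>\<tau>. phi i \<tau> n) has_real_derivative f' \<tau>) (at \<tau>)"
    using phi[OF assms] by blast
  then have "isCont (\<lambda>\<tau>. phi i \<tau> n) \<tau>" for \<tau> by (rule DERIV_isCont)
  then show ?thesis by (simp add: continuous_at_imp_continuous_on)
qed

lemma kern_cont:
  assumes "continuous_on {0..t} G"
  shows "continuous_on {0..t} (\<lambda>s. kern (t - s) n (G s))"
  unfolding kern_def
proof (intro continuous_on_sum continuous_on_scaleR)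
  fix i assume i: "i \<in> I"
  show "continuous_on {0..t} (\<lambda>s. phi i (t - s) n)"
    by (rule continuous_on_compose2[OF phi_cont[OF i, of UNIV]]) (auto intro!: continuous_intros)
  show "continuous_on {0..t} (\<lambda>s. M i n (G s))"
    by (rule bounded_linear.continuous_on[OF M[OF i] assms])
qed

lemma kern_integrable:
  assumes "continuous_on {0..t} G"
  shows "(\<lambda>s. kern (t - s) n (G s)) integrable_on {0..t}"
  by (rule integrable_continuous_interval[OF kern_cont[OF assms]])

text \<open>The factor |n| of the kernel is paid for by the time integral of exp (-nu tau |n|^2),
  and the exponential weight turns the remaining gain into a small factor. The bound is uniform in
  n, so no derivative is lost.\<close>

lemma kern_integral_bound:
  assumes lam: "0 < lam" and t: "0 \<le> t" and G: "continuous_on {0..t} G"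
    and b: "\<And>s. s \<in> {0..t} \<Longrightarrow> norm (G s) \<le> g * exp (lam * s)"
  shows "norm (integral {0..t} (\<lambda>s. kern (t - s) n (G s))) \<le> eps lam * g * exp (lam * t)"
proof -
  define x where "x = norm (nreal n)"
  have g: "0 \<le> g" using order_trans[OF norm_ge_zero b[of 0]] t by simp
  have x: "0 \<le> x" by (simp add: x_def)
  define a where "a = nu * x\<^sup>2 + lam"
  have a: "0 < a" using nu lam by (simp add: a_def add_nonneg_pos)
  define h where "h s = C * g * (exp (lam * s) + x * exp (- nu * (t - s) * x\<^sup>2 + lam * s))" for s
  \<comment> \<open>An explicit primitive of the dominating function \<open>h\<close>;
    \<open>a\<close> is the joint decay rate of heat kernel and weight.\<close>
  define H where "H s = C * g * (exp (lam * s) / lam + x * exp (- nu * (t - s) * x\<^sup>2 + lam * s) / a)" for s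
  have "(H has_vector_derivative h s) (at s within {0..t})" for s
  proof -
    have 1: "((\<lambda>s. exp (lam * s) / lam) has_real_derivative exp (lam * s)) (at s within {0..t})"
      using lam by (auto intro!: derivative_eq_intros)
    have 2: "((\<lambda>s. exp (- nu * (t - s) * x\<^sup>2 + lam * s)) has_real_derivative
        (exp (- nu * (t - s) * x\<^sup>2 + lam * s) * a)) (at s within {0..t})"
      by (auto intro!: derivative_eq_intros simp: a_def algebra_simps)
    have 3: "((\<lambda>s. x * exp (- nu * (t - s) * x\<^sup>2 + lam * s) / a) has_real_derivative
        (x * (exp (- nu * (t - s) * x\<^sup>2 + lam * s) * a) / a)) (at s within {0..t})"
      by (intro DERIV_cdivide DERIV_cmult 2)
    have "(H has_real_derivative h s) (at s within {0..t})"
      unfolding H_def[abs_def] h_def using 1 3 a by (intro DERIV_cmult DERIV_add) auto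
    then show ?thesis by (simp add: has_real_derivative_iff_has_vector_derivative)
  qed
  then have hint: "(h has_integral (H t - H 0)) {0..t}"
    by (intro fundamental_theorem_of_calculus t) auto
  have "norm (integral {0..t} (\<lambda>s. kern (t - s) n (G s))) \<le> integral {0..t} h"
  proof (rule integral_norm_bound_integral[OF kern_integrable[OF G]])
    show "h integrable_on {0..t}" using hint by blast
    fix s assume s: "s \<in> {0..t}"
    have "norm (kern (t - s) n (G s)) \<le> C * (1 + x * exp (- nu * (t - s) * x\<^sup>2)) * norm (G s)"
      unfolding kern_def x_def using s by (intro kernel_bound) auto
    also have "\<dots> \<le> C * (1 + x * exp (- nu * (t - s) * x\<^sup>2)) * (g * exp (lam * s))"
      using C x b[OF s] by (intro mult_left_mono) auto
    also have "\<dots> = h s" unfolding h_def exp_add by (simp add: algebra_simps)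
    finally show "norm (kern (t - s) n (G s)) \<le> h s" .
  qed
  also have "\<dots> = H t - H 0" using hint by (rule integral_unique)
  also have "\<dots> \<le> H t" using C g x a lam by (simp add: H_def)
  also have "\<dots> = C * g * exp (lam * t) * (1 / lam + x / a)" by (simp add: H_def algebra_simps)
  also have "\<dots> \<le> C * g * exp (lam * t) * (1 / lam + 1 / sqrt (nu * lam))"
    using C g frac_le_inverse_sqrt[OF x nu lam] by (intro mult_left_mono add_left_mono) (auto simp: a_def)
  finally show ?thesis by (simp add: eps_def mult_ac)
qed

lemma Q_nonneg: "0 \<le> Q" using q by (rule bilinear_withD)

text \<open>In each product the factor carrying the difference is measured by its supremum, the
  others in l1. The difference can occupy two places of the quadratic and three of the cubic term,
  whence the 2 and the 3.\<close>

lemma nonlin_diff: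
  assumes f: "l1 f" "l1norm f \<le> B" and g: "l1 g" "l1norm g \<le> B"
    and d: "\<And>n. norm (f n - g n) \<le> d"
  shows "norm (nonlin f n - nonlin g n) \<le> (2 * Q * B + 3 * Q\<^sup>2 * B\<^sup>2) * d"
proof -
  have B: "0 \<le> B" using l1norm_nonneg f(2) order_trans by blast
  have d0: "0 \<le> d" using d norm_ge_zero order_trans by blast
  have quad: "norm (convolve b f f n - convolve b g g n) \<le> 2 * Q * B * d"
    if b: "bilinear_with b Q" for b :: "'a \<Rightarrow> 'a \<Rightarrow> 'd::banach" and n
  proof -
    have "norm (convolve b f f n - convolve b g g n)
       \<le> norm (convolve b (\<lambda>n. f n - g n) f n) + norm (convolve b g (\<lambda>n. f n - g n) n)"
      unfolding convolve_diff[OF b f(1) g(1) f(1) g(1)] by (rule norm_triangle_ineq)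
    also have "\<dots> \<le> Q * d * l1norm f + Q * l1norm g * d"
      by (intro add_mono convolve_bound_right[OF b d f(1)] convolve_summable(2)[OF b g(1) d])
    also have "\<dots> \<le> Q * d * B + Q * B * d"
      using f g Q_nonneg d0 by (intro add_mono mult_left_mono mult_right_mono) auto
    finally show ?thesis by (simp add: mult_ac)
  qed
  note pf = convolve_l1[OF p f(1) f(1)] and pg = convolve_l1[OF p g(1) g(1)]
  have "norm (convolve r (convolve p f f) f n - convolve r (convolve p g g) g n)
      \<le> norm (convolve r (\<lambda>n. convolve p f f n - convolve p g g n) f n)
        + norm (convolve r (convolve p g g) (\<lambda>n. f n - g n) n)"
    unfolding convolve_diff[OF r pf(1) pg(1) f(1) g(1)] by (rule norm_triangle_ineq)
  also have "\<dots> \<le> Q * (2 * Q * B * d) * l1norm f + Q * l1norm (convolve p g g) * d"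
    by (intro add_mono convolve_bound_right[OF r quad[OF p] f(1)] convolve_summable(2)[OF r pg(1) d])
  also have "\<dots> \<le> Q * (2 * Q * B * d) * B + Q * (Q * B * B) * d"
  proof (intro add_mono mult_left_mono mult_right_mono f)
    have "Q * l1norm g * l1norm g \<le> Q * B * B"
      using g Q_nonneg B by (intro mult_mono) auto
    then show "l1norm (convolve p g g) \<le> Q * B * B" using pg(2) by linarith
  qed (use Q_nonneg B d0 in auto)
  finally have cub: "norm (convolve r (convolve p f f) f n - convolve r (convolve p g g) g n)
    \<le> 3 * Q\<^sup>2 * B\<^sup>2 * d" by (simp add: power2_eq_square algebra_simps)
  have "nonlin f n - nonlin g n = (convolve q f f n - convolve q g g n)
      + (convolve r (convolve p f f) f n - convolve r (convolve p g g) g n)"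
    by (simp add: nonlin_def)
  then have "norm (nonlin f n - nonlin g n) \<le> 2 * Q * B * d + 3 * Q\<^sup>2 * B\<^sup>2 * d"
    using norm_triangle_mono[OF quad[OF q] cub] by simp
  then show ?thesis by (simp add: algebra_simps)
qed

lemma nonlin_cont:
  assumes z: "cont_l1 T z"
  shows "continuous_on {0..T} (\<lambda>s. nonlin (z s) n)"
  unfolding continuous_on_def
proof
  fix t0 assume t0: "t0 \<in> {0..T}"
  obtain B where B: "0 \<le> B" "\<And>t. t \<in> {0..T} \<Longrightarrow> l1norm (z t) \<le> B"
    using cont_l1_bounded[OF z] by blast
  define c where "c = 2 * Q * B + 3 * Q\<^sup>2 * B\<^sup>2"
  have "((\<lambda>t. l1norm (\<lambda>n. z t n - z t0 n)) \<longlongrightarrow> 0) (at t0 within {0..T})"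
    using z t0 by (auto simp: cont_l1_def)
  from tendsto_mult_right_zero[OF this]
  have lim: "((\<lambda>t. c * l1norm (\<lambda>n. z t n - z t0 n)) \<longlongrightarrow> 0) (at t0 within {0..T})" .
  show "((\<lambda>t. nonlin (z t) n) \<longlongrightarrow> nonlin (z t0) n) (at t0 within {0..T})"
  proof (rule Lim_transform2[OF tendsto_const], rule Lim_null_comparison[OF _ lim])
    show "\<forall>\<^sub>F t in at t0 within {0..T}.
        norm (nonlin (z t0) n - nonlin (z t) n) \<le> c * l1norm (\<lambda>n. z t n - z t0 n)"
      unfolding eventually_at_filter
    proof (intro always_eventually allI impI)
      fix t assume t: "t \<in> {0..T}"
      have l: "l1 (z t)" "l1 (z t0)" using z t t0 by (auto simp: cont_l1_def)
      have "norm (nonlin (z t) n - nonlin (z t0) n) \<le> c * l1norm (\<lambda>n. z t n - z t0 n)"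
        unfolding c_def
        using nonlin_diff[OF l(1) B(2)[OF t] l(2) B(2)[OF t0] norm_le_l1norm[OF abs_summable_diff[OF l]]] .
      then show "norm (nonlin (z t0) n - nonlin (z t) n) \<le> c * l1norm (\<lambda>n. z t n - z t0 n)"
        by (simp add: norm_minus_commute)
    qed
  qed
qed

text \<open>The linear parts cancel, so the whole difference is one Duhamel integral and acquires
  the small factor \<open>eps lam\<close>.\<close>

lemma Psi_diff:
  assumes lam: "0 < lam" and z: "cont_l1 T z" and z': "cont_l1 T z'"
    and B: "\<And>t. t \<in> {0..T} \<Longrightarrow> l1norm (z t) \<le> B" "\<And>t. t \<in> {0..T} \<Longrightarrow> l1norm (z' t) \<le> B"
    and d: "\<And>t n. t \<in> {0..T} \<Longrightarrow> norm (z t n - z' t n) \<le> d * exp (lam * t)"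
    and t: "t \<in> {0..T}"
  shows "norm (Psi z t n - Psi z' t n) \<le> eps lam * ((2 * Q * B + 3 * Q\<^sup>2 * B\<^sup>2) * d) * exp (lam * t)"
proof -
  have sub: "{0..t} \<subseteq> {0..T}" using t by auto
  have c: "continuous_on {0..t} (\<lambda>s. nonlin (z s) n)" "continuous_on {0..t} (\<lambda>s. nonlin (z' s) n)"
    using nonlin_cont[OF z] nonlin_cont[OF z'] continuous_on_subset[OF _ sub] by auto
  have "Psi z t n - Psi z' t n = integral {0..t} (\<lambda>s. kern (t - s) n (nonlin (z s) n - nonlin (z' s) n))"
    unfolding Psi_def kern_diff[symmetric]
    by (subst integral_diff) (use c kern_integrable in auto)
  also have "norm \<dots> \<le> eps lam * ((2 * Q * B + 3 * Q\<^sup>2 * B\<^sup>2) * d) * exp (lam * t)"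
  proof (rule kern_integral_bound[OF lam])
    show "0 \<le> t" using t by simp
    show "continuous_on {0..t} (\<lambda>s. nonlin (z s) n - nonlin (z' s) n)"
      by (intro continuous_intros c)
    fix s assume "s \<in> {0..t}"
    then have s: "s \<in> {0..T}" using sub by auto
    have "norm (nonlin (z s) n - nonlin (z' s) n) \<le> (2 * Q * B + 3 * Q\<^sup>2 * B\<^sup>2) * (d * exp (lam * s))"
      using s z z' d by (intro nonlin_diff B) (auto simp: cont_l1_def)
    then show "norm (nonlin (z s) n - nonlin (z' s) n)
        \<le> (2 * Q * B + 3 * Q\<^sup>2 * B\<^sup>2) * d * exp (lam * s)" by (simp add: mult_ac)
  qed
  finally show ?thesis .
qed

definition solution :: "real \<Rightarrow> (real \<Rightarrow> int^3 \<Rightarrow> 'a) \<Rightarrow> bool" where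
  "solution T z \<longleftrightarrow> cont_l1 T z \<and> (\<forall>t\<in>{0..T}. \<forall>n. z t n = Psi z t n)"

text \<open>The contraction is measured in the supremum over all times and frequencies, which convolution
  with summable families respects.\<close>

lemma contraction_rate:
  assumes "0 \<le> B"
  obtains lam where "0 < lam" "eps lam * (2 * Q * B + 3 * Q\<^sup>2 * B\<^sup>2) \<le> 1/2"
proof -
  define c where "c = 2 * Q * B + 3 * Q\<^sup>2 * B\<^sup>2"
  have c: "0 \<le> c" using assms Q_nonneg by (simp add: c_def)
  \<comment> \<open>Dividing by c + 1 rather than c covers the case c = 0.\<close>
  obtain lam where lam: "0 < lam" "eps lam \<le> 1 / (2 * (c + 1))"
    using eps_small[of "1 / (2 * (c + 1))"] c by auto
  have "eps lam * c \<le> 1 / (2 * (c + 1)) * (c + 1)"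
    using lam c eps_nonneg[OF lam(1)] by (intro mult_mono) auto
  also have "\<dots> = 1/2" using c by (simp add: field_simps)
  finally show ?thesis using that lam by (auto simp: c_def)
qed

text \<open>\<open>lam\<close> is adapted to a common l1 bound of both solutions, so a single
  contraction reaches across the whole interval and no continuation in time is required. Applying
  the fixed-point equation k times halves the a priori bound k times, which replaces forming a
  supremum.\<close>

lemma solution_unique:
  assumes z: "solution T z" and z': "solution T z'" and t: "t \<in> {0..T}"
  shows "z t n = z' t n"
proof -
  have c: "cont_l1 T z" "cont_l1 T z'" using z z' by (auto simp: solution_def)
  obtain B1 where B1: "0 \<le> B1" "\<And>t. t \<in> {0..T} \<Longrightarrow> l1norm (z t) \<le> B1"
    using cont_l1_bounded[OF c(1)] by blast
  obtain B2 where B2: "0 \<le> B2" "\<And>t. t \<in> {0..T} \<Longrightarrow> l1norm (z' t) \<le> B2"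
    using cont_l1_bounded[OF c(2)] by blast
  define B where "B = B1 + B2"
  have B: "0 \<le> B" "\<And>t. t \<in> {0..T} \<Longrightarrow> l1norm (z t) \<le> B" "\<And>t. t \<in> {0..T} \<Longrightarrow> l1norm (z' t) \<le> B"
    using B1 B2 by (force simp: B_def)+
  obtain lam where lam: "0 < lam" and half: "eps lam * (2 * Q * B + 3 * Q\<^sup>2 * B\<^sup>2) \<le> 1/2"
    using contraction_rate[OF B(1)] by blast
  have iter: "norm (z t n - z' t n) \<le> (2 * B / 2 ^ k) * exp (lam * t)" if "t \<in> {0..T}" for k t n
    using that
  proof (induction k arbitrary: t n)
    case 0
    have "norm (z t n - z' t n) \<le> norm (z t n) + norm (z' t n)" by (rule norm_triangle_ineq4)
    also have "\<dots> \<le> B + B"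
      using norm_le_l1norm[of "z t" n] norm_le_l1norm[of "z' t" n] B(2)[OF 0] B(3)[OF 0] c 0
      by (force simp: cont_l1_def)
    also have "\<dots> \<le> (2 * B / 2 ^ 0) * exp (lam * t)"
      using B(1) lam 0 mult_left_mono[of 1 "exp (lam * t)" "2 * B"] by simp
    finally show ?case .
  next
    case (Suc k)
    have "norm (z t n - z' t n) = norm (Psi z t n - Psi z' t n)"
      using z z' Suc.prems by (simp add: solution_def)
    also have "\<dots> \<le> eps lam * ((2 * Q * B + 3 * Q\<^sup>2 * B\<^sup>2) * (2 * B / 2 ^ k)) * exp (lam * t)"
      by (rule Psi_diff[OF lam c B(2,3) Suc.IH Suc.prems])
    also have "\<dots> = (eps lam * (2 * Q * B + 3 * Q\<^sup>2 * B\<^sup>2)) * (2 * B / 2 ^ k * exp (lam * t))"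
      by (simp add: mult_ac)
    also have "\<dots> \<le> 1/2 * (2 * B / 2 ^ k * exp (lam * t))"
      using half B(1) by (intro mult_right_mono) auto
    finally show ?case by simp
  qed
  have "(\<lambda>k. 2 * B / 2 ^ k * exp (lam * t)) \<longlonglongrightarrow> 0"
    by (intro tendsto_mult_left_zero LIMSEQ_divide_realpow_zero) auto
  then have "norm (z t n - z' t n) \<le> 0"
    using iter[OF t] by (intro LIMSEQ_le_const) auto
  then show ?thesis by simp
qed

end

context duhamel
begin

lemma kern_integral_sum:
  assumes "continuous_on {0..t} G"
  shows "integral {0..t} (\<lambda>s. kern (t - s) n (G s))
    = (\<Sum>i\<in>I. integral {0..t} (\<lambda>s. phi i (t - s) n *\<^sub>R M i n (G s)))"
\<comment> \<open>For infinite \<open>I\<close> all sums over \<open>I\<close> are 0 by convention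
  and both sides vanish.\<close>
proof (cases "finite I")
  case True
  show ?thesis
    unfolding kern_def
  proof (rule integral_sum[OF True])
    fix i assume i: "i \<in> I"
    show "(\<lambda>s. phi i (t - s) n *\<^sub>R M i n (G s)) integrable_on {0..t}"
      by (intro integrable_continuous_interval continuous_on_scaleR continuous_on_compose2[OF phi_cont[OF i, of UNIV]]
          bounded_linear.continuous_on[OF M[OF i] assms] continuous_intros) auto
  qed
qed (simp add: kern_def)

text \<open>At a fixed frequency each scalar Duhamel integral is even differentiable in time, and
  continuity is read off from that.\<close>

lemma Psi_cont:
  assumes z: "cont_l1 T z"
  shows "continuous_on {0..T} (\<lambda>t. Psi z t n)"
proof -
  have G: "continuous_on {0..T} (\<lambda>s. nonlin (z s) n)" by (rule nonlin_cont[OF z])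
  have "continuous_on {0..T} (\<lambda>t. \<Sum>i\<in>I. integral {0..t} (\<lambda>s. phi i (t - s) n *\<^sub>R M i n (nonlin (z s) n)))"
  proof (rule continuous_on_sum)
    fix i assume i: "i \<in> I"
    obtain f' where f': "continuous_on UNIV f'" "\<And>\<tau>. ((\<lambda>\<tau>. phi i \<tau> n) has_real_derivative f' \<tau>) (at \<tau>)"
      using phi[OF i] by blast
    show "continuous_on {0..T} (\<lambda>t. integral {0..t} (\<lambda>s. phi i (t - s) n *\<^sub>R M i n (nonlin (z s) n)))"
      unfolding continuous_on_eq_continuous_within
      by (intro ballI has_vector_derivative_continuous[OF duhamel_integral_derivative[OF f'(2,1)
            bounded_linear.continuous_on[OF M[OF i] G]]])
  qed
  then have "continuous_on {0..T} (\<lambda>t. integral {0..t} (\<lambda>s. kern (t - s) n (nonlin (z s) n)))"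
    by (rule continuous_on_eq) (rule kern_integral_sum[symmetric], rule continuous_on_subset[OF G], auto)
  moreover have "continuous_on {0..T} (\<lambda>t. lin t n)" by (rule continuous_on_subset[OF lin_cont]) auto
  ultimately show ?thesis unfolding Psi_def by (rule continuous_on_add[rotated])
qed

section \<open>Scalar majorants and the Picard iteration\<close>

definition Nmaj :: "(int^3 \<Rightarrow> real) \<Rightarrow> int^3 \<Rightarrow> real" where
  "Nmaj U n = Q * convolve (*) U U n + Q\<^sup>2 * convolve (*) (convolve (*) U U) U n"

text \<open>Picard iteration for the scalar equation U = L + e Nmaj(U), the method of majorants. The
  number \<open>e\<close> will bound the time-integrated kernel, exponential weight
  included.\<close>

primrec majorant :: "real \<Rightarrow> nat \<Rightarrow> int^3 \<Rightarrow> real" where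
  "majorant e 0 = (\<lambda>_. 0)"
| "majorant e (Suc j) = (\<lambda>n. L n + e * Nmaj (majorant e j) n)"

primrec picard :: "nat \<Rightarrow> real \<Rightarrow> int^3 \<Rightarrow> 'a" where
  "picard 0 = (\<lambda>_ _. 0)"
| "picard (Suc j) = Psi (picard j)"

lemma L_nonneg: "0 \<le> L n"
  using order_trans[OF norm_ge_zero lin_bound[of 0 n]] by simp

lemma nonlin_majorant:
  assumes f: "\<And>n. norm (f n) \<le> U n" and U: "U summable_on UNIV"
  shows "norm (nonlin f n) \<le> Nmaj U n"
proof -
  have U0: "0 \<le> U n" for n using f norm_ge_zero order_trans by blast
  have s: "(\<lambda>n. Q * convolve (*) U U n) summable_on UNIV"
    by (intro summable_on_cmult_right convolve_real_l1 U0 U)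
  have "norm (convolve r (convolve p f f) f n) \<le> Q * convolve (*) (\<lambda>n. Q * convolve (*) U U n) U n"
    by (rule convolve_majorant[OF r convolve_majorant[OF p f f U U] f s U])
  also have "convolve (*) (\<lambda>n. Q * convolve (*) U U n) U n = Q * convolve (*) (convolve (*) U U) U n"
    unfolding convolve_def[of "(*)" "\<lambda>n. Q * convolve (*) U U n"] convolve_def[of "(*)" "convolve (*) U U"]
    by (simp add: mult.assoc infsum_cmult_right')
  finally have "norm (convolve r (convolve p f f) f n) \<le> Q\<^sup>2 * convolve (*) (convolve (*) U U) U n"
    by (simp add: power2_eq_square mult.assoc)
  then show ?thesis
    unfolding nonlin_def Nmaj_def by (intro norm_triangle_mono convolve_majorant[OF q f f U U])
qed

lemma Nmaj_nonneg:
  assumes "\<And>n. 0 \<le> U n"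
  shows "0 \<le> Nmaj U n"
  unfolding Nmaj_def using assms Q_nonneg by (intro add_nonneg_nonneg mult_nonneg_nonneg convolve_nonneg) auto

lemma Nmaj_mono:
  assumes "\<And>n. 0 \<le> U n" "\<And>n. U n \<le> V n" "V summable_on UNIV"
  shows "Nmaj U n \<le> Nmaj V n"
proof -
  have V0: "0 \<le> V n" for n using assms order_trans by blast
  show ?thesis
    unfolding Nmaj_def using Q_nonneg
    by (intro add_mono mult_left_mono convolve_real_mono assms convolve_nonneg convolve_real_l1 V0) auto
qed

lemma Nmaj_weighted:
  assumes w: "submult_weight w" and U: "\<And>n. 0 \<le> U n" "(\<lambda>n. w n * U n) summable_on UNIV"
    and R: "(\<Sum>\<^sub>\<infinity>n. w n * U n) \<le> R"
  shows "(\<lambda>n. w n * Nmaj U n) summable_on UNIV"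
    and "(\<Sum>\<^sub>\<infinity>n. w n * Nmaj U n) \<le> Q * R\<^sup>2 + Q\<^sup>2 * R ^ 3"
proof -
  have w0: "0 \<le> w n" for n using submult_weightD(2)[OF w] .
  have S0: "0 \<le> (\<Sum>\<^sub>\<infinity>n. w n * U n)" using U w0 by (intro infsum_nonneg) auto
  have UU0: "0 \<le> convolve (*) U U n" for n by (rule convolve_nonneg[OF U(1) U(1)])
  note c2 = convolve_weighted[OF w U(1) U(1) U(2) U(2)]
  note c3 = convolve_weighted[OF w UU0 U(1) c2(1) U(2)]
  have eq: "w n * Nmaj U n = Q * (w n * convolve (*) U U n)
      + Q\<^sup>2 * (w n * convolve (*) (convolve (*) U U) U n)" for n
    by (simp add: Nmaj_def algebra_simps)
  show "(\<lambda>n. w n * Nmaj U n) summable_on UNIV"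
    unfolding eq by (intro summable_on_add summable_on_cmult_right c2 c3)
  have b2: "(\<Sum>\<^sub>\<infinity>n. w n * convolve (*) U U n) \<le> R * R"
    using c2(2) mult_mono[OF R R] R S0 by linarith
  have b20: "0 \<le> (\<Sum>\<^sub>\<infinity>n. w n * convolve (*) U U n)"
    using UU0 w0 by (intro infsum_nonneg) auto
  have b3: "(\<Sum>\<^sub>\<infinity>n. w n * convolve (*) (convolve (*) U U) U n) \<le> R * R * R"
    using c3(2) mult_mono[OF b2 R] b20 S0 R by simp
  have "(\<Sum>\<^sub>\<infinity>n. w n * Nmaj U n) = Q * (\<Sum>\<^sub>\<infinity>n. w n * convolve (*) U U n)
      + Q\<^sup>2 * (\<Sum>\<^sub>\<infinity>n. w n * convolve (*) (convolve (*) U U) U n)"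
    unfolding eq
    by (simp add: infsum_add summable_on_cmult_right c2 c3 infsum_cmult_right)
  also have "\<dots> \<le> Q * (R * R) + Q\<^sup>2 * (R * R * R)"
    using b2 b3 Q_nonneg by (intro add_mono mult_left_mono) auto
  finally show "(\<Sum>\<^sub>\<infinity>n. w n * Nmaj U n) \<le> Q * R\<^sup>2 + Q\<^sup>2 * R ^ 3"
    by (simp add: power2_eq_square power3_eq_cube)
qed

lemma majorant_nonneg: "0 \<le> e \<Longrightarrow> 0 \<le> majorant e j n"
  by (induction j arbitrary: n) (auto intro!: add_nonneg_nonneg L_nonneg mult_nonneg_nonneg Nmaj_nonneg)

text \<open>A weighted l1 space with submultiplicative weight is a convolution algebra with constant 1, so
  the same smallness condition serves all weights.\<close>

lemma majorant_weighted:
  assumes w: "submult_weight w" and e: "0 \<le> e" and R: "0 \<le> R"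
    and L: "(\<lambda>n. w n * L n) summable_on UNIV" "(\<Sum>\<^sub>\<infinity>n. w n * L n) \<le> l"
    and small: "l + e * (Q * R\<^sup>2 + Q\<^sup>2 * R ^ 3) \<le> R"
  shows "(\<lambda>n. w n * majorant e j n) summable_on UNIV \<and> (\<Sum>\<^sub>\<infinity>n. w n * majorant e j n) \<le> R"
proof (induction j)
  case 0
  then show ?case using R by simp
next
  case (Suc j)
  note N = Nmaj_weighted[OF w majorant_nonneg[OF e] conjunct1[OF Suc] conjunct2[OF Suc]]
  have eq: "w n * majorant e (Suc j) n = w n * L n + e * (w n * Nmaj (majorant e j) n)" for n
    by (simp add: algebra_simps)
  have "(\<Sum>\<^sub>\<infinity>n. w n * majorant e (Suc j) n)
      = (\<Sum>\<^sub>\<infinity>n. w n * L n) + e * (\<Sum>\<^sub>\<infinity>n. w n * Nmaj (majorant e j) n)"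
    unfolding eq by (simp add: infsum_add summable_on_cmult_right L N infsum_cmult_right)
  also have "\<dots> \<le> l + e * (Q * R\<^sup>2 + Q\<^sup>2 * R ^ 3)"
    using L N e by (intro add_mono mult_left_mono) auto
  finally have "(\<Sum>\<^sub>\<infinity>n. w n * majorant e (Suc j) n) \<le> R" using small by linarith
  moreover have "(\<lambda>n. w n * majorant e (Suc j) n) summable_on UNIV"
    unfolding eq by (intro summable_on_add summable_on_cmult_right L N)
  ultimately show ?case by blast
qed

end

text \<open>Fixes the existence time. By \<open>mu * T \<le> 1\<close> the weight exp (mu t) is at
  most exp 1 and so at most 3, the origin of \<open>3 * eps mu\<close>. The condition
  \<open>small\<close> makes the ball of radius \<open>R\<close> invariant under the scalar
  recursion; it is stated with an upper bound \<open>l\<close> of the data so that slightly larger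
  weighted sums can share it.\<close>

locale duhamel_small = duhamel nu C Q I phi M q p r lin L
  for nu C Q :: real
    and I :: "'k set" and phi :: "'k \<Rightarrow> real \<Rightarrow> int^3 \<Rightarrow> real"
    and M :: "'k \<Rightarrow> int^3 \<Rightarrow> 'w::banach \<Rightarrow> 'a::banach"
    and q :: "'a \<Rightarrow> 'a \<Rightarrow> 'w" and p :: "'a \<Rightarrow> 'a \<Rightarrow> 'c::banach" and r :: "'c \<Rightarrow> 'a \<Rightarrow> 'w"
    and lin :: "real \<Rightarrow> int^3 \<Rightarrow> 'a" and L :: "int^3 \<Rightarrow> real" +
  fixes T mu l R :: real
  assumes mu: "0 < mu" "mu * T \<le> 1" and T: "0 < T" and R: "0 \<le> R"
    and L_le: "(\<Sum>\<^sub>\<infinity>n. L n) \<le> l"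
    and small: "l + 3 * eps mu * (Q * R\<^sup>2 + Q\<^sup>2 * R ^ 3) \<le> R"
begin

abbreviation "Maj \<equiv> majorant (3 * eps mu)"

lemma step_nonneg: "0 \<le> 3 * eps mu" using eps_nonneg[OF mu(1)] by simp

lemma Maj_summable: "Maj j summable_on UNIV" "(\<Sum>\<^sub>\<infinity>n. Maj j n) \<le> R"
  using majorant_weighted[OF submult_weight_1 step_nonneg R, of l j] L L_le small by auto

lemma Maj_le: "Maj j n \<le> R"
proof -
  note a = nonneg_abs_summable[of "Maj j", OF majorant_nonneg[OF step_nonneg] Maj_summable(1)]
  show ?thesis
    using norm_le_l1norm[OF a(1), of n] a(2) Maj_summable(2)[of j] by simp
qed

lemma Maj_mono: "Maj j n \<le> Maj (Suc j) n"
proof (induction j arbitrary: n)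
  case 0
  then show ?case using majorant_nonneg[OF step_nonneg, of "Suc 0"] by simp
next
  case (Suc j)
  have "Nmaj (Maj j) n \<le> Nmaj (Maj (Suc j)) n"
    by (rule Nmaj_mono[OF majorant_nonneg[OF step_nonneg] Suc Maj_summable(1)])
  then have "L n + 3 * eps mu * Nmaj (Maj j) n \<le> L n + 3 * eps mu * Nmaj (Maj (Suc j)) n"
    using step_nonneg by (intro add_left_mono mult_left_mono) auto
  then show ?case by simp
qed

text \<open>The supremum is that of an increasing sequence bounded by \<open>R\<close>, hence also
  its limit.\<close>

definition Ulim :: "int^3 \<Rightarrow> real" where
  "Ulim n = (SUP j. Maj j n)"

lemma Maj_bdd: "bdd_above (range (\<lambda>j. Maj j n))"
  using Maj_le by (intro bdd_aboveI2) auto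

lemma Maj_le_Ulim: "Maj j n \<le> Ulim n"
  unfolding Ulim_def by (rule cSUP_upper[OF _ Maj_bdd]) simp

lemma Ulim_nonneg: "0 \<le> Ulim n"
  using Maj_le_Ulim[of 0 n] by simp

lemma Maj_tendsto: "(\<lambda>j. Maj j n) \<longlonglongrightarrow> Ulim n"
  unfolding Ulim_def by (rule LIMSEQ_incseq_SUP[OF Maj_bdd]) (simp add: incseq_SucI Maj_mono del: majorant.simps)

text \<open>The bound on weighted sums is uniform in j, passes to the limit over finite sets of
  frequencies, and from there to the full sum. \<open>R\<close> is the same for all weights under
  which the data still sum to at most \<open>l\<close>.\<close>

lemma Ulim_weighted:
  assumes w: "submult_weight w" and L: "(\<lambda>n. w n * L n) summable_on UNIV" "(\<Sum>\<^sub>\<infinity>n. w n * L n) \<le> l"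
  shows "(\<lambda>n. w n * Ulim n) summable_on UNIV" "(\<Sum>\<^sub>\<infinity>n. w n * Ulim n) \<le> R"
proof -
  have w0: "0 \<le> w n" for n using submult_weightD(2)[OF w] .
  have nn: "0 \<le> w n * Ulim n" for n using w0 Ulim_nonneg by simp
  have fin: "(\<Sum>n\<in>A. w n * Ulim n) \<le> R" if A: "finite A" for A
  proof (rule LIMSEQ_le_const2)
    show "(\<lambda>j. \<Sum>n\<in>A. w n * Maj j n) \<longlonglongrightarrow> (\<Sum>n\<in>A. w n * Ulim n)"
      by (intro tendsto_intros Maj_tendsto)
    have "(\<Sum>n\<in>A. w n * Maj j n) \<le> R" for j
    proof -
      note mw = majorant_weighted[OF w step_nonneg R L small, of j]
      have "(\<Sum>n\<in>A. w n * Maj j n) \<le> (\<Sum>\<^sub>\<infinity>n. w n * Maj j n)"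
        using mw w0 majorant_nonneg[OF step_nonneg] A by (intro finite_sum_le_infsum) auto
      then show ?thesis using mw by linarith
    qed
    then show "\<exists>N. \<forall>j\<ge>N. (\<Sum>n\<in>A. w n * Maj j n) \<le> R" by blast
  qed
  show "(\<lambda>n. w n * Ulim n) summable_on UNIV" "(\<Sum>\<^sub>\<infinity>n. w n * Ulim n) \<le> R"
    using nonneg_summable_iff_finite_sums[of "\<lambda>n. w n * Ulim n" R, OF nn fin] by auto
qed

lemma Ulim_summable: "Ulim summable_on UNIV" "(\<Sum>\<^sub>\<infinity>n. Ulim n) \<le> R"
  using Ulim_weighted[OF submult_weight_1] L L_le by auto

text \<open>Both claims go through one induction: continuity of the next iterate needs continuity of
  the current one in l1, and this follows from continuous coefficients together with the summable
  majorant. The growth of exp (mu t) is spent in the factor 3, so the majorant carries no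
  time.\<close>

lemma picard_bounds:
  "(\<forall>n. continuous_on {0..T} (\<lambda>t. picard j t n)) \<and> (\<forall>t\<in>{0..T}. \<forall>n. norm (picard j t n) \<le> Maj j n)"
proof (induction j)
  case 0
  then show ?case by simp
next
  case (Suc j)
  have c: "cont_l1 T (picard j)"
    by (rule cont_l1_majorant(1)[where U="Maj j"]) (use Suc Maj_summable in auto)
  have "norm (Psi (picard j) t n) \<le> Maj (Suc j) n" if t: "t \<in> {0..T}" for t n
  proof -
    have "norm (integral {0..t} (\<lambda>s. kern (t - s) n (nonlin (picard j s) n)))
        \<le> eps mu * Nmaj (Maj j) n * exp (mu * t)"
    proof (rule kern_integral_bound[OF mu(1)])
      show "continuous_on {0..t} (\<lambda>s. nonlin (picard j s) n)"
        by (rule continuous_on_subset[OF nonlin_cont[OF c]]) (use t in auto)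
      fix s assume s: "s \<in> {0..t}"
      have "norm (nonlin (picard j s) n) \<le> Nmaj (Maj j) n"
        by (rule nonlin_majorant) (use Suc s t Maj_summable in auto)
      also have "\<dots> \<le> Nmaj (Maj j) n * exp (mu * s)"
        using mult_left_mono[of 1 "exp (mu * s)" "Nmaj (Maj j) n"] s mu
          Nmaj_nonneg[of "Maj j" n, OF majorant_nonneg[OF step_nonneg]] by simp
      finally show "norm (nonlin (picard j s) n) \<le> Nmaj (Maj j) n * exp (mu * s)" .
    qed (use t in auto)
    also have "\<dots> \<le> eps mu * Nmaj (Maj j) n * 3"
    proof (rule mult_left_mono)
      have "mu * t \<le> mu * T" using t mu by (intro mult_left_mono) auto
      then have "exp (mu * t) \<le> exp 1" using mu(2) by (subst exp_le_cancel_iff) linarith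
      then show "exp (mu * t) \<le> 3" using exp_le by linarith
      show "0 \<le> eps mu * Nmaj (Maj j) n"
        using eps_nonneg[OF mu(1)] Nmaj_nonneg[of "Maj j" n, OF majorant_nonneg[OF step_nonneg]] by simp
    qed
    finally have "norm (Psi (picard j) t n) \<le> L n + eps mu * Nmaj (Maj j) n * 3"
      unfolding Psi_def using t by (intro norm_triangle_mono lin_bound) auto
    then show ?thesis by (simp add: mult_ac)
  qed
  then show ?case using Psi_cont[OF c] by (simp del: majorant.simps)
qed

lemma picard_cont: "cont_l1 T (picard j)"
  by (rule cont_l1_majorant(1)[where U="Maj j"]) (use picard_bounds Maj_summable in auto)

lemma picard_l1: "t \<in> {0..T} \<Longrightarrow> l1norm (picard j t) \<le> R"
  using cont_l1_majorant(2)[where U="Maj j" and z="picard j"] picard_bounds[of j] Maj_summable[of j] by force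

text \<open>Two bounds cooperate. A geometric rate in the exponentially weighted supremum makes
  every coefficient converge uniformly in time, and \<open>Ulim\<close> keeps the limit in l1. Since
  \<open>Psi_diff\<close> measures differences by the supremum, this is enough to pass to the limit
  in the equation.\<close>

lemma picard_limit:
  obtains z where "solution T z" "\<And>t n. t \<in> {0..T} \<Longrightarrow> norm (z t n) \<le> Ulim n"
    "\<And>t n. t \<in> {0..T} \<Longrightarrow> (\<lambda>j. picard j t n) \<longlonglongrightarrow> z t n"
proof -
  obtain lam where lam: "0 < lam" and half: "eps lam * (2 * Q * R + 3 * Q\<^sup>2 * R\<^sup>2) \<le> 1/2"
    using contraction_rate[OF R] by blast
  have step: "norm (picard (Suc j) t n - picard j t n) \<le> (R / 2 ^ j) * exp (lam * t)"
    if "t \<in> {0..T}" for j t n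
    using that
  proof (induction j arbitrary: t n)
    case 0
    have "norm (picard (Suc 0) t n) \<le> Maj (Suc 0) n" using picard_bounds[of "Suc 0"] 0 by blast
    also have "\<dots> \<le> R" by (rule Maj_le)
    also have "\<dots> \<le> R * exp (lam * t)" using mult_left_mono[of 1 "exp (lam * t)" R] R 0 lam by simp
    finally show ?case by simp
  next
    case (Suc j)
    have "norm (picard (Suc (Suc j)) t n - picard (Suc j) t n)
        = norm (Psi (picard (Suc j)) t n - Psi (picard j) t n)" by simp
    also have "\<dots> \<le> eps lam * ((2 * Q * R + 3 * Q\<^sup>2 * R\<^sup>2) * (R / 2 ^ j)) * exp (lam * t)"
      by (rule Psi_diff[OF lam picard_cont picard_cont picard_l1 picard_l1 Suc.IH Suc.prems])
    also have "\<dots> = (eps lam * (2 * Q * R + 3 * Q\<^sup>2 * R\<^sup>2)) * (R / 2 ^ j * exp (lam * t))"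
      by (simp add: mult_ac)
    also have "\<dots> \<le> 1/2 * (R / 2 ^ j * exp (lam * t))"
      using half R by (intro mult_right_mono) auto
    finally show ?case by simp
  qed
  \<comment> \<open>A telescoping series, so that the geometric bound on the steps gives
    convergence.\<close>
  define z where "z t n = (\<Sum>j. picard (Suc j) t n - picard j t n)" for t n
  have geo: "summable (\<lambda>j. R / 2 ^ j * exp (lam * t))" for t
    using summable_mult2[OF summable_mult[OF summable_geometric[of "1/2::real"]], of R "exp (lam * t)"]
    by (simp add: power_one_over field_simps)
  have telescope: "(\<Sum>j<k. picard (Suc j) t n - picard j t n) = picard k t n" for k t n
    by (induction k) auto
  have lim: "(\<lambda>j. picard j t n) \<longlonglongrightarrow> z t n" if t: "t \<in> {0..T}" for t n
  proof -
    have "summable (\<lambda>j. picard (Suc j) t n - picard j t n)"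
      by (rule summable_comparison_test'[OF geo[of t], of 0]) (use step[OF t] in blast)
    from summable_LIMSEQ[OF this] show ?thesis unfolding telescope z_def .
  qed
  \<comment> \<open>The steps from j on sum to the geometric tail 2 R / 2^j. Keeping the exact
    finite sum in \<open>fin\<close> lets the induction on k close.\<close>
  have rate: "norm (picard j t n - z t n) \<le> (2 * R / 2 ^ j) * exp (lam * t)" if t: "t \<in> {0..T}" for j t n
  proof -
    have fin: "norm (picard (j + k) t n - picard j t n) \<le> (2 * R / 2 ^ j - 2 * R / 2 ^ (j + k)) * exp (lam * t)" for k
    proof (induction k)
      case (Suc k)
      have "norm (picard (j + Suc k) t n - picard j t n)
          \<le> norm (picard (Suc (j + k)) t n - picard (j + k) t n) + norm (picard (j + k) t n - picard j t n)"
        using norm_triangle_ineq[of "picard (Suc (j + k)) t n - picard (j + k) t n" "picard (j + k) t n - picard j t n"]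
        by simp
      also have "\<dots> \<le> (R / 2 ^ (j + k)) * exp (lam * t) + (2 * R / 2 ^ j - 2 * R / 2 ^ (j + k)) * exp (lam * t)"
        by (rule add_mono[OF step[OF t] Suc])
      also have "\<dots> = (2 * R / 2 ^ j - 2 * R / 2 ^ (j + Suc k)) * exp (lam * t)"
        by (simp add: field_simps)
      finally show ?case .
    qed simp
    have "(\<lambda>k. norm (picard (k + j) t n - picard j t n)) \<longlonglongrightarrow> norm (z t n - picard j t n)"
      by (intro tendsto_intros LIMSEQ_ignore_initial_segment lim[OF t])
    moreover have "norm (picard (k + j) t n - picard j t n) \<le> (2 * R / 2 ^ j) * exp (lam * t)" for k
    proof -
      have "(2 * R / 2 ^ j - 2 * R / 2 ^ (j + k)) * exp (lam * t) \<le> (2 * R / 2 ^ j) * exp (lam * t)"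
        using R by (intro mult_right_mono) auto
      then show ?thesis using fin[of k] by (simp add: add.commute)
    qed
    ultimately have "norm (z t n - picard j t n) \<le> (2 * R / 2 ^ j) * exp (lam * t)"
      by (intro LIMSEQ_le_const2) auto
    then show ?thesis by (simp add: norm_minus_commute)
  qed
  have zU: "norm (z t n) \<le> Ulim n" if t: "t \<in> {0..T}" for t n
  proof (rule LIMSEQ_le_const2[OF tendsto_norm[OF lim[OF t]]])
    have "norm (picard j t n) \<le> Ulim n" for j
      using picard_bounds[of j] t Maj_le_Ulim[of j n] by (meson order_trans)
    then show "\<exists>N. \<forall>j\<ge>N. norm (picard j t n) \<le> Ulim n" by blast
  qed
  have zcont: "continuous_on {0..T} (\<lambda>t. z t n)" for n
  proof (rule uniform_limit_theorem[of _ "\<lambda>j t. picard j t n" sequentially])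
    show "\<forall>\<^sub>F j in sequentially. continuous_on {0..T} (\<lambda>t. picard j t n)"
      using picard_bounds by simp
    show "uniform_limit {0..T} (\<lambda>j t. picard j t n) (\<lambda>t. z t n) sequentially"
    proof (rule uniform_limitI)
      fix e :: real assume e: "0 < e"
      have "(\<lambda>j. 2 * R / 2 ^ j * exp (lam * T)) \<longlonglongrightarrow> 0"
        by (intro tendsto_mult_left_zero LIMSEQ_divide_realpow_zero) auto
      then have "\<forall>\<^sub>F j in sequentially. 2 * R / 2 ^ j * exp (lam * T) < e"
        using e by (intro order_tendstoD) auto
      then show "\<forall>\<^sub>F j in sequentially. \<forall>t\<in>{0..T}. dist (picard j t n) (z t n) < e"
      proof eventually_elim
        case (elim j)
        show ?case
        proof
          fix t assume t: "t \<in> {0..T}"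
          have "2 * R / 2 ^ j * exp (lam * t) \<le> 2 * R / 2 ^ j * exp (lam * T)"
            using t lam R by (intro mult_left_mono) auto
          then show "dist (picard j t n) (z t n) < e"
            using rate[OF t, of j n] elim unfolding dist_norm by linarith
        qed
      qed
    qed
  qed simp
  have zc: "cont_l1 T z" and zl: "\<And>t. t \<in> {0..T} \<Longrightarrow> l1norm (z t) \<le> R"
    using cont_l1_majorant[where z=z and U=Ulim, OF zcont zU Ulim_summable(1)] Ulim_summable(2) by force+
  \<comment> \<open>The values of \<open>Psi (picard j)\<close> tend to \<open>Psi z\<close> by the
    Lipschitz bound and to \<open>z\<close> because they are the shifted iterates.\<close>
  have "z t n = Psi z t n" if t: "t \<in> {0..T}" for t n
  proof -
    have "(\<lambda>j. Psi (picard j) t n) \<longlonglongrightarrow> Psi z t n"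
    proof (rule Lim_transform2[OF tendsto_const], rule Lim_null_comparison)
      show "(\<lambda>j. eps lam * (2 * Q * R + 3 * Q\<^sup>2 * R\<^sup>2) * exp (lam * t) * (2 * R / 2 ^ j)) \<longlonglongrightarrow> 0"
        by (intro tendsto_mult_right_zero LIMSEQ_divide_realpow_zero) auto
      have "norm (Psi (picard j) t n - Psi z t n)
          \<le> eps lam * ((2 * Q * R + 3 * Q\<^sup>2 * R\<^sup>2) * (2 * R / 2 ^ j)) * exp (lam * t)" for j
        by (rule Psi_diff[OF lam picard_cont zc picard_l1 zl rate t])
      then show "\<forall>\<^sub>F j in sequentially. norm (Psi z t n - Psi (picard j) t n)
          \<le> eps lam * (2 * Q * R + 3 * Q\<^sup>2 * R\<^sup>2) * exp (lam * t) * (2 * R / 2 ^ j)"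
        by (intro always_eventually allI) (simp add: norm_minus_commute mult_ac)
    qed
    moreover have "(\<lambda>j. Psi (picard j) t n) \<longlonglongrightarrow> z t n"
      using LIMSEQ_Suc[OF lim[OF t, of n]] by simp
    ultimately show ?thesis using LIMSEQ_unique by blast
  qed
  then have "solution T z" using zc by (simp add: solution_def)
  then show ?thesis using that zU lim by blast
qed

end

section \<open>Regularity in time for families with rapidly decreasing majorants\<close>

text \<open>Nonnegativity is part of the notion because these sequences serve as majorants.\<close>

definition rapid :: "(int^3 \<Rightarrow> real) \<Rightarrow> bool" where
  "rapid V \<longleftrightarrow> (\<forall>n. 0 \<le> V n) \<and> (\<forall>k. (\<lambda>n. (1 + norm (nreal n)) ^ k * V n) summable_on UNIV)"

lemma nreal_add: "nreal (m + n) = nreal m + nreal n"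
  by (simp add: nreal_def vec_eq_iff)

lemma nreal_minus: "nreal (- n) = - nreal n"
  by (simp add: nreal_def vec_eq_iff)

text \<open>By the triangle inequality 1 + d |m + n| is at most (1 + d |m|)(1 + d |n|). A small
  \<open>d\<close> later flattens the weight without changing its order of growth.\<close>

lemma submult_weight_poly:
  assumes "0 \<le> d"
  shows "submult_weight (\<lambda>n. (1 + d * norm (nreal n)) ^ k)"
  unfolding submult_weight_def
proof (intro conjI allI)
  fix m n
  show "1 \<le> (1 + d * norm (nreal n)) ^ k" using assms by (intro one_le_power) simp
  have "d * norm (nreal (m + n)) \<le> d * (norm (nreal m) + norm (nreal n))"
    unfolding nreal_add by (intro mult_left_mono norm_triangle_ineq assms)
  also have "\<dots> \<le> d * norm (nreal m) + d * norm (nreal n) + d * norm (nreal m) * (d * norm (nreal n))"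
    using assms by (simp add: algebra_simps)
  finally have "1 + d * norm (nreal (m + n)) \<le> (1 + d * norm (nreal m)) * (1 + d * norm (nreal n))"
    by (simp add: algebra_simps)
  then have "(1 + d * norm (nreal (m + n))) ^ k \<le> ((1 + d * norm (nreal m)) * (1 + d * norm (nreal n))) ^ k"
    using assms by (intro power_mono) auto
  then show "(1 + d * norm (nreal (m + n))) ^ k
      \<le> (1 + d * norm (nreal m)) ^ k * (1 + d * norm (nreal n)) ^ k"
    by (simp add: power_mult_distrib)
qed

lemma rapid_nonneg: "rapid V \<Longrightarrow> 0 \<le> V n"
  by (simp add: rapid_def)

lemma rapid_summable: "rapid V \<Longrightarrow> V summable_on UNIV"
  unfolding rapid_def by (metis (no_types, lifting) mult_1 power_0 summable_on_cong)

lemma rapid_mono: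
  assumes "rapid W" "\<And>n. 0 \<le> V n" "\<And>n. V n \<le> W n"
  shows "rapid V"
  unfolding rapid_def
proof (intro conjI allI)
  fix k
  have "(\<lambda>n. (1 + norm (nreal n)) ^ k * W n) summable_on UNIV" using assms by (auto simp: rapid_def)
  then show "(\<lambda>n. (1 + norm (nreal n)) ^ k * V n) summable_on UNIV"
    by (rule summable_on_comparison_test) (auto intro!: mult_left_mono mult_nonneg_nonneg assms)
qed (rule assms)

lemma rapid_add:
  assumes "rapid V" "rapid W"
  shows "rapid (\<lambda>n. V n + W n)"
  using assms unfolding rapid_def by (auto simp: distrib_left intro: summable_on_add)

lemma rapid_poly:
  assumes "rapid V" "0 \<le> c"
  shows "rapid (\<lambda>n. c * (1 + norm (nreal n)) ^ p * V n)"
  unfolding rapid_def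
proof (intro conjI allI)
  fix k
  have "(\<lambda>n. c * ((1 + norm (nreal n)) ^ (k + p) * V n)) summable_on UNIV"
    using assms(1) by (intro summable_on_cmult_right) (auto simp: rapid_def)
  then show "(\<lambda>n. (1 + norm (nreal n)) ^ k * (c * (1 + norm (nreal n)) ^ p * V n)) summable_on UNIV"
    by (simp add: power_add mult_ac)
qed (use assms in \<open>auto simp: rapid_def intro!: mult_nonneg_nonneg\<close>)

lemma rapid_cmult: "rapid V \<Longrightarrow> 0 \<le> c \<Longrightarrow> rapid (\<lambda>n. c * V n)"
  using rapid_poly[of V c 0] by simp

lemma rapid_convolve:
  assumes "rapid V" "rapid W"
  shows "rapid (convolve (*) V W)"
  unfolding rapid_def
proof (intro conjI allI)
  fix n k
  show "0 \<le> convolve (*) V W n" using assms by (intro convolve_nonneg rapid_nonneg)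
  show "(\<lambda>n. (1 + norm (nreal n)) ^ k * convolve (*) V W n) summable_on UNIV"
    using convolve_weighted(1)[OF submult_weight_poly[of 1 k], of V W] assms
    by (simp add: rapid_def)
qed

definition reg0 :: "real \<Rightarrow> (real \<Rightarrow> int^3 \<Rightarrow> 'a::banach) \<Rightarrow> bool" where
  "reg0 T f \<longleftrightarrow> (\<forall>n. continuous_on {0..T} (\<lambda>t. f t n)) \<and>
     (\<exists>V. rapid V \<and> (\<forall>t\<in>{0..T}. \<forall>n. norm (f t n) \<le> V n))"

text \<open>Regularity of order k in time, with rapid decay in frequency at every order. Rapid decay
  absorbs any power of |n|, hence any number of spatial derivatives, so only the time derivatives
  need counting.\<close>

fun reg :: "real \<Rightarrow> nat \<Rightarrow> (real \<Rightarrow> int^3 \<Rightarrow> 'a::banach) \<Rightarrow> bool" where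
  "reg T 0 f \<longleftrightarrow> reg0 T f"
| "reg T (Suc k) f \<longleftrightarrow> reg0 T f \<and> (\<exists>g. reg T k g \<and>
     (\<forall>t\<in>{0..T}. \<forall>n. ((\<lambda>t. f t n) has_vector_derivative g t n) (at t within {0..T})))"

lemma reg0I:
  assumes "\<And>n. continuous_on {0..T} (\<lambda>t. f t n)" "rapid V"
    "\<And>t n. t \<in> {0..T} \<Longrightarrow> norm (f t n) \<le> V n"
  shows "reg0 T f"
  unfolding reg0_def using assms by (intro conjI allI exI[of _ V] ballI)

lemma reg0_cont: "reg0 T f \<Longrightarrow> continuous_on {0..T} (\<lambda>t. f t n)"
  by (simp add: reg0_def)

lemma reg0E:
  assumes "reg0 T f"
  obtains V where "rapid V" "\<And>t n. t \<in> {0..T} \<Longrightarrow> norm (f t n) \<le> V n"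
proof -
  have "\<exists>V. rapid V \<and> (\<forall>t\<in>{0..T}. \<forall>n. norm (f t n) \<le> V n)"
    using assms unfolding reg0_def by (rule conjunct2)
  then obtain V where V: "rapid V \<and> (\<forall>t\<in>{0..T}. \<forall>n. norm (f t n) \<le> V n)" by (rule exE)
  show ?thesis by (rule that[of V]) (simp_all add: V)
qed

lemma reg_SucI:
  assumes "reg0 T f" "reg T k g"
    "\<And>t n. t \<in> {0..T} \<Longrightarrow> ((\<lambda>t. f t n) has_vector_derivative g t n) (at t within {0..T})"
  shows "reg T (Suc k) f"
  unfolding reg.simps using assms by (intro conjI exI[of _ g] ballI allI)

lemma reg_SucE:
  assumes "reg T (Suc k) f"
  obtains g where "reg T k g"
    "\<And>t n. t \<in> {0..T} \<Longrightarrow> ((\<lambda>t. f t n) has_vector_derivative g t n) (at t within {0..T})"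
proof -
  have "\<exists>g. reg T k g \<and>
     (\<forall>t\<in>{0..T}. \<forall>n. ((\<lambda>t. f t n) has_vector_derivative g t n) (at t within {0..T}))"
    using assms unfolding reg.simps by (rule conjunct2)
  then obtain g where g: "reg T k g \<and>
     (\<forall>t\<in>{0..T}. \<forall>n. ((\<lambda>t. f t n) has_vector_derivative g t n) (at t within {0..T}))" by (rule exE)
  show ?thesis by (rule that[of g]) (simp_all add: g)
qed

lemma reg_imp_reg0: "reg T k f \<Longrightarrow> reg0 T f"
  by (cases k) auto

lemma reg_Suc_imp: "reg T (Suc k) f \<Longrightarrow> reg T k f"
proof (induction k arbitrary: f)
  case (Suc k)
  obtain g where g: "reg T (Suc k) g"
    "\<And>t n. t \<in> {0..T} \<Longrightarrow> ((\<lambda>t. f t n) has_vector_derivative g t n) (at t within {0..T})"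
    by (fact reg_SucE[OF Suc.prems])
  show ?case by (rule reg_SucI[OF reg_imp_reg0[OF Suc.prems] Suc.IH[OF g(1)] g(2)])
qed simp

lemma reg0_cong:
  assumes eq: "\<And>t n. t \<in> {0..T} \<Longrightarrow> f t n = g t n" and f: "reg0 T f"
  shows "reg0 T g"
proof -
  obtain V where V: "rapid V" "\<And>t n. t \<in> {0..T} \<Longrightarrow> norm (f t n) \<le> V n"
    by (fact reg0E[OF f])
  show ?thesis
  proof (rule reg0I[OF _ V(1)])
    show "continuous_on {0..T} (\<lambda>t. g t n)" for n
      by (rule continuous_on_eq[OF reg0_cont[OF f] eq])
    show "norm (g t n) \<le> V n" if "t \<in> {0..T}" for t n
      using V(2)[OF that] eq[OF that] by simp
  qed
qed

lemma reg_cong: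
  assumes eq: "\<And>t n. t \<in> {0..T} \<Longrightarrow> f t n = g t n" and f: "reg T k f"
  shows "reg T k g"
proof (cases k)
  case 0
  then show ?thesis using reg0_cong[of T f g] eq f by simp
next
  case (Suc j)
  obtain h where h: "reg T j h"
    "\<And>t n. t \<in> {0..T} \<Longrightarrow> ((\<lambda>t. f t n) has_vector_derivative h t n) (at t within {0..T})"
    by (fact reg_SucE[OF f[unfolded Suc]])
  show ?thesis
    unfolding Suc
  proof (rule reg_SucI[OF reg0_cong[OF eq reg_imp_reg0[OF f]] h(1)])
    fix t n assume t: "t \<in> {0..T}"
    show "((\<lambda>t. g t n) has_vector_derivative h t n) (at t within {0..T})"
      by (rule has_vector_derivative_transform[OF t _ h(2)[OF t]]) (simp add: eq)
  qed
qed

lemma reg0_add: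
  assumes "reg0 T f" "reg0 T g"
  shows "reg0 T (\<lambda>t n. f t n + g t n)"
proof -
  obtain V where V: "rapid V" "\<And>t n. t \<in> {0..T} \<Longrightarrow> norm (f t n) \<le> V n"
    by (fact reg0E[OF assms(1)])
  obtain W where W: "rapid W" "\<And>t n. t \<in> {0..T} \<Longrightarrow> norm (g t n) \<le> W n"
    by (fact reg0E[OF assms(2)])
  show ?thesis
    by (rule reg0I[OF _ rapid_add[OF V(1) W(1)]])
       (intro continuous_on_add reg0_cont assms norm_triangle_mono V W; assumption)+
qed

lemma reg_add:
  assumes "reg T k f" "reg T k g"
  shows "reg T k (\<lambda>t n. f t n + g t n)"
  using assms
proof (induction k arbitrary: f g)
  case (Suc k)
  obtain f' where f': "reg T k f'"
    "\<And>t n. t \<in> {0..T} \<Longrightarrow> ((\<lambda>t. f t n) has_vector_derivative f' t n) (at t within {0..T})"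
    by (fact reg_SucE[OF Suc.prems(1)])
  obtain g' where g': "reg T k g'"
    "\<And>t n. t \<in> {0..T} \<Longrightarrow> ((\<lambda>t. g t n) has_vector_derivative g' t n) (at t within {0..T})"
    by (fact reg_SucE[OF Suc.prems(2)])
  show ?case
    by (rule reg_SucI[OF reg0_add[OF Suc.prems[THEN reg_imp_reg0]] Suc.IH[OF f'(1) g'(1)]])
       (intro has_vector_derivative_add f' g'; assumption)
qed (simp add: reg0_add)

lemma reg_zero: "reg T k (\<lambda>t n. 0)"
proof (induction k)
  case 0
  have "rapid (\<lambda>_. 0)" by (simp add: rapid_def)
  then show ?case unfolding reg.simps by (rule reg0I[rotated]) auto
next
  case (Suc k)
  show ?case by (rule reg_SucI[OF reg_imp_reg0[OF Suc] Suc]) simp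
qed

lemma reg_sum:
  assumes "\<And>i. i \<in> I \<Longrightarrow> reg T k (f i)"
  shows "reg T k (\<lambda>t n. \<Sum>i\<in>I. f i t n)"
  using assms by (induction I rule: infinite_finite_induct) (auto simp: reg_zero intro: reg_add)

text \<open>Fourier multipliers of finite order, whose growth rapid decay absorbs.\<close>

definition poly_bounded :: "(int^3 \<Rightarrow> 'a::real_normed_vector \<Rightarrow> 'b::real_normed_vector) \<Rightarrow> bool" where
  "poly_bounded A \<longleftrightarrow> (\<forall>n. bounded_linear (A n)) \<and>
     (\<exists>c p. 0 \<le> c \<and> (\<forall>n x. norm (A n x) \<le> c * (1 + norm (nreal n)) ^ p * norm x))"

lemma poly_boundedE:
  assumes "poly_bounded A"
  obtains c p where "0 \<le> c" "\<And>n x. norm (A n x) \<le> c * (1 + norm (nreal n)) ^ p * norm x"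
proof -
  from assms obtain c where "\<exists>p. 0 \<le> c \<and> (\<forall>n x. norm (A n x) \<le> c * (1 + norm (nreal n)) ^ p * norm x)"
    unfolding poly_bounded_def by auto
  then obtain p where "0 \<le> c \<and> (\<forall>n x. norm (A n x) \<le> c * (1 + norm (nreal n)) ^ p * norm x)" by (rule exE)
  then show ?thesis by (intro that[of c p]) simp_all
qed

lemma reg0_linear:
  assumes A: "poly_bounded A" and f: "reg0 T f"
  shows "reg0 T (\<lambda>t n. A n (f t n))"
proof -
  obtain c p where c: "0 \<le> c" "\<And>n x. norm (A n x) \<le> c * (1 + norm (nreal n)) ^ p * norm x"
    by (fact poly_boundedE[OF A])
  have bl: "bounded_linear (A n)" for n using A by (simp add: poly_bounded_def)
  obtain V where V: "rapid V" "\<And>t n. t \<in> {0..T} \<Longrightarrow> norm (f t n) \<le> V n"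
    by (fact reg0E[OF f])
  show ?thesis
  proof (rule reg0I[OF _ rapid_poly[OF V(1) c(1), of p]])
    fix t n assume t: "t \<in> {0..T}"
    have "c * (1 + norm (nreal n)) ^ p * norm (f t n) \<le> c * (1 + norm (nreal n)) ^ p * V n"
      using c(1) V(2)[OF t] by (intro mult_left_mono) auto
    then show "norm (A n (f t n)) \<le> c * (1 + norm (nreal n)) ^ p * V n"
      using c(2)[of n "f t n"] by linarith
  qed (rule bounded_linear.continuous_on[OF bl reg0_cont[OF f]])
qed

lemma reg_linear:
  assumes A: "poly_bounded A" and "reg T k f"
  shows "reg T k (\<lambda>t n. A n (f t n))"
  using assms(2)
proof (induction k arbitrary: f)
  case (Suc k)
  have bl: "bounded_linear (A n)" for n using A by (simp add: poly_bounded_def)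
  obtain f' where f': "reg T k f'"
    "\<And>t n. t \<in> {0..T} \<Longrightarrow> ((\<lambda>t. f t n) has_vector_derivative f' t n) (at t within {0..T})"
    by (fact reg_SucE[OF Suc.prems])
  show ?case
    by (rule reg_SucI[OF reg0_linear[OF A reg_imp_reg0[OF Suc.prems]] Suc.IH[OF f'(1)]])
       (rule bounded_linear.has_vector_derivative[OF bl f'(2)])
qed (simp add: reg0_linear[OF A])

lemma reg0_convolve:
  assumes b: "bilinear_with b Q" and f: "reg0 T f" and g: "reg0 T g"
  shows "reg0 T (\<lambda>t. convolve b (f t) (g t))"
proof -
  obtain V where V: "rapid V" "\<And>t n. t \<in> {0..T} \<Longrightarrow> norm (f t n) \<le> V n"
    by (fact reg0E[OF f])
  obtain W where W: "rapid W" "\<And>t n. t \<in> {0..T} \<Longrightarrow> norm (g t n) \<le> W n"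
    by (fact reg0E[OF g])
  have "norm (convolve b (f t) (g t) n) \<le> Q * convolve (*) V W n" if "t \<in> {0..T}" for t n
    by (rule convolve_majorant[OF b]) (use V W that rapid_summable in auto)
  moreover have "rapid (\<lambda>n. Q * convolve (*) V W n)"
    by (intro rapid_cmult rapid_convolve V W bilinear_withD(2)[OF b])
  moreover have "continuous_on {0..T} (\<lambda>t. convolve b (f t) (g t) n)" for n
    unfolding convolve_def
  proof (rule continuous_on_infsum)
    show "continuous_on {0..T} (\<lambda>t. b (f t m) (g t (n - m)))" for m
      by (intro bounded_bilinear.continuous_on[OF bilinear_withD(1)[OF b]] reg0_cont f g)
    show "norm (b (f t m) (g t (n - m))) \<le> Q * (V m * W (n - m))" if "t \<in> {0..T}" for t m
    proof -
      have "norm (b (f t m) (g t (n - m))) \<le> Q * (norm (f t m) * norm (g t (n - m)))"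
        using bilinear_withD(3)[OF b] by (simp add: mult.assoc)
      also have "\<dots> \<le> Q * (V m * W (n - m))"
        using V W that rapid_nonneg[OF V(1)] by (intro mult_left_mono mult_mono bilinear_withD(2)[OF b]) auto
      finally show ?thesis .
    qed
    show "(\<lambda>m. Q * (V m * W (n - m))) summable_on UNIV"
      by (intro summable_on_cmult_right convolve_real_summable rapid_nonneg rapid_summable V W)
  qed
  ultimately show ?thesis by (intro reg0I)
qed

text \<open>Leibniz rule term by term; products of the majorants of one factor and of the derivative
  of the other dominate the differentiated series.\<close>

lemma convolve_has_vector_derivative:
  assumes b: "bilinear_with b Q" and f: "reg0 T f" "reg0 T f'" and g: "reg0 T g" "reg0 T g'"
    and d: "\<And>t n. t \<in> {0..T} \<Longrightarrow> ((\<lambda>t. f t n) has_vector_derivative f' t n) (at t within {0..T})"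
      "\<And>t n. t \<in> {0..T} \<Longrightarrow> ((\<lambda>t. g t n) has_vector_derivative g' t n) (at t within {0..T})"
    and t: "t \<in> {0..T}"
  shows "((\<lambda>t. convolve b (f t) (g t) n) has_vector_derivative
      (convolve b (f t) (g' t) n + convolve b (f' t) (g t) n)) (at t within {0..T})"
proof -
  obtain V where V: "rapid V" "\<And>t n. t \<in> {0..T} \<Longrightarrow> norm (f t n) \<le> V n"
    by (fact reg0E[OF f(1)])
  obtain V' where V': "rapid V'" "\<And>t n. t \<in> {0..T} \<Longrightarrow> norm (f' t n) \<le> V' n"
    by (fact reg0E[OF f(2)])
  obtain W where W: "rapid W" "\<And>t n. t \<in> {0..T} \<Longrightarrow> norm (g t n) \<le> W n"
    by (fact reg0E[OF g(1)])
  obtain W' where W': "rapid W'" "\<And>t n. t \<in> {0..T} \<Longrightarrow> norm (g' t n) \<le> W' n"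
    by (fact reg0E[OF g(2)])
  have bb: "norm (b x y) \<le> Q * (v * w)" if "norm x \<le> v" "norm y \<le> w" for x y v w
  proof -
    have "norm (b x y) \<le> Q * (norm x * norm y)" using bilinear_withD(3)[OF b] by (simp add: mult.assoc)
    also have "\<dots> \<le> Q * (v * w)"
      using that order_trans[OF norm_ge_zero that(1)] by (intro mult_left_mono mult_mono bilinear_withD(2)[OF b]) auto
    finally show ?thesis .
  qed
  note rn = V(1)[THEN rapid_nonneg] V'(1)[THEN rapid_nonneg] W(1)[THEN rapid_nonneg] W'(1)[THEN rapid_nonneg]
  note rs = V(1)[THEN rapid_summable] V'(1)[THEN rapid_summable] W(1)[THEN rapid_summable] W'(1)[THEN rapid_summable]
  have s: "(\<lambda>m. Q * (v m * w (n - m))) summable_on UNIV"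
    if "\<And>n. 0 \<le> v n" "\<And>n. 0 \<le> w n" "v summable_on UNIV" "w summable_on UNIV" for v w :: "int^3 \<Rightarrow> real"
    by (intro summable_on_cmult_right convolve_real_summable that)
  have sb: "(\<lambda>m. b (x m) (y (n - m))) summable_on UNIV"
    if "\<And>n. norm (x n) \<le> v n" "\<And>n. norm (y n) \<le> w n" "\<And>n. 0 \<le> v n" "\<And>n. 0 \<le> w n"
      "v summable_on UNIV" "w summable_on UNIV" for x y v w
    by (rule abs_summable_summable, rule l1norm_leI(1)[OF s[OF that(3-6)]]) (intro bb that)
  have "((\<lambda>t. \<Sum>\<^sub>\<infinity>m. b (f t m) (g t (n - m))) has_derivative
      (\<lambda>h. \<Sum>\<^sub>\<infinity>m. h *\<^sub>R (b (f t m) (g' t (n - m)) + b (f' t m) (g t (n - m))))) (at t within {0..T})"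
  proof (rule has_derivative_infsum[where V="\<lambda>m. Q * (V m * W' (n - m)) + Q * (V' m * W (n - m))"])
    fix m x assume x: "x \<in> {0..T}"
    show "((\<lambda>t. b (f t m) (g t (n - m))) has_derivative
        (\<lambda>h. h *\<^sub>R (b (f x m) (g' x (n - m)) + b (f' x m) (g x (n - m))))) (at x within {0..T})"
      using bounded_bilinear.has_vector_derivative[OF bilinear_withD(1)[OF b] d(1)[OF x] d(2)[OF x]]
      by (simp add: has_vector_derivative_def)
    have "norm (b (f x m) (g' x (n - m)) + b (f' x m) (g x (n - m)))
        \<le> Q * (V m * W' (n - m)) + Q * (V' m * W (n - m))"
      by (intro norm_triangle_mono bb V V' W W' x)
    then show "norm (h *\<^sub>R (b (f x m) (g' x (n - m)) + b (f' x m) (g x (n - m))))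
        \<le> (Q * (V m * W' (n - m)) + Q * (V' m * W (n - m))) * norm h" for h
      unfolding norm_scaleR real_norm_def by (subst mult.commute) (rule mult_right_mono, auto)
  next
    show "(\<lambda>m. Q * (V m * W' (n - m)) + Q * (V' m * W (n - m))) summable_on UNIV"
      by (intro summable_on_add s rn rs)
    show "(\<lambda>m. b (f x m) (g x (n - m))) summable_on UNIV" if "x \<in> {0..T}" for x
      by (rule sb[of "f x" V "g x" W]) (intro V W that rn rs)+
  qed (use t rn bilinear_withD(2)[OF b] in auto)
  moreover have "(\<Sum>\<^sub>\<infinity>m. h *\<^sub>R (b (f t m) (g' t (n - m)) + b (f' t m) (g t (n - m))))
      = h *\<^sub>R (convolve b (f t) (g' t) n + convolve b (f' t) (g t) n)" for h
    unfolding convolve_def infsum_scaleR_right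
    by (subst infsum_add)
       (auto intro!: sb[of "f t" V "g' t" W'] sb[of "f' t" V' "g t" W] V V' W W' t rn rs)
  ultimately show ?thesis by (simp add: has_vector_derivative_def convolve_def)
qed

lemma reg_convolve:
  assumes b: "bilinear_with b Q" and "reg T k f" "reg T k g"
  shows "reg T k (\<lambda>t. convolve b (f t) (g t))"
  using assms(2,3)
proof (induction k arbitrary: f g)
  case (Suc k)
  obtain f' where f': "reg T k f'"
    "\<And>t n. t \<in> {0..T} \<Longrightarrow> ((\<lambda>t. f t n) has_vector_derivative f' t n) (at t within {0..T})"
    by (fact reg_SucE[OF Suc.prems(1)])
  obtain g' where g': "reg T k g'"
    "\<And>t n. t \<in> {0..T} \<Longrightarrow> ((\<lambda>t. g t n) has_vector_derivative g' t n) (at t within {0..T})"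
    by (fact reg_SucE[OF Suc.prems(2)])
  note fg = Suc.prems[THEN reg_Suc_imp]
  note fg0 = Suc.prems[THEN reg_imp_reg0]
  show ?case
  proof (rule reg_SucI[OF reg0_convolve[OF b fg0]])
    show "reg T k (\<lambda>t n. convolve b (f t) (g' t) n + convolve b (f' t) (g t) n)"
      by (intro reg_add Suc.IH f' g' fg)
  qed (rule convolve_has_vector_derivative[OF b fg0(1) reg_imp_reg0[OF f'(1)] fg0(2) reg_imp_reg0[OF g'(1)] f'(2) g'(2)])
qed (simp add: reg0_convolve[OF b])

text \<open>Derivatives are required on the whole line, as in
  \<open>duhamel_integral_derivative\<close>, but growth bounds only on [0,T]: at negative times the
  heat kernel grows exponentially in |n|^2. A time derivative may cost powers of |n|.\<close>

definition smooth_kernel :: "real \<Rightarrow> (real \<Rightarrow> int^3 \<Rightarrow> real) \<Rightarrow> bool" where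
  "smooth_kernel T \<phi> \<longleftrightarrow> (\<exists>D. D 0 = \<phi> \<and>
     (\<forall>j \<tau> n. ((\<lambda>\<tau>. D j \<tau> n) has_real_derivative D (Suc j) \<tau> n) (at \<tau>)) \<and>
     (\<forall>j. \<exists>c p. 0 \<le> c \<and> (\<forall>\<tau>\<in>{0..T}. \<forall>n. \<bar>D j \<tau> n\<bar> \<le> c * (1 + norm (nreal n)) ^ p)))"

lemma smooth_kernel_derivative:
  assumes "smooth_kernel T \<phi>"
  obtains \<phi>' where "smooth_kernel T \<phi>'" "\<And>n. continuous_on UNIV (\<lambda>\<tau>. \<phi>' \<tau> n)"
    "\<And>n \<tau>. ((\<lambda>\<tau>. \<phi> \<tau> n) has_real_derivative \<phi>' \<tau> n) (at \<tau>)"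
proof -
  obtain D where D: "D 0 = \<phi>"
    "\<And>j \<tau> n. ((\<lambda>\<tau>. D j \<tau> n) has_real_derivative D (Suc j) \<tau> n) (at \<tau>)"
    "\<And>j. \<exists>c p. 0 \<le> c \<and> (\<forall>\<tau>\<in>{0..T}. \<forall>n. \<bar>D j \<tau> n\<bar> \<le> c * (1 + norm (nreal n)) ^ p)"
    using assms unfolding smooth_kernel_def by blast
  have "smooth_kernel T (D (Suc 0))"
    unfolding smooth_kernel_def using D(2,3) by (intro exI[of _ "\<lambda>j. D (Suc j)"]) auto
  moreover have "continuous_on UNIV (\<lambda>\<tau>. D (Suc 0) \<tau> n)" for n
    using DERIV_isCont[OF D(2)] by (simp add: continuous_at_imp_continuous_on)
  ultimately show ?thesis using that D(1,2) by blast
qed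

lemma smooth_kernel_bound:
  assumes "smooth_kernel T \<phi>"
  obtains c p where "0 \<le> c" "\<And>\<tau> n. \<tau> \<in> {0..T} \<Longrightarrow> \<bar>\<phi> \<tau> n\<bar> \<le> c * (1 + norm (nreal n)) ^ p"
  using assms unfolding smooth_kernel_def by blast

lemma smooth_kernel_poly_bounded:
  assumes "smooth_kernel T \<phi>" "0 \<le> T"
  shows "poly_bounded (\<lambda>n x. \<phi> 0 n *\<^sub>R x :: 'a::real_normed_vector)"
proof -
  obtain c p where c: "0 \<le> c" "\<And>\<tau> n. \<tau> \<in> {0..T} \<Longrightarrow> \<bar>\<phi> \<tau> n\<bar> \<le> c * (1 + norm (nreal n)) ^ p"
    by (fact smooth_kernel_bound[OF assms(1)])
  then show ?thesis
    unfolding poly_bounded_def using assms(2)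
    by (auto intro!: bounded_linear_scaleR_right exI[of _ c] exI[of _ p] mult_right_mono)
qed

lemma reg0_duhamel:
  assumes phi: "smooth_kernel T \<phi>" and G: "reg0 T G"
  shows "reg0 T (\<lambda>t n. integral {0..t} (\<lambda>s. \<phi> (t - s) n *\<^sub>R G s n))"
proof -
  obtain \<phi>' where "smooth_kernel T \<phi>'" and d: "\<And>n. continuous_on UNIV (\<lambda>\<tau>. \<phi>' \<tau> n)"
    "\<And>n \<tau>. ((\<lambda>\<tau>. \<phi> \<tau> n) has_real_derivative \<phi>' \<tau> n) (at \<tau>)"
    by (fact smooth_kernel_derivative[OF phi])
  obtain c p where c: "0 \<le> c" "\<And>\<tau> n. \<tau> \<in> {0..T} \<Longrightarrow> \<bar>\<phi> \<tau> n\<bar> \<le> c * (1 + norm (nreal n)) ^ p"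
    by (fact smooth_kernel_bound[OF phi])
  obtain V where V: "rapid V" "\<And>t n. t \<in> {0..T} \<Longrightarrow> norm (G t n) \<le> V n"
    by (fact reg0E[OF G])
  have Gc: "continuous_on {0..T} (\<lambda>s. G s n)" for n using G by (simp add: reg0_def)
  have cont: "continuous_on {0..T} (\<lambda>t. integral {0..t} (\<lambda>s. \<phi> (t - s) n *\<^sub>R G s n))" for n
    unfolding continuous_on_eq_continuous_within
    by (intro ballI has_vector_derivative_continuous[OF duhamel_integral_derivative[OF d(2,1) Gc]])
  have phic: "continuous_on UNIV (\<lambda>\<tau>. \<phi> \<tau> n)" for n
    using DERIV_isCont[OF d(2)] by (simp add: continuous_at_imp_continuous_on)
  have "norm (integral {0..t} (\<lambda>s. \<phi> (t - s) n *\<^sub>R G s n)) \<le> (\<bar>T\<bar> * c) * (1 + norm (nreal n)) ^ p * V n"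
    if t: "t \<in> {0..T}" for t n
  proof -
    have "norm (integral {0..t} (\<lambda>s. \<phi> (t - s) n *\<^sub>R G s n)) \<le> (c * (1 + norm (nreal n)) ^ p * V n) * (t - 0)"
    proof (rule integral_bound)
      show "continuous_on {0..t} (\<lambda>s. \<phi> (t - s) n *\<^sub>R G s n)"
        using t by (intro continuous_intros continuous_on_compose2[OF phic] continuous_on_subset[OF Gc]) auto
      show "norm (\<phi> (t - s) n *\<^sub>R G s n) \<le> c * (1 + norm (nreal n)) ^ p * V n" if "s \<in> {0..t}" for s
        unfolding norm_scaleR using that t c V by (intro mult_mono) auto
    qed (use t in auto)
    also have "\<dots> \<le> (c * (1 + norm (nreal n)) ^ p * V n) * \<bar>T\<bar>"
      using t c rapid_nonneg[OF V(1)] by (intro mult_left_mono) auto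
    finally show ?thesis by (simp add: mult_ac)
  qed
  then show ?thesis
    using cont rapid_poly[OF V(1), of "\<bar>T\<bar> * c" p] c(1) by (intro reg0I) auto
qed

text \<open>Integration in time gains one order. The derivative is a boundary term with
  \<open>\<phi> 0\<close> plus a Duhamel integral of the same \<open>G\<close> with the kernel
  \<open>\<phi>'\<close>, so the induction has to let the kernel vary.\<close>

lemma reg_duhamel:
  assumes "smooth_kernel T \<phi>" "reg T k G" "0 \<le> T"
  shows "reg T (Suc k) (\<lambda>t n. integral {0..t} (\<lambda>s. \<phi> (t - s) n *\<^sub>R G s n))"
  using assms(1,2)
proof (induction k arbitrary: \<phi>)
  case (0 \<phi>)
  have G: "reg0 T G" using 0 by simp
  obtain \<phi>' where d: "smooth_kernel T \<phi>'" "\<And>n. continuous_on UNIV (\<lambda>\<tau>. \<phi>' \<tau> n)"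
    "\<And>n \<tau>. ((\<lambda>\<tau>. \<phi> \<tau> n) has_real_derivative \<phi>' \<tau> n) (at \<tau>)"
    by (fact smooth_kernel_derivative[OF 0(1)])
  have "reg T 0 (\<lambda>t n. \<phi> 0 n *\<^sub>R G t n + integral {0..t} (\<lambda>s. \<phi>' (t - s) n *\<^sub>R G s n))"
    using reg0_duhamel[OF d(1) G]
    by (intro reg_add reg_linear[OF smooth_kernel_poly_bounded[OF 0(1) assms(3)] 0(2)]) simp
  then show ?case
    by (rule reg_SucI[OF reg0_duhamel[OF 0(1) G]]) (rule duhamel_integral_derivative[OF d(3,2) reg0_cont[OF G]])
next
  case (Suc k \<phi>)
  have G: "reg0 T G" using Suc by simp
  obtain \<phi>' where d: "smooth_kernel T \<phi>'" "\<And>n. continuous_on UNIV (\<lambda>\<tau>. \<phi>' \<tau> n)"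
    "\<And>n \<tau>. ((\<lambda>\<tau>. \<phi> \<tau> n) has_real_derivative \<phi>' \<tau> n) (at \<tau>)"
    by (fact smooth_kernel_derivative[OF Suc.prems(1)])
  have "reg T (Suc k) (\<lambda>t n. \<phi> 0 n *\<^sub>R G t n + integral {0..t} (\<lambda>s. \<phi>' (t - s) n *\<^sub>R G s n))"
    by (intro reg_add Suc.IH[OF d(1) reg_Suc_imp[OF Suc.prems(2)]]
        reg_linear[OF smooth_kernel_poly_bounded[OF Suc.prems(1) assms(3)] Suc.prems(2)])
  then show ?case
    by (rule reg_SucI[OF reg0_duhamel[OF Suc.prems(1) G]])
       (rule duhamel_integral_derivative[OF d(3,2) reg0_cont[OF G]])
qed

context duhamel
begin

text \<open>Bootstrap: order k of the solution passes to the nonlinearity, and the Duhamel integral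
  returns order k + 1. The start is the rapidly decreasing majorant \<open>U\<close>, which already
  contains all the spatial regularity.\<close>

lemma solution_reg:
  assumes z: "solution T z" and T: "0 \<le> T" and U: "rapid U" "\<And>t n. t \<in> {0..T} \<Longrightarrow> norm (z t n) \<le> U n"
    and lin: "\<And>k. reg T k lin" and M': "\<And>i. i \<in> I \<Longrightarrow> poly_bounded (M i)"
    and phi': "\<And>i. i \<in> I \<Longrightarrow> smooth_kernel T (phi i)"
  shows "reg T k z"
proof (induction k)
  case 0
  have "reg0 T z"
    by (rule reg0I[of T z, OF cont_l1_coeff[of T z] U]) (use z in \<open>simp add: solution_def\<close>)
  then show ?case by simp
next
  case (Suc k)
  have N: "reg T k (\<lambda>t. nonlin (z t))"
    unfolding nonlin_def[abs_def]
    by (intro reg_add reg_convolve[OF q] reg_convolve[OF r] reg_convolve[OF p] Suc)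
  have "reg T (Suc k) (\<lambda>t n. \<Sum>i\<in>I. integral {0..t} (\<lambda>s. phi i (t - s) n *\<^sub>R M i n (nonlin (z s) n)))"
    by (intro reg_sum reg_duhamel[OF phi' _ T] reg_linear[OF M' N])
  then have "reg T (Suc k) (\<lambda>t n. lin t n +
      (\<Sum>i\<in>I. integral {0..t} (\<lambda>s. phi i (t - s) n *\<^sub>R M i n (nonlin (z s) n))))"
    by (intro reg_add lin)
  then show ?case
  proof (rule reg_cong[rotated])
    fix t n assume t: "t \<in> {0..T}"
    have "continuous_on {0..t} (\<lambda>s. nonlin (z s) n)"
      by (rule continuous_on_subset[OF nonlin_cont[of T]]) (use z t in \<open>auto simp: solution_def\<close>)
    then show "lin t n + (\<Sum>i\<in>I. integral {0..t} (\<lambda>s. phi i (t - s) n *\<^sub>R M i n (nonlin (z s) n))) = z t n"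
      using z t by (simp add: solution_def Psi_def kern_integral_sum)
  qed
qed

end

section \<open>Joint smoothness of the realised fields\<close>

lemma norm_vec_le_componentwise:
  fixes x :: "('a::real_normed_vector) ^ 'n" and y :: "('b::real_normed_vector) ^ 'n"
  assumes "\<And>i. norm (x $ i) \<le> norm (y $ i)"
  shows "norm x \<le> norm y"
  unfolding norm_vec_def by (rule L2_set_mono) (use assms in auto)

text \<open>With the real part placed inside a bilinear map of coefficient and exponential,
  \<open>realize\<close> becomes a vector-valued series to which the product rule applies
  termwise.\<close>

definition re_mult :: "complex^3 \<Rightarrow> complex \<Rightarrow> real^3" where
  "re_mult u a = (\<chi> i. Re (u $ i * a))"

lemma norm_re_mult: "norm (re_mult u a) \<le> norm u * norm a"
proof -
  have "norm (re_mult u a) \<le> norm (\<chi> i. u $ i * a)"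
    by (rule norm_vec_le_componentwise) (simp add: re_mult_def abs_Re_le_cmod del: times_complex.sel)
  also have "\<dots> = norm u * norm a"
    by (simp add: norm_vec_def norm_mult L2_set_right_distrib mult.commute)
  finally show ?thesis .
qed

lemma bounded_bilinear_re_mult: "bounded_bilinear re_mult"
proof
  show "\<exists>K. \<forall>a b. norm (re_mult a b) \<le> norm a * norm b * K"
    using norm_re_mult by (intro exI[of _ 1]) simp
qed (simp_all add: re_mult_def vec_eq_iff algebra_simps)

lemma norm_re_mult_cis: "norm (re_mult u (cis x)) \<le> norm u"
  using norm_re_mult[of u "cis x"] by simp

lemma realize_eq_infsum:
  assumes "l1 c"
  shows "realize c x = (\<Sum>\<^sub>\<infinity>n. re_mult (c n) (cis (nreal n \<bullet> x)))"
proof (subst vec_eq_iff, rule allI)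
  fix i
  have s: "(\<lambda>n. re_mult (c n) (cis (nreal n \<bullet> x))) summable_on UNIV"
    by (rule abs_summable_summable, rule l1norm_leI(1)[OF assms]) (rule norm_re_mult_cis)
  have s': "(\<lambda>n. c n $ i * cis (nreal n \<bullet> x)) summable_on UNIV"
    by (rule abs_summable_summable, rule l1norm_leI(1)[OF assms])
       (simp add: norm_mult Finite_Cartesian_Product.norm_nth_le)
  have "(\<Sum>\<^sub>\<infinity>n. re_mult (c n) (cis (nreal n \<bullet> x))) $ i = (\<Sum>\<^sub>\<infinity>n. Re (c n $ i * cis (nreal n \<bullet> x)))"
    using has_sum_bounded_linear[OF bounded_linear_vec_nth has_sum_infsum[OF s]]
    by (simp add: re_mult_def infsumI[symmetric])
  also have "\<dots> = realize c x $ i"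
    by (simp add: realize_def infsum_Re[OF s'] del: times_complex.sel)
  finally show "realize c x $ i = (\<Sum>\<^sub>\<infinity>n. re_mult (c n) (cis (nreal n \<bullet> x))) $ i" by simp
qed

lemma Ck_on_cong:
  assumes "\<And>x. x \<in> S \<Longrightarrow> f x = g x" "Ck_on k S f"
  shows "Ck_on k S g"
proof (cases k)
  case 0
  then show ?thesis using assms by (simp cong: continuous_on_cong)
next
  case (Suc j)
  obtain f' where f': "\<forall>x\<in>S. (f has_derivative f' x) (at x within S)" "\<forall>i\<in>Basis. Ck_on j S (\<lambda>x. f' x i)"
    using assms(2) unfolding Suc Ck_on.simps by (elim exE conjE)
  have "(g has_derivative f' x) (at x within S)" if x: "x \<in> S" for x
    by (rule has_derivative_transform[OF x, where f=f]) (use f'(1) x assms(1) in simp_all)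
  then show ?thesis unfolding Suc Ck_on.simps using f'(2) by (intro exI[of _ f']) simp
qed

text \<open>This multiplier is the symbol of the partial derivative in direction j.\<close>

lemma poly_bounded_frequency: "poly_bounded (\<lambda>n u. cscale (\<i> * of_int (n $ j)) u)"
  unfolding poly_bounded_def
proof (intro conjI allI exI[of _ 1])
  fix n :: "int^3" and u :: "complex^3"
  have le: "\<bar>real_of_int (n $ j)\<bar> \<le> 1 + norm (nreal n)"
    using Finite_Cartesian_Product.norm_nth_le[of "nreal n" j] by (simp add: nreal_def)
  have eq: "norm (cscale (\<i> * of_int (n $ j)) u) = \<bar>real_of_int (n $ j)\<bar> * norm u" for u
    by (simp add: cscale_def norm_vec_def norm_mult L2_set_right_distrib)
  show "norm (cscale (\<i> * of_int (n $ j)) u) \<le> 1 * (1 + norm (nreal n)) ^ 1 * norm u"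
    unfolding eq using mult_right_mono[OF le norm_ge_zero[of u]] by simp
  show "bounded_linear (cscale (\<i> * of_int (n $ j)))"
  proof (rule bounded_linear_intro[where K="\<bar>real_of_int (n $ j)\<bar>"])
    show "norm (cscale (\<i> * of_int (n $ j)) u) \<le> norm u * \<bar>real_of_int (n $ j)\<bar>" for u
      unfolding eq by (simp add: mult.commute)
  qed (simp_all add: cscale_def vec_eq_iff algebra_simps scaleR_conv_of_real)
qed simp

lemma reg_l1: "reg T k c \<Longrightarrow> t \<in> {0..T} \<Longrightarrow> l1 (c t)"
proof -
  assume r: "reg T k c" and t: "t \<in> {0..T}"
  obtain V where V: "rapid V" "\<And>t n. t \<in> {0..T} \<Longrightarrow> norm (c t n) \<le> V n"
    by (fact reg0E[OF reg_imp_reg0[OF r]])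
  show "l1 (c t)" by (rule l1norm_leI(1)[OF rapid_summable[OF V(1)] V(2)[OF t]])
qed

lemma reg_realize_eq:
  assumes "reg T k c" "p \<in> {0..T} \<times> UNIV"
  shows "(case p of (t, x) \<Rightarrow> realize (c t) x) = (\<Sum>\<^sub>\<infinity>n. re_mult (c (fst p) n) (cis (nreal n \<bullet> snd p)))"
proof -
  have "l1 (c (fst p))" by (rule reg_l1[OF assms(1)]) (use assms(2) in auto)
  from realize_eq_infsum[OF this, of "snd p"] show ?thesis by (simp add: case_prod_beta)
qed

text \<open>Every partial derivative of the realised field is again a realised field: in time with
  the coefficients \<open>g\<close>, in direction j with i n_j c_n. Both families have order k, so
  the induction reaches all mixed derivatives.\<close>

lemma reg_realize_Ck:
  assumes "reg T k c"
  shows "Ck_on k ({0..T} \<times> UNIV) (\<lambda>(t, x). realize (c t) x)"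
  using assms
proof (induction k arbitrary: c)
  case (0 c)
  then have r: "reg0 T c" by simp
  obtain V where V: "rapid V" "\<And>t n. t \<in> {0..T} \<Longrightarrow> norm (c t n) \<le> V n" by (fact reg0E[OF r])
  have "continuous_on ({0..T} \<times> UNIV) (\<lambda>p. \<Sum>\<^sub>\<infinity>n. re_mult (c (fst p) n) (cis (nreal n \<bullet> snd p)))"
  proof (rule continuous_on_infsum[OF _ _ rapid_summable[OF V(1)]])
    show "continuous_on ({0..T} \<times> UNIV) (\<lambda>p. re_mult (c (fst p) n) (cis (nreal n \<bullet> snd p)))" for n
      by (intro bounded_bilinear.continuous_on[OF bounded_bilinear_re_mult] continuous_intros
          continuous_on_compose2[OF reg0_cont[OF r]]) auto
    show "norm (re_mult (c (fst p) n) (cis (nreal n \<bullet> snd p))) \<le> V n" if "p \<in> {0..T} \<times> UNIV" for n p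
      using that V(2)[of "fst p" n] norm_re_mult_cis[of "c (fst p) n" "nreal n \<bullet> snd p"] by auto
  qed
  then have "continuous_on ({0..T} \<times> UNIV) (\<lambda>(t, x). realize (c t) x)"
    by (rule continuous_on_eq) (rule reg_realize_eq[OF 0, symmetric])
  then show ?case by simp
next
  case (Suc k c)
  obtain g where g: "reg T k g"
    "\<And>t n. t \<in> {0..T} \<Longrightarrow> ((\<lambda>t. c t n) has_vector_derivative g t n) (at t within {0..T})"
    by (fact reg_SucE[OF Suc.prems])
  note cg = reg_imp_reg0[OF Suc.prems] reg_imp_reg0[OF g(1)]
  obtain V where V: "rapid V" "\<And>t n. t \<in> {0..T} \<Longrightarrow> norm (c t n) \<le> V n" by (fact reg0E[OF cg(1)])
  obtain W where W: "rapid W" "\<And>t n. t \<in> {0..T} \<Longrightarrow> norm (g t n) \<le> W n" by (fact reg0E[OF cg(2)])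
  let ?S = "{0..T} \<times> (UNIV :: (real^3) set)"
  \<comment> \<open>The differential of a single Fourier mode: \<open>snd h\<close> acts on the
    exponential and costs a factor |n|, \<open>fst h\<close> acts on the coefficient.\<close>
  define D where "D n p h = re_mult (c (fst p) n) ((nreal n \<bullet> snd h) *\<^sub>R (\<i> * cis (nreal n \<bullet> snd p)))
      + re_mult (fst h *\<^sub>R g (fst p) n) (cis (nreal n \<bullet> snd p))" for n and p h :: "real \<times> (real^3)"
  have der: "((\<lambda>p. \<Sum>\<^sub>\<infinity>n. re_mult (c (fst p) n) (cis (nreal n \<bullet> snd p))) has_derivative
      (\<lambda>h. \<Sum>\<^sub>\<infinity>n. D n p h)) (at p within ?S)" if p: "p \<in> ?S" for p
  proof (rule has_derivative_infsum[where V="\<lambda>n. (1 + norm (nreal n)) ^ 1 * V n + W n"])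
    show "convex ?S" by (intro convex_Times) auto
    show "((\<lambda>p. re_mult (c (fst p) n) (cis (nreal n \<bullet> snd p))) has_derivative D n p) (at p within ?S)"
      if p: "p \<in> ?S" for n p
    proof -
      have "((\<lambda>t. c t n) has_derivative (\<lambda>h. h *\<^sub>R g (fst p) n)) (at (fst p) within fst ` ?S)"
        using g(2)[of "fst p" n] p by (auto simp: has_vector_derivative_def)
      from has_derivative_in_compose[OF has_derivative_fst[OF has_derivative_ident] this]
      have 1: "((\<lambda>p. c (fst p) n) has_derivative (\<lambda>h. fst h *\<^sub>R g (fst p) n)) (at p within ?S)" .
      have 2: "((\<lambda>p. cis (nreal n \<bullet> snd p)) has_derivative
          (\<lambda>h. (nreal n \<bullet> snd h) *\<^sub>R (\<i> * cis (nreal n \<bullet> snd p)))) (at p within ?S)"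
        by (auto intro!: derivative_eq_intros)
      show ?thesis unfolding D_def by (rule bounded_bilinear.FDERIV[OF bounded_bilinear_re_mult 1 2])
    qed
    show "norm (D n p h) \<le> ((1 + norm (nreal n)) ^ 1 * V n + W n) * norm h" if p: "p \<in> ?S" for n p h
    proof -
      have t: "fst p \<in> {0..T}" using p by auto
      have "norm (re_mult (c (fst p) n) ((nreal n \<bullet> snd h) *\<^sub>R (\<i> * cis (nreal n \<bullet> snd p))))
          \<le> norm (c (fst p) n) * \<bar>nreal n \<bullet> snd h\<bar>"
        by (rule order_trans[OF norm_re_mult]) (simp add: norm_mult)
      also have "\<dots> \<le> V n * ((1 + norm (nreal n)) * norm h)"
      proof (intro mult_mono V t)
        have "\<bar>nreal n \<bullet> snd h\<bar> \<le> norm (nreal n) * norm (snd h)" by (rule Cauchy_Schwarz_ineq2)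
        also have "\<dots> \<le> (1 + norm (nreal n)) * norm h" using norm_snd_le[of "snd h" "fst h"] by (intro mult_mono) auto
        finally show "\<bar>nreal n \<bullet> snd h\<bar> \<le> (1 + norm (nreal n)) * norm h" .
      qed (use rapid_nonneg[OF V(1)] in auto)
      finally have 1: "norm (re_mult (c (fst p) n) ((nreal n \<bullet> snd h) *\<^sub>R (\<i> * cis (nreal n \<bullet> snd p))))
          \<le> V n * ((1 + norm (nreal n)) * norm h)" .
      have "norm (re_mult (fst h *\<^sub>R g (fst p) n) (cis (nreal n \<bullet> snd p))) \<le> \<bar>fst h\<bar> * norm (g (fst p) n)"
        by (rule order_trans[OF norm_re_mult_cis]) simp
      also have "\<dots> \<le> norm h * W n"
        using norm_fst_le[of "fst h" "snd h"] by (intro mult_mono W t) auto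
      finally have "norm (re_mult (fst h *\<^sub>R g (fst p) n) (cis (nreal n \<bullet> snd p))) \<le> norm h * W n" .
      from norm_triangle_mono[OF 1 this] show ?thesis unfolding D_def by (simp add: algebra_simps)
    qed
    show "(\<lambda>n. (1 + norm (nreal n)) ^ 1 * V n + W n) summable_on UNIV"
      using V(1) rapid_summable[OF W(1)] unfolding rapid_def by (intro summable_on_add) blast+
    show "(\<lambda>n. re_mult (c (fst p) n) (cis (nreal n \<bullet> snd p))) summable_on UNIV" if "p \<in> ?S" for p
    proof -
      have l: "l1 (c (fst p))" using reg_l1[OF Suc.prems] that by auto
      show ?thesis
        by (rule abs_summable_summable, rule l1norm_leI(1)[OF l]) (rule norm_re_mult_cis)
    qed
  qed (use rapid_nonneg[OF V(1)] rapid_nonneg[OF W(1)] p in auto)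
  have "Ck_on (Suc k) ?S (\<lambda>p. \<Sum>\<^sub>\<infinity>n. re_mult (c (fst p) n) (cis (nreal n \<bullet> snd p)))"
    unfolding Ck_on.simps
  proof (intro exI[of _ "\<lambda>p h. \<Sum>\<^sub>\<infinity>n. D n p h"] conjI ballI der)
    fix h :: "real \<times> (real^3)" assume "h \<in> Basis"
    then consider "h = (1, 0)" | j :: 3 where "h = (0, axis j 1)"
      by (auto simp: Basis_prod_def Basis_vec_def)
    then show "Ck_on k ?S (\<lambda>p. \<Sum>\<^sub>\<infinity>n. D n p h)"
    proof cases
      case 1
      have "D n p h = re_mult (g (fst p) n) (cis (nreal n \<bullet> snd p))" for n p
        by (simp add: D_def 1 re_mult_def vec_eq_iff)
      then have "(\<lambda>p. \<Sum>\<^sub>\<infinity>n. D n p h) = (\<lambda>p. \<Sum>\<^sub>\<infinity>n. re_mult (g (fst p) n) (cis (nreal n \<bullet> snd p)))"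
        by (simp only:)
      then show ?thesis
        using Ck_on_cong[OF reg_realize_eq[OF g(1)] Suc.IH[OF g(1)]] by (simp only:)
    next
      case (2 j)
      have "nreal n \<bullet> axis j 1 = of_int (n $ j)" for n
        by (simp add: inner_axis nreal_def)
      then have D: "D n p h = re_mult (cscale (\<i> * of_int (n $ j)) (c (fst p) n)) (cis (nreal n \<bullet> snd p))" for n p
        by (simp add: D_def 2 re_mult_def vec_eq_iff cscale_def scaleR_conv_of_real mult_ac)
      have r: "reg T k (\<lambda>t n. cscale (\<i> * of_int (n $ j)) (c t n))"
        by (rule reg_linear[OF poly_bounded_frequency reg_Suc_imp[OF Suc.prems]])
      show ?thesis
        unfolding D
        by (rule Ck_on_cong[OF reg_realize_eq[OF r] Suc.IH[OF r]])
    qed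
  qed
  then show ?case
    by (rule Ck_on_cong[rotated]) (rule reg_realize_eq[OF Suc.prems, symmetric])
qed

section \<open>Rapid decay of the Fourier coefficients of smooth fields\<close>

lemma infsum_finite_sum:
  fixes f :: "'k \<Rightarrow> 'i \<Rightarrow> 'a::banach"
  assumes "finite K" "\<And>k. k \<in> K \<Longrightarrow> f k summable_on UNIV"
  shows "(\<Sum>\<^sub>\<infinity>n. \<Sum>k\<in>K. f k n) = (\<Sum>k\<in>K. \<Sum>\<^sub>\<infinity>n. f k n)"
proof -
  have "((\<lambda>n. \<Sum>k\<in>K. f k n) has_sum (\<Sum>k\<in>K. \<Sum>\<^sub>\<infinity>n. f k n)) UNIV"
    using assms by (induction K rule: finite_induct) (auto intro!: has_sum_add)
  then show ?thesis by (rule infsumI)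
qed

definition trig :: "(int^3 \<Rightarrow> complex) \<Rightarrow> real^3 \<Rightarrow> complex" where
  "trig a x = (\<Sum>\<^sub>\<infinity>n. a n * cis (nreal n \<bullet> x))"

lemma trig_summable:
  assumes "l1 a"
  shows "(\<lambda>n. a n * cis (nreal n \<bullet> x)) summable_on UNIV"
  by (rule abs_summable_summable, rule l1norm_leI(1)[OF assms]) (simp add: norm_mult)

text \<open>Orthogonality of the characters of Z/N, from the geometric sum of an N-th root of
  unity.\<close>

lemma root_of_unity_sum:
  fixes N :: nat and d :: int
  assumes "0 < N"
  shows "(\<Sum>k<N. cis (2 * pi * of_int d * real k / real N)) = (if int N dvd d then of_nat N else 0)"
proof -
  define z where "z = cis (2 * pi * of_int d / real N)"
  have pow: "cis (2 * pi * of_int d * real k / real N) = z ^ k" for k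
  proof -
    have "2 * pi * of_int d * real k / real N = real k * (2 * pi * of_int d / real N)" by simp
    then show ?thesis by (simp only: z_def Complex.DeMoivre)
  qed
  have zN: "z ^ N = 1"
    using assms by (simp add: z_def Complex.DeMoivre)
  show ?thesis
  proof (cases "int N dvd d")
    case True
    then obtain e where e: "d = int N * e" by blast
    have "2 * pi * of_int d / real N = 2 * pi * of_int e" using assms by (simp add: e)
    then have "z = cis (2 * pi * of_int e)" unfolding z_def by (rule arg_cong)
    also have "\<dots> = 1" by (rule cis_multiple_2pi) simp
    finally have "z = 1" .
    then show ?thesis using True unfolding pow by simp
  next
    case False
    have "z \<noteq> 1"
    proof
      assume "z = 1"
      then have "cos (2 * pi * of_int d / real N) = 1" by (simp add: z_def cis.code complex_eq_iff)
      then obtain e :: int where "2 * pi * of_int d / real N = of_int e * 2 * pi"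
        using cos_one_2pi_int by blast
      then have "real_of_int d = of_int e * real N" using assms by (simp add: field_simps)
      then have "d = e * int N" by (metis of_int_eq_iff of_int_mult of_int_of_nat_eq)
      then show False using False by simp
    qed
    then show ?thesis using False geometric_sum[of z N] zN unfolding pow by simp
  qed
qed

text \<open>Averaging N equally spaced translates in direction j, twisted by the unimodular phases
  \<open>c k\<close>, projects onto the frequencies with \<open>n $ j\<close> congruent to m modulo
  N. Such an average cannot exceed the supremum of the field; it is a discrete substitute for the
  integral that defines a Fourier coefficient.\<close>

lemma trig_average_bound:
  assumes a: "l1 a" and M: "\<And>x. norm (trig a x) \<le> M" and N: "0 < N"
  shows "norm (trig (\<lambda>n. if int N dvd n $ j - m then a n else 0) x) \<le> M"
proof -
  define y where "y k = x + (2 * pi * real k / real N) *\<^sub>R axis j 1" for k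
  define c where "c k = cis (- (2 * pi * of_int m * real k / real N))" for k
  have inner: "nreal n \<bullet> y k = nreal n \<bullet> x + 2 * pi * of_int (n $ j) * real k / real N" for n k
    by (simp add: y_def inner_add_right inner_axis nreal_def mult_ac)
  have trm: "c k * (a n * cis (nreal n \<bullet> y k))
      = a n * cis (nreal n \<bullet> x) * cis (2 * pi * of_int (n $ j - m) * real k / real N)" for n k
    unfolding inner c_def by (simp add: cis_mult[symmetric] diff_divide_distrib algebra_simps flip: cis_mult)
       (simp add: cis_mult algebra_simps)
  have "(\<Sum>k<N. c k * trig a (y k)) = (\<Sum>k<N. \<Sum>\<^sub>\<infinity>n. c k * (a n * cis (nreal n \<bullet> y k)))"
    unfolding trig_def by (intro sum.cong refl infsum_cmult_right[symmetric] trig_summable a)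
  also have "\<dots> = (\<Sum>\<^sub>\<infinity>n. \<Sum>k<N. c k * (a n * cis (nreal n \<bullet> y k)))"
    by (intro infsum_finite_sum[symmetric] summable_on_cmult_right trig_summable a) auto
  also have "\<dots> = (\<Sum>\<^sub>\<infinity>n. of_nat N * ((if int N dvd n $ j - m then a n else 0) * cis (nreal n \<bullet> x)))"
    unfolding trm sum_distrib_left[symmetric] root_of_unity_sum[OF N]
    by (intro infsum_cong) auto
  also have "\<dots> = of_nat N * trig (\<lambda>n. if int N dvd n $ j - m then a n else 0) x"
    unfolding trig_def
    by (intro infsum_cmult_right trig_summable l1norm_leI(1)[OF a]) auto
  finally have eq: "of_nat N * trig (\<lambda>n. if int N dvd n $ j - m then a n else 0) x = (\<Sum>k<N. c k * trig a (y k))" ..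
  have "real N * norm (trig (\<lambda>n. if int N dvd n $ j - m then a n else 0) x) = norm (\<Sum>k<N. c k * trig a (y k))"
    unfolding eq[symmetric] by (simp add: norm_mult)
  also have "\<dots> \<le> (\<Sum>k<N. M)"
    by (intro sum_norm_le) (simp add: norm_mult c_def M)
  finally show ?thesis using N by simp
qed

text \<open>Sieving all three coordinates with a large modulus leaves the frequency m and otherwise
  only frequencies outside \<open>F\<close>, whose total mass is below e.\<close>

lemma trig_coeff_bound:
  assumes a: "l1 a" and M: "\<And>x. norm (trig a x) \<le> M"
  shows "norm (a m) \<le> M"
proof (rule field_le_epsilon)
  fix e :: real assume e: "0 < e"
  obtain F where F: "finite F" "(\<Sum>\<^sub>\<infinity>n\<in>-F. norm (a n)) < e"
    using infsum_tail_small[OF a _ e] by auto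
  obtain N :: nat where N: "0 < N" "\<And>n j. n \<in> F \<Longrightarrow> \<bar>n $ j - m $ j\<bar> < int N"
  proof -
    define N where "N = Suc (\<Sum>n\<in>F. \<Sum>j\<in>UNIV. nat \<bar>n $ j - m $ j\<bar>)"
    have "\<bar>n $ j - m $ j\<bar> < int N" if n: "n \<in> F" for n j
    proof -
      have "nat \<bar>n $ j - m $ j\<bar> \<le> (\<Sum>j\<in>UNIV. nat \<bar>n $ j - m $ j\<bar>)"
        by (rule member_le_sum) auto
      also have "\<dots> \<le> (\<Sum>n\<in>F. \<Sum>j\<in>UNIV. nat \<bar>n $ j - m $ j\<bar>)"
        using n F(1) by (intro member_le_sum[of n F "\<lambda>n. \<Sum>j\<in>UNIV. nat \<bar>n $ j - m $ j\<bar>"]) auto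
      finally have "nat \<bar>n $ j - m $ j\<bar> < N" unfolding N_def by (rule le_imp_less_Suc)
      then show ?thesis by linarith
    qed
    then show ?thesis using that[of N] by (simp add: N_def)
  qed
  define b where "b n = (if \<forall>j. int N dvd n $ j - m $ j then a n else 0)" for n
  have l1if: "l1 (\<lambda>n. if P n then a' n else 0)" if "l1 a'" for P and a' :: "int^3 \<Rightarrow> complex"
    by (rule l1norm_leI(1)[OF that]) auto
  have b: "b = (\<lambda>n. if int N dvd n $ 1 - m $ 1 then if int N dvd n $ 2 - m $ 2 then
      if int N dvd n $ 3 - m $ 3 then a n else 0 else 0 else 0)"
    by (auto simp: b_def fun_eq_iff forall_3)
  have lb: "l1 b" unfolding b_def by (rule l1if[OF a])
  \<comment> \<open>The nested form of \<open>b\<close> lets the averaging bound act once for each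
    coordinate.\<close>
  have "norm (trig b 0) \<le> M"
    unfolding b by (intro trig_average_bound N(1) M l1if a)
  moreover have "trig b 0 = a m + (\<Sum>\<^sub>\<infinity>n\<in>-{m}. b n)"
  proof -
    have s: "b summable_on A" for A
      using summable_on_subset_banach[OF abs_summable_summable[OF lb]] by auto
    have "trig b 0 = (\<Sum>\<^sub>\<infinity>n\<in>{m} \<union> -{m}. b n)" by (simp add: trig_def)
    also have "\<dots> = (\<Sum>\<^sub>\<infinity>n\<in>{m}. b n) + (\<Sum>\<^sub>\<infinity>n\<in>-{m}. b n)"
      by (intro infsum_Un_disjoint s) auto
    finally show ?thesis by (simp add: b_def)
  qed
  moreover have "norm (\<Sum>\<^sub>\<infinity>n\<in>-{m}. b n) \<le> (\<Sum>\<^sub>\<infinity>n\<in>-F. norm (a n))"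
  proof -
    have sb: "(\<lambda>n. norm (b n)) summable_on A" for A
      using summable_on_subset_banach[OF lb] by auto
    have sa: "(\<lambda>n. norm (a n)) summable_on A" for A
      using summable_on_subset_banach[OF a] by auto
    have "norm (\<Sum>\<^sub>\<infinity>n\<in>-{m}. b n) \<le> (\<Sum>\<^sub>\<infinity>n\<in>-{m}. norm (b n))" by (rule norm_infsum_bound[OF sb])
    also have "\<dots> \<le> (\<Sum>\<^sub>\<infinity>n\<in>-F. norm (a n))"
    proof (rule infsum_mono_neutral[OF sb sa])
      show "norm (b n) \<le> 0" if "n \<in> - {m} - - F" for n
      proof -
        have "n \<in> F" "n \<noteq> m" using that by auto
        then obtain j where "n $ j \<noteq> m $ j" by (auto simp: vec_eq_iff)
        then have "\<not> int N dvd n $ j - m $ j"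
          using N(2)[OF \<open>n \<in> F\<close>, of j] zdvd_imp_le[of "int N" "\<bar>n $ j - m $ j\<bar>"] by fastforce
        then show ?thesis by (auto simp: b_def)
      qed
    qed (auto simp: b_def)
    finally show ?thesis .
  qed
  ultimately show "norm (a m) \<le> M + e"
    using F(2) norm_triangle_ineq4[of "a m + (\<Sum>\<^sub>\<infinity>n\<in>-{m}. b n)" "\<Sum>\<^sub>\<infinity>n\<in>-{m}. b n"] by simp
qed

text \<open>For a real field the series is invariant under conjugation, by the substitution n -> -n,
  so the real part taken in \<open>realize\<close> discards nothing.\<close>

lemma of_real_realize:
  assumes "l1 c" "real_field c"
  shows "of_real (realize c x $ i) = trig (\<lambda>n. c n $ i) x"
proof -
  have l: "l1 (\<lambda>n. c n $ i)"
    by (rule l1norm_leI(1)[OF assms(1)]) (rule Finite_Cartesian_Product.norm_nth_le)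
  have bij: "bij (uminus :: int^3 \<Rightarrow> int^3)"
    by (rule bij_betw_byWitness[where f'=uminus]) auto
  have "cnj (trig (\<lambda>n. c n $ i) x) = (\<Sum>\<^sub>\<infinity>n. cnj (c n $ i * cis (nreal n \<bullet> x)))"
    by (simp add: trig_def del: complex_cnj_mult)
  also have "\<dots> = (\<Sum>\<^sub>\<infinity>n. c (- n) $ i * cis (nreal (- n) \<bullet> x))"
    using assms(2) by (simp add: real_field_def nreal_minus cis_cnj)
  also have "\<dots> = trig (\<lambda>n. c n $ i) x"
    using infsum_reindex_bij_betw[OF bij, of "\<lambda>n. c n $ i * cis (nreal n \<bullet> x)"] by (simp add: trig_def)
  finally have "trig (\<lambda>n. c n $ i) x \<in> \<real>" by (simp add: Reals_cnj_iff)
  then show ?thesis by (simp add: realize_def trig_def)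
qed

text \<open>Differences are used because smoothness is known of the function
  \<open>realize c\<close>, while its series cannot yet be differentiated termwise. On the
  coefficients, a difference acts for any summable series.\<close>

definition fdiff :: "real \<Rightarrow> 3 \<Rightarrow> (real^3 \<Rightarrow> 'a::real_normed_vector) \<Rightarrow> real^3 \<Rightarrow> 'a" where
  "fdiff h j f x = f (x + h *\<^sub>R axis j 1) - f x"

text \<open>A difference is a linear combination of translates and so commutes with
  differentiation.\<close>

lemma fdiff_pow_derivative:
  assumes "\<And>x. (f has_derivative (\<lambda>v. f' v x)) (at x)"
  shows "((fdiff h j ^^ k) f has_derivative (\<lambda>v. (fdiff h j ^^ k) (f' v) x)) (at x)"
proof (induction k arbitrary: x)
  case (Suc k)
  have "((\<lambda>x. (fdiff h j ^^ k) f (x + h *\<^sub>R axis j 1)) has_derivative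
      (\<lambda>v. (fdiff h j ^^ k) (f' v) (x + h *\<^sub>R axis j 1))) (at x)"
    by (rule has_derivative_compose[of "\<lambda>x. x + h *\<^sub>R axis j 1" "\<lambda>v. v", OF _ Suc])
       (auto intro!: derivative_eq_intros)
  from has_derivative_diff[OF this Suc[of x]]
  show ?case by (simp add: fdiff_def[abs_def])
qed (simp add: assms)

definition periodic3 :: "(real^3 \<Rightarrow> 'a) \<Rightarrow> bool" where
  "periodic3 f \<longleftrightarrow> (\<forall>x n. f (x + (2 * pi) *\<^sub>R nreal n) = f x)"

text \<open>A lattice translation, found by rounding each coordinate down, moves any point into the
  compact cube of side 2 pi.\<close>

lemma periodic3_bounded:
  fixes f :: "real^3 \<Rightarrow> 'a::real_normed_vector"
  assumes "continuous_on UNIV f" "periodic3 f"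
  obtains M where "\<And>x. norm (f x) \<le> M"
proof -
  have "compact (f ` cbox 0 (\<chi> i. 2 * pi))"
    by (intro compact_continuous_image continuous_on_subset[OF assms(1)]) auto
  then obtain M where M: "\<forall>y\<in>f ` cbox 0 (\<chi> i. 2 * pi). norm y \<le> M"
    using compact_imp_bounded bounded_iff by blast
  have "norm (f x) \<le> M" for x
  proof -
    define n :: "int^3" where "n = (\<chi> i. - \<lfloor>x $ i / (2 * pi)\<rfloor>)"
    have "(x + (2 * pi) *\<^sub>R nreal n) $ i = 2 * pi * frac (x $ i / (2 * pi))" for i
      by (simp add: n_def nreal_def frac_def field_simps)
    then have "x + (2 * pi) *\<^sub>R nreal n \<in> cbox 0 (\<chi> i. 2 * pi)"
      by (simp add: mem_box_cart frac_ge_0 less_imp_le[OF frac_lt_1])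
    then show ?thesis using M assms(2) unfolding periodic3_def by (metis image_eqI)
  qed
  then show ?thesis by (rule that)
qed

lemma periodic3_derivative:
  assumes "\<And>x. (f has_derivative f' x) (at x)" "periodic3 f"
  shows "periodic3 (\<lambda>x. f' x v)"
  unfolding periodic3_def
proof (intro allI)
  fix x n
  have "((\<lambda>y. f (y + (2 * pi) *\<^sub>R nreal n)) has_derivative f' (x + (2 * pi) *\<^sub>R nreal n)) (at x)"
    by (rule has_derivative_compose[of "\<lambda>x. x + (2 * pi) *\<^sub>R nreal n" "\<lambda>v. v", OF _ assms(1)])
       (auto intro!: derivative_eq_intros)
  then have "(f has_derivative f' (x + (2 * pi) *\<^sub>R nreal n)) (at x)"
    using assms(2) by (simp add: periodic3_def)
  then have "f' (x + (2 * pi) *\<^sub>R nreal n) = f' x"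
    by (rule has_derivative_unique[OF _ assms(1)])
  then show "f' (x + (2 * pi) *\<^sub>R nreal n) v = f' x v" by simp
qed

text \<open>Each step removes one difference by the mean value inequality along the j-th axis. What
  remains are k differences of the partial derivative, again periodic and one order less smooth;
  \<open>M\<close> does not depend on h.\<close>

lemma fdiff_pow_bound:
  fixes f :: "real^3 \<Rightarrow> 'a::real_normed_vector"
  assumes "Ck_on k UNIV f" "periodic3 f"
  shows "\<exists>M. \<forall>h x. norm ((fdiff h j ^^ k) f x) \<le> \<bar>h\<bar> ^ k * M"
  using assms
proof (induction k arbitrary: f)
  case 0
  then show ?case using periodic3_bounded[of f] by auto
next
  case (Suc k)
  obtain f' where f': "\<forall>x\<in>UNIV. (f has_derivative f' x) (at x within UNIV)" "\<forall>i\<in>Basis. Ck_on k UNIV (\<lambda>x. f' x i)"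
    using Suc.prems(1) unfolding Ck_on.simps by (elim exE conjE)
  define e :: "real^3" where "e = axis j 1"
  have ne: "norm e = 1" "e \<in> Basis" by (auto simp: e_def)
  have d: "(f has_derivative (\<lambda>v. f' x v)) (at x)" for x using f'(1) by simp
  obtain M where M: "\<And>h x. norm ((fdiff h j ^^ k) (\<lambda>x. f' x e) x) \<le> \<bar>h\<bar> ^ k * M"
    using Suc.IH[of "\<lambda>x. f' x e"] f'(2) ne(2) periodic3_derivative[OF d Suc.prems(2)] by blast
  have "norm ((fdiff h j ^^ Suc k) f x) \<le> \<bar>h\<bar> ^ Suc k * M" for h x
  proof -
    define g where "g = (fdiff h j ^^ k) f"
    have g: "(g has_derivative (\<lambda>v. (fdiff h j ^^ k) (\<lambda>x. f' x v) x)) (at x)" for x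
      unfolding g_def by (rule fdiff_pow_derivative[of f "\<lambda>v x. f' x v"]) (rule d)
    \<comment> \<open>The k-fold difference along a line; \<open>p h - p 0\<close> is the next
      difference at x.\<close>
    define p where "p s = g (x + s *\<^sub>R e)" for s
    have p: "(p has_derivative (\<lambda>s'. (fdiff h j ^^ k) (\<lambda>x. f' x (s' *\<^sub>R e)) (x + s *\<^sub>R e))) (at s)" for s
      unfolding p_def[abs_def]
      by (rule has_derivative_compose[of "\<lambda>s. x + s *\<^sub>R e" "\<lambda>s. s *\<^sub>R e", OF _ g])
         (auto intro!: derivative_eq_intros)
    have lin: "(fdiff h j ^^ k) (\<lambda>x. f' x (s' *\<^sub>R e)) y = s' *\<^sub>R (fdiff h j ^^ k) (\<lambda>x. f' x e) y" for s' y
      using linear_scale[OF has_derivative_linear[OF g[of y]]] .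
    have "norm (p h - p 0) \<le> (\<bar>h\<bar> ^ k * M) * norm (h - 0)"
    proof (rule differentiable_bound[OF convex_UNIV])
      show "(p has_derivative (\<lambda>s'. s' *\<^sub>R (fdiff h j ^^ k) (\<lambda>x. f' x e) (x + s *\<^sub>R e))) (at s within UNIV)" for s
        using p unfolding lin .
      show "onorm (\<lambda>s'. s' *\<^sub>R (fdiff h j ^^ k) (\<lambda>x. f' x e) (x + s *\<^sub>R e)) \<le> \<bar>h\<bar> ^ k * M" for s
      proof (rule onorm_bound)
        show "0 \<le> \<bar>h\<bar> ^ k * M" using M[of h x] norm_ge_zero order_trans by blast
        show "norm (s' *\<^sub>R (fdiff h j ^^ k) (\<lambda>x. f' x e) (x + s *\<^sub>R e)) \<le> \<bar>h\<bar> ^ k * M * norm s'" for s'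
          using mult_right_mono[OF M[of h "x + s *\<^sub>R e"], of "norm s'"] by (simp add: mult.commute)
      qed
    qed auto
    then show ?thesis by (simp add: p_def g_def e_def fdiff_def mult_ac)
  qed
  then show ?case by blast
qed

text \<open>The Fourier side of \<open>fdiff\<close>: a translation by h multiplies the coefficient
  by exp (i n_j h).\<close>

definition dcoeff :: "real \<Rightarrow> 3 \<Rightarrow> coeffs \<Rightarrow> coeffs" where
  "dcoeff h j c n = cscale (cis (of_int (n $ j) * h) - 1) (c n)"

lemma norm_cscale: "norm (cscale a u) = norm a * norm u"
  by (simp add: cscale_def norm_vec_def norm_mult L2_set_right_distrib)

lemma dcoeff_facts:
  assumes "l1 c" "real_field c"
  shows "l1 (dcoeff h j c)" "real_field (dcoeff h j c)" "realize (dcoeff h j c) = fdiff h j (realize c)"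
proof -
  show l: "l1 (dcoeff h j c)"
  proof (rule l1norm_leI(1)[OF summable_on_cmult_right[OF assms(1)]])
    fix n
    have "norm (cis (of_int (n $ j) * h) - 1) \<le> 2"
      using norm_triangle_ineq4[of "cis (of_int (n $ j) * h)" 1] by simp
    then show "norm (dcoeff h j c n) \<le> 2 * norm (c n)"
      unfolding dcoeff_def norm_cscale by (intro mult_right_mono) auto
  qed
  show r: "real_field (dcoeff h j c)"
    using assms(2) by (simp add: real_field_def dcoeff_def cscale_def vec_eq_iff cis_cnj)
  show "realize (dcoeff h j c) = fdiff h j (realize c)"
  proof (rule ext)
    fix x
    have l': "l1 (\<lambda>n. c n $ i)" for i
      by (rule l1norm_leI(1)[OF assms(1)]) (rule Finite_Cartesian_Product.norm_nth_le)
    have eq: "dcoeff h j c n $ i * cis (nreal n \<bullet> x)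
        = c n $ i * cis (nreal n \<bullet> (x + h *\<^sub>R axis j 1)) + - (c n $ i * cis (nreal n \<bullet> x))" for n i
      by (simp add: dcoeff_def cscale_def inner_add_right inner_axis nreal_def algebra_simps flip: cis_mult)
    have "(of_real (realize (dcoeff h j c) x $ i) :: complex) = of_real (fdiff h j (realize c) x $ i)" for i
    proof -
      have "of_real (realize (dcoeff h j c) x $ i)
          = (\<Sum>\<^sub>\<infinity>n. c n $ i * cis (nreal n \<bullet> (x + h *\<^sub>R axis j 1)) + - (c n $ i * cis (nreal n \<bullet> x)))"
        unfolding of_real_realize[OF l r] trig_def eq ..
      also have "\<dots> = trig (\<lambda>n. c n $ i) (x + h *\<^sub>R axis j 1) + - trig (\<lambda>n. c n $ i) x"
        unfolding trig_def infsum_uminus[symmetric]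
        by (intro infsum_add trig_summable l') (simp add: summable_on_uminus trig_summable[OF l'])
      finally show ?thesis by (simp add: of_real_realize[OF assms, symmetric] fdiff_def)
    qed
    then show "realize (dcoeff h j c) x = fdiff h j (realize c) x" by (simp add: vec_eq_iff)
  qed
qed

lemma dcoeff_pow:
  assumes "l1 c" "real_field c"
  shows "l1 ((dcoeff h j ^^ k) c) \<and> real_field ((dcoeff h j ^^ k) c)
    \<and> realize ((dcoeff h j ^^ k) c) = (fdiff h j ^^ k) (realize c)"
  using assms by (induction k) (auto simp: dcoeff_facts)

lemma norm_dcoeff_pow: "norm ((dcoeff h j ^^ k) c n) = norm (cis (of_int (n $ j) * h) - 1) ^ k * norm (c n)"
  by (induction k) (auto simp: dcoeff_def norm_cscale)

text \<open>Each of the three components of \<open>c n\<close> is at most \<open>M\<close>; their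
  sum bounds the norm, whence the 3.\<close>

lemma realize_coeff_bound:
  assumes "l1 c" "real_field c" "\<And>x. norm (realize c x) \<le> M"
  shows "norm (c n) \<le> 3 * M"
proof -
  have l: "l1 (\<lambda>n. c n $ i)" for i
    by (rule l1norm_leI(1)[OF assms(1)]) (rule Finite_Cartesian_Product.norm_nth_le)
  have "norm (trig (\<lambda>n. c n $ i) x) \<le> M" for i x
    unfolding of_real_realize[OF assms(1,2), symmetric] norm_of_real
    using component_le_norm_cart[of "realize c x" i] assms(3)[of x] by linarith
  then have "norm (c n $ i) \<le> M" for i by (rule trig_coeff_bound[OF l])
  then have "(\<Sum>i\<in>UNIV. norm (c n $ i)) \<le> (\<Sum>i\<in>(UNIV::3 set). M)" by (intro sum_mono)
  moreover have "norm (c n) \<le> (\<Sum>i\<in>UNIV. norm (c n $ i))"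
    unfolding norm_vec_def by (rule L2_set_le_sum) simp
  ultimately show ?thesis by simp
qed

lemma realize_periodic: "periodic3 (realize c)"
proof -
  have "cis (nreal n \<bullet> (x + (2 * pi) *\<^sub>R nreal m)) = cis (nreal n \<bullet> x)" for n m x
  proof -
    have "nreal n \<bullet> nreal m = of_int (\<Sum>i\<in>UNIV. n $ i * m $ i)"
      by (simp add: nreal_def inner_vec_def)
    then have "cis (2 * pi * (nreal n \<bullet> nreal m)) = 1" by (metis Ints_of_int cis_multiple_2pi)
    then show ?thesis by (simp add: inner_add_right flip: cis_mult)
  qed
  then show ?thesis by (simp add: periodic3_def realize_def)
qed

text \<open>The k-fold difference has coefficients of size |exp (i n_j h) - 1|^k |c n| and is
  bounded by |h|^k M. Dividing by |h|^k and letting h tend to 0 turns the symbol into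
  |n_j|^k.\<close>

lemma smooth_coeff_bound:
  assumes l: "l1 c" and r: "real_field c" and s: "smooth_on UNIV (realize c)"
  shows "\<exists>M. \<forall>n. \<bar>of_int (n $ j)\<bar> ^ k * norm (c n) \<le> M"
proof -
  obtain M where M: "\<And>h x. norm ((fdiff h j ^^ k) (realize c) x) \<le> \<bar>h\<bar> ^ k * M"
    using fdiff_pow_bound[OF _ realize_periodic, of k c j] s unfolding smooth_on_def by blast
  have "\<bar>of_int (n $ j)\<bar> ^ k * norm (c n) \<le> 3 * M" for n
  proof -
    define d where "d = real_of_int (n $ j)"
    have q: "norm ((cis (d * h) - 1) /\<^sub>R h) ^ k * norm (c n) \<le> 3 * M" if h: "h \<noteq> 0" for h
    proof -
      have "norm (cis (d * h) - 1) ^ k * norm (c n) \<le> 3 * (\<bar>h\<bar> ^ k * M)"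
        unfolding d_def norm_dcoeff_pow[symmetric]
        using dcoeff_pow[OF l r] M by (intro realize_coeff_bound) auto
      then have "inverse (\<bar>h\<bar> ^ k) * (norm (cis (d * h) - 1) ^ k * norm (c n)) \<le> inverse (\<bar>h\<bar> ^ k) * (3 * (\<bar>h\<bar> ^ k * M))"
        by (intro mult_left_mono) auto
      also have "\<dots> = 3 * M" using h by simp
      finally show ?thesis by (simp only: norm_scaleR power_mult_distrib abs_inverse power_inverse mult.assoc)
    qed
    \<comment> \<open>The difference quotient of the symbol tends to its derivative i d at h =
      0.\<close>
    have "((\<lambda>h. cis (d * h)) has_vector_derivative d *\<^sub>R \<i>) (at 0)"
      unfolding has_vector_derivative_def by (auto intro!: derivative_eq_intros)
    then have lim: "((\<lambda>h. norm (cis (d * h) - 1 - h *\<^sub>R d *\<^sub>R \<i>) / norm h) \<longlongrightarrow> 0) (at 0)"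
      unfolding has_vector_derivative_def has_derivative_at by simp
    have "((\<lambda>h. (cis (d * h) - 1) /\<^sub>R h - d *\<^sub>R \<i>) \<longlongrightarrow> 0) (at 0)"
    proof (rule Lim_null_comparison[OF _ lim])
      show "\<forall>\<^sub>F h in at 0. norm ((cis (d * h) - 1) /\<^sub>R h - d *\<^sub>R \<i>) \<le> norm (cis (d * h) - 1 - h *\<^sub>R d *\<^sub>R \<i>) / norm h"
        unfolding eventually_at_filter
      proof (intro always_eventually allI impI)
        fix h :: real assume "h \<noteq> 0"
        then have "(cis (d * h) - 1) /\<^sub>R h - d *\<^sub>R \<i> = (cis (d * h) - 1 - h *\<^sub>R d *\<^sub>R \<i>) /\<^sub>R h"
          by (simp add: scaleR_diff_right)
        then have "norm ((cis (d * h) - 1) /\<^sub>R h - d *\<^sub>R \<i>) = norm ((cis (d * h) - 1 - h *\<^sub>R d *\<^sub>R \<i>) /\<^sub>R h)"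
          by (rule arg_cong)
        also have "\<dots> = norm (cis (d * h) - 1 - h *\<^sub>R d *\<^sub>R \<i>) / norm h"
          unfolding norm_scaleR by (simp add: divide_inverse mult.commute)
        finally show "norm ((cis (d * h) - 1) /\<^sub>R h - d *\<^sub>R \<i>) \<le> norm (cis (d * h) - 1 - h *\<^sub>R d *\<^sub>R \<i>) / norm h" by simp
      qed
    qed
    then have "((\<lambda>h. (cis (d * h) - 1) /\<^sub>R h) \<longlongrightarrow> d *\<^sub>R \<i>) (at 0)" by (rule LIM_zero_cancel)
    then have "((\<lambda>h. norm ((cis (d * h) - 1) /\<^sub>R h) ^ k * norm (c n)) \<longlongrightarrow> norm (d *\<^sub>R \<i>) ^ k * norm (c n)) (at 0)"
      by (intro tendsto_mult tendsto_power tendsto_norm tendsto_const)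
    then have "norm (d *\<^sub>R \<i>) ^ k * norm (c n) \<le> 3 * M"
    proof (rule tendsto_upperbound)
      show "\<forall>\<^sub>F h in at 0. norm ((cis (d * h) - 1) /\<^sub>R h) ^ k * norm (c n) \<le> 3 * M"
        unfolding eventually_at_filter by (intro always_eventually allI impI q)
    qed simp
    then show ?thesis by (simp add: d_def)
  qed
  then show ?thesis by blast
qed

lemma summable_on_prod:
  fixes F :: "'a \<Rightarrow> real" and G :: "'b \<Rightarrow> real"
  assumes "F summable_on UNIV" "G summable_on UNIV" "\<And>x. 0 \<le> F x" "\<And>y. 0 \<le> G y"
  shows "(\<lambda>(x, y). F x * G y) summable_on UNIV"
proof -
  have "(\<lambda>(x, y). F x * G y) summable_on UNIV \<times> UNIV"
    by (rule summable_on_SigmaI[where g="\<lambda>x. F x * (\<Sum>\<^sub>\<infinity>y. G y)"])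
       (use assms in \<open>auto intro: has_sum_cmult_right summable_on_cmult_left\<close>)
  then show ?thesis by simp
qed

lemma summable_inverse_square_int: "(\<lambda>a::int. 1 / (1 + \<bar>real_of_int a\<bar>)\<^sup>2) summable_on UNIV"
proof -
  let ?f = "\<lambda>a::int. 1 / (1 + \<bar>real_of_int a\<bar>)\<^sup>2"
  have "summable (\<lambda>k. inverse (real (Suc k) ^ 2))"
    using inverse_power_summable[of 2, where 'a=real] by (subst summable_Suc_iff) auto
  then have "(\<lambda>k. 1 / (1 + real k)\<^sup>2) summable_on UNIV"
    by (intro summable_nonneg_imp_summable_on) (auto simp: inverse_eq_divide add_ac)
  then have nat: "(?f \<circ> h) summable_on UNIV" if "\<And>k. \<bar>h k\<bar> = int k" for h
    using that by (simp add: o_def flip: of_int_abs)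
  have "?f summable_on range int"
    by (subst summable_on_reindex) (auto intro: nat simp del: o_apply)
  moreover have "?f summable_on range (\<lambda>k. - int k)"
    by (subst summable_on_reindex) (auto intro: nat simp: inj_on_def simp del: o_apply)
  ultimately have "?f summable_on (range int \<union> range (\<lambda>k. - int k))" by (rule summable_on_union)
  moreover have "range int \<union> range (\<lambda>k. - int k) = UNIV"
  proof -
    have "a \<in> range int \<union> range (\<lambda>k. - int k)" for a
      by (cases a rule: int_cases2) auto
    then show ?thesis by blast
  qed
  ultimately show ?thesis by simp
qed

text \<open>The exponent is 2 + 2 + 2: each factor (1 + |n|)^2 dominates one (1 + |n_i|)^2, and a
  product of three summable one-dimensional families is summable.\<close>

lemma summable_inverse_power_lattice: "(\<lambda>n::int^3. 1 / (1 + norm (nreal n)) ^ 6) summable_on UNIV"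
proof -
  define g where "g a = 1 / (1 + \<bar>real_of_int a\<bar>)\<^sup>2" for a
  have g: "g summable_on UNIV" "0 \<le> g a" for a
    using summable_inverse_square_int by (auto simp: g_def[abs_def])
  define h where "h n = (n $ 1, n $ 2, n $ 3)" for n :: "int^3"
  define G where "G = (\<lambda>(a, p). g a * (case p of (b, c) \<Rightarrow> g b * g c))"
  have "G summable_on UNIV"
    unfolding G_def by (intro summable_on_prod g) (auto simp: g)
  then have "G summable_on range h" by (rule summable_on_subset_banach) simp
  then have "(G \<circ> h) summable_on UNIV"
    by (subst summable_on_reindex[symmetric]) (auto simp: h_def inj_on_def vec_eq_iff forall_3)
  then show ?thesis
  proof (rule summable_on_comparison_test)
    fix n :: "int^3"
    have "\<bar>real_of_int (n $ i)\<bar> \<le> norm (nreal n)" for i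
      using component_le_norm_cart[of "nreal n" i] by (simp add: nreal_def)
    then have le: "(1 + \<bar>real_of_int (n $ i)\<bar>)\<^sup>2 \<le> (1 + norm (nreal n))\<^sup>2" for i
      by (intro power_mono) auto
    have "1 / (1 + norm (nreal n)) ^ 6 = 1 / (1 + norm (nreal n))\<^sup>2 * (1 / (1 + norm (nreal n))\<^sup>2 * (1 / (1 + norm (nreal n))\<^sup>2))"
      by (simp flip: power_add)
    also have "\<dots> \<le> g (n $ 1) * (g (n $ 2) * g (n $ 3))"
      unfolding g_def using le by (intro mult_mono divide_left_mono) (auto intro!: mult_pos_pos zero_less_power add_pos_nonneg)
    finally show "1 / (1 + norm (nreal n)) ^ 6 \<le> (G \<circ> h) n" by (simp add: G_def h_def)
  qed simp
qed

text \<open>Summability is bought with six extra powers: (1 + |n|)^(k+6) |c n| is bounded and (1 +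
  |n|)^(-6) is summable over the lattice.\<close>

lemma smooth_rapid:
  assumes l: "l1 c" and r: "real_field c" and s: "smooth_on UNIV (realize c)"
  shows "rapid (\<lambda>n. norm (c n))"
  unfolding rapid_def
proof (intro conjI allI)
  have bound: "\<exists>M. \<forall>n. (1 + norm (nreal n)) ^ k * norm (c n) \<le> M" for k
  proof -
    have "\<forall>j. \<exists>M. \<forall>n. \<bar>real_of_int (n $ j)\<bar> ^ k * norm (c n) \<le> M"
      using smooth_coeff_bound[OF l r s] by blast
    then obtain M where M: "\<And>j n. \<bar>real_of_int (n $ j)\<bar> ^ k * norm (c n) \<le> M j" by metis
    have "(1 + norm (nreal n)) ^ k * norm (c n) \<le> 4 ^ k * (l1norm c + (\<Sum>j\<in>UNIV. M j))" for n
    proof -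
      \<comment> \<open>With this maximum, 1 + |n| is at most 4 m. If 1 attains it, the l1 norm
        bounds the term; if coordinate j does, \<open>M j\<close> bounds it.\<close>
      define m where "m = Max (insert 1 (range (\<lambda>j. \<bar>real_of_int (n $ j)\<bar>)))"
      have m: "1 \<le> m" "\<bar>real_of_int (n $ j)\<bar> \<le> m" for j
        unfolding m_def by (rule Max_ge; simp)+
      have "norm (nreal n) \<le> (\<Sum>j\<in>UNIV. \<bar>nreal n $ j\<bar>)" by (rule norm_le_l1_cart)
      also have "\<dots> \<le> (\<Sum>j\<in>(UNIV::3 set). m)" using m by (intro sum_mono) (simp add: nreal_def)
      finally have "1 + norm (nreal n) \<le> 4 * m" using m(1) by simp
      then have "(1 + norm (nreal n)) ^ k \<le> (4 * m) ^ k" by (intro power_mono) auto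
      then have "(1 + norm (nreal n)) ^ k * norm (c n) \<le> 4 ^ k * (m ^ k * norm (c n))"
        using mult_right_mono[of _ _ "norm (c n)"] by (fastforce simp: power_mult_distrib)
      also have "m ^ k * norm (c n) \<le> l1norm c + (\<Sum>j\<in>UNIV. M j)"
      proof -
        have M0: "0 \<le> M j" for j using M[of n j] by (meson order_trans mult_nonneg_nonneg zero_le_power abs_ge_zero norm_ge_zero)
        have "m \<in> insert 1 (range (\<lambda>j. \<bar>real_of_int (n $ j)\<bar>))" unfolding m_def by (intro Max_in) auto
        then consider "m = 1" | j where "m = \<bar>real_of_int (n $ j)\<bar>" by auto
        then show ?thesis
        proof cases
          case 1
          then show ?thesis using norm_le_l1norm[OF l, of n] sum_nonneg[of UNIV M] M0 by simp
        next
          case (2 j)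
          then have "m ^ k * norm (c n) \<le> M j" using M[of n j] by simp
          also have "M j \<le> (\<Sum>j\<in>UNIV. M j)" using M0 by (intro member_le_sum) auto
          finally show ?thesis using l1norm_nonneg[of c] by linarith
        qed
      qed
      finally show ?thesis by simp
    qed
    then show ?thesis by blast
  qed
  fix k
  obtain M where M: "\<And>n. (1 + norm (nreal n)) ^ (k + 6) * norm (c n) \<le> M" using bound by blast
  show "(\<lambda>n. (1 + norm (nreal n)) ^ k * norm (c n)) summable_on UNIV"
  proof (rule summable_on_comparison_test[OF summable_on_cmult_right[OF summable_inverse_power_lattice]])
    fix n
    have "0 < (1 + norm (nreal n)) ^ 6" by (intro zero_less_power) (simp add: add_pos_nonneg)
    then show "(1 + norm (nreal n)) ^ k * norm (c n) \<le> M * (1 / (1 + norm (nreal n)) ^ 6)"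
      using M[of n] by (simp add: pos_le_divide_eq power_add mult_ac)
  qed simp
qed simp

text \<open>Convexity of (1 + y)^k between y = 0 and y = x. The weight with parameter d exceeds 1 by
  at most d times the full polynomial weight, so for small d it barely changes the weighted sum of
  the data.\<close>

lemma power_convex_bound:
  fixes d x :: real
  assumes "0 \<le> d" "d \<le> 1" "0 \<le> x"
  shows "(1 + d * x) ^ k \<le> 1 + d * (1 + x) ^ k"
proof -
  have "(1 + d * x) ^ k \<le> 1 + d * ((1 + x) ^ k - 1)"
  proof (induction k)
    case (Suc k)
    define P where "P = (1 + x) ^ k"
    have P: "1 \<le> P" using assms by (simp add: P_def)
    have "(1 + d * x) ^ Suc k \<le> (1 + d * x) * (1 + d * (P - 1))"
      using Suc assms by (simp add: P_def mult_left_mono)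
    also have "\<dots> = 1 + d * (P - 1 + x) + (d * d) * (x * (P - 1))" by (simp add: algebra_simps)
    also have "\<dots> \<le> 1 + d * (P - 1 + x) + d * (x * (P - 1))"
      using assms P by (intro add_left_mono mult_right_mono mult_left_le_one_le) auto
    also have "\<dots> = 1 + d * ((1 + x) ^ Suc k - 1)" by (simp add: P_def algebra_simps)
    finally show ?case .
  qed simp
  also have "\<dots> \<le> 1 + d * (1 + x) ^ k" using assms by (simp add: algebra_simps)
  finally show ?thesis .
qed

section \<open>Linear images and reflections of convolutions and iterates\<close>

lemma convolve_linear:
  assumes b: "bilinear_with b Q" and h: "bounded_linear h" and f: "l1 f" and g: "l1 g"
  shows "h (convolve b f g n) = convolve (\<lambda>x y. h (b x y)) f g n"
proof -
  have s: "(\<lambda>m. b (f m) (g (n - m))) summable_on UNIV"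
    by (rule abs_summable_summable[OF convolve_summable(1)[OF b f norm_le_l1norm[OF g]]])
  show ?thesis
    unfolding convolve_def
    using has_sum_bounded_linear[OF h has_sum_infsum[OF s]] by (simp add: infsumI)
qed

text \<open>Substitution of -m for m. With conjugations as \<open>Jf\<close>, \<open>Jg\<close> and
  \<open>Jb\<close> it says that products of real fields are real.\<close>

lemma convolve_reflect:
  fixes f :: "'i::ab_group_add \<Rightarrow> 'a::banach" and g :: "'i \<Rightarrow> 'b::banach" and b :: "'a \<Rightarrow> 'b \<Rightarrow> 'c::banach"
  assumes b: "bilinear_with b Q" and Jb: "bounded_linear Jb" and f: "l1 f" and g: "l1 g"
    and sf: "\<And>n. f (- n) = Jf (f n)" and sg: "\<And>n. g (- n) = Jg (g n)"
    and J: "\<And>x y. b (Jf x) (Jg y) = Jb (b x y)"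
  shows "convolve b f g (- n) = Jb (convolve b f g n)"
proof -
  have bij: "bij (uminus :: 'i \<Rightarrow> 'i)"
    by (rule bij_betw_byWitness[where f'=uminus]) auto
  have "convolve b f g (- n) = (\<Sum>\<^sub>\<infinity>m. b (f (- m)) (g (- n - - m)))"
    unfolding convolve_def
    using infsum_reindex_bij_betw[OF bij, of "\<lambda>m. b (f m) (g (- n - m))"] by simp
  also have "\<dots> = (\<Sum>\<^sub>\<infinity>m. b (f (- m)) (g (- (n - m))))"
    by (simp add: algebra_simps)
  also have "\<dots> = convolve (\<lambda>x y. Jb (b x y)) f g n"
    unfolding convolve_def sf sg J ..
  finally show ?thesis by (simp add: convolve_linear[OF b Jb f g])
qed

context duhamel_small
begin

text \<open>All ingredients of the equation commute with n -> -n combined with the linear maps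
  \<open>Ja\<close>, \<open>Jw\<close>, \<open>Jc\<close>, and the iteration starts at 0, so every
  iterate inherits the symmetry.\<close>

lemma picard_reflect:
  assumes Ja: "bounded_linear Ja" and Jw: "bounded_linear Jw" and Jc: "bounded_linear Jc"
    and Jq: "\<And>x y. q (Ja x) (Ja y) = Jw (q x y)"
    and Jp: "\<And>x y. p (Ja x) (Ja y) = Jc (p x y)"
    and Jr: "\<And>x y. r (Jc x) (Ja y) = Jw (r x y)"
    and Jk: "\<And>\<tau> n w. kern \<tau> (- n) (Jw w) = Ja (kern \<tau> n w)"
    and Jl: "\<And>t n. lin t (- n) = Ja (lin t n)"
  shows "t \<in> {0..T} \<Longrightarrow> picard j t (- n) = Ja (picard j t n)"
proof (induction j arbitrary: t n)
  case 0
  then show ?case using linear_0[OF bounded_linear.linear[OF Ja]] by simp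
next
  case (Suc j)
  have t: "t \<in> {0..T}" by fact
  have N: "nonlin (picard j s) (- n) = Jw (nonlin (picard j s) n)" if s: "s \<in> {0..T}" for s n
  proof -
    have IH: "picard j s (- n) = Ja (picard j s n)" for n by (rule Suc.IH[OF s])
    have l: "l1 (picard j s)" using picard_cont[of j] s by (simp add: cont_l1_def)
    have 1: "convolve q (picard j s) (picard j s) (- n) = Jw (convolve q (picard j s) (picard j s) n)" for n
      by (rule convolve_reflect[where f="picard j s" and g="picard j s" and b=q and Jf=Ja and Jg=Ja and Jb=Jw, OF q Jw l l IH IH Jq])
    have 2: "convolve p (picard j s) (picard j s) (- n) = Jc (convolve p (picard j s) (picard j s) n)" for n
      by (rule convolve_reflect[where f="picard j s" and g="picard j s" and b=p and Jf=Ja and Jg=Ja and Jb=Jc, OF p Jc l l IH IH Jp])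
    have 3: "convolve r (convolve p (picard j s) (picard j s)) (picard j s) (- n)
        = Jw (convolve r (convolve p (picard j s) (picard j s)) (picard j s) n)" for n
      by (rule convolve_reflect[where f="convolve p (picard j s) (picard j s)" and g="picard j s" and b=r and Jf=Jc and Jg=Ja and Jb=Jw,
          OF r Jw convolve_l1(1)[OF p l l] l 2 IH Jr])
    show ?thesis
      unfolding nonlin_def 1 3 by (simp add: linear_add[OF bounded_linear.linear[OF Jw]])
  qed
  have cont: "continuous_on {0..t} (\<lambda>s. nonlin (picard j s) n)"
    by (rule continuous_on_subset[OF nonlin_cont[OF picard_cont]]) (use t in auto)
  have "integral {0..t} (\<lambda>s. kern (t - s) (- n) (nonlin (picard j s) (- n)))
      = integral {0..t} (Ja \<circ> (\<lambda>s. kern (t - s) n (nonlin (picard j s) n)))"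
    by (rule integral_cong) (use t N Jk in auto)
  also have "\<dots> = Ja (integral {0..t} (\<lambda>s. kern (t - s) n (nonlin (picard j s) n)))"
    by (rule integral_linear[OF kern_integrable[OF cont] Ja])
  finally show ?case
    by (simp add: Psi_def Jl linear_add[OF bounded_linear.linear[OF Ja]])
qed

text \<open>The weights (1 + d |n|)^k with small d cost almost nothing on the data, so the existence time
  does not depend on the order k of regularity.\<close>

lemma Ulim_rapid:
  assumes rL: "rapid L" and l: "(\<Sum>\<^sub>\<infinity>n. L n) + 1 \<le> l"
  shows "rapid Ulim"
  unfolding rapid_def
proof (intro conjI allI Ulim_nonneg)
  fix k
  define S where "S = (\<Sum>\<^sub>\<infinity>n. (1 + norm (nreal n)) ^ k * L n)"
  have sL: "(\<lambda>n. (1 + norm (nreal n)) ^ k * L n) summable_on UNIV" using rL by (simp add: rapid_def)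
  have S: "0 \<le> S" unfolding S_def using L_nonneg by (intro infsum_nonneg) auto
  \<comment> \<open>Chosen so that d S is at most 1: the weighted data still sum to at most
    \<open>l\<close>, which exceeds the unweighted sum by at least 1.\<close>
  define d where "d = 1 / (1 + S)"
  have d: "0 < d" "d \<le> 1" "d * S \<le> 1" using S by (auto simp: d_def field_simps)
  define w where "w n = (1 + d * norm (nreal n)) ^ k" for n
  have w: "submult_weight w" unfolding w_def using d by (intro submult_weight_poly) simp
  have le: "w n * L n \<le> L n + d * ((1 + norm (nreal n)) ^ k * L n)" for n
    using mult_right_mono[OF power_convex_bound[of d "norm (nreal n)" k] L_nonneg[of n]] d
    by (simp add: w_def algebra_simps)
  have s: "(\<lambda>n. L n + d * ((1 + norm (nreal n)) ^ k * L n)) summable_on UNIV"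
    by (intro summable_on_add summable_on_cmult_right L sL)
  have wL: "(\<lambda>n. w n * L n) summable_on UNIV"
    by (rule summable_on_comparison_test[OF s le])
       (use L_nonneg submult_weightD(2)[OF w] in auto)
  have "(\<Sum>\<^sub>\<infinity>n. w n * L n) \<le> (\<Sum>\<^sub>\<infinity>n. L n + d * ((1 + norm (nreal n)) ^ k * L n))"
    by (rule infsum_mono[OF wL s le])
  also have "\<dots> = (\<Sum>\<^sub>\<infinity>n. L n) + d * S"
    unfolding S_def by (simp add: infsum_add L sL summable_on_cmult_right infsum_cmult_right)
  also have "\<dots> \<le> l" using l d by linarith
  finally have U: "(\<lambda>n. w n * Ulim n) summable_on UNIV" by (rule Ulim_weighted(1)[OF w wL])
  show "(\<lambda>n. (1 + norm (nreal n)) ^ k * Ulim n) summable_on UNIV"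
  proof (rule summable_on_comparison_test[OF summable_on_cmult_right[OF U, of "(1 / d) ^ k"]])
    fix n
    \<comment> \<open>For d at most 1 the flattened weight still dominates the full one, up to the
      constant (1/d)^k.\<close>
    have "1 + norm (nreal n) \<le> 1 / d * (1 + d * norm (nreal n))"
      using d by (simp add: distrib_left)
    then have "(1 + norm (nreal n)) ^ k \<le> (1 / d * (1 + d * norm (nreal n))) ^ k"
      by (intro power_mono) auto
    then have "(1 + norm (nreal n)) ^ k \<le> (1 / d) ^ k * w n"
      unfolding w_def power_mult_distrib .
    from mult_right_mono[OF this Ulim_nonneg[of n]]
    show "(1 + norm (nreal n)) ^ k * Ulim n \<le> (1 / d) ^ k * (w n * Ulim n)"
      by (simp only: mult.assoc)
  qed (simp add: Ulim_nonneg)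
qed

end

section \<open>Kernels governed by linear systems in time\<close>

definition poly_growth :: "(int^3 \<Rightarrow> real) \<Rightarrow> bool" where
  "poly_growth a \<longleftrightarrow> (\<exists>c p. 0 \<le> c \<and> (\<forall>n. \<bar>a n\<bar> \<le> c * (1 + norm (nreal n)) ^ p))"

lemma poly_growthI: "0 \<le> c \<Longrightarrow> (\<And>n. \<bar>a n\<bar> \<le> c * (1 + norm (nreal n)) ^ p) \<Longrightarrow> poly_growth a"
  unfolding poly_growth_def by blast

lemma poly_growth_const: "poly_growth (\<lambda>_. c)"
  by (rule poly_growthI[of "\<bar>c\<bar>" _ 0]) auto

lemma poly_growth_mult:
  assumes "poly_growth a" "poly_growth b"
  shows "poly_growth (\<lambda>n. a n * b n)"
proof -
  obtain c p where a: "0 \<le> c" "\<And>n. \<bar>a n\<bar> \<le> c * (1 + norm (nreal n)) ^ p"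
    using assms(1) unfolding poly_growth_def by blast
  obtain d q where b: "0 \<le> d" "\<And>n. \<bar>b n\<bar> \<le> d * (1 + norm (nreal n)) ^ q"
    using assms(2) unfolding poly_growth_def by blast
  show ?thesis
  proof (rule poly_growthI[of "c * d" _ "p + q"])
    fix n
    have "\<bar>a n * b n\<bar> \<le> (c * (1 + norm (nreal n)) ^ p) * (d * (1 + norm (nreal n)) ^ q)"
      unfolding abs_mult using a b by (intro mult_mono) auto
    then show "\<bar>a n * b n\<bar> \<le> c * d * (1 + norm (nreal n)) ^ (p + q)"
      by (simp add: power_add mult_ac)
  qed (use a b in auto)
qed

lemma poly_growth_add:
  assumes "poly_growth a" "poly_growth b"
  shows "poly_growth (\<lambda>n. a n + b n)"
proof -
  obtain c p where a: "0 \<le> c" "\<And>n. \<bar>a n\<bar> \<le> c * (1 + norm (nreal n)) ^ p"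
    using assms(1) unfolding poly_growth_def by blast
  obtain d q where b: "0 \<le> d" "\<And>n. \<bar>b n\<bar> \<le> d * (1 + norm (nreal n)) ^ q"
    using assms(2) unfolding poly_growth_def by blast
  show ?thesis
  proof (rule poly_growthI[of "c + d" _ "p + q"])
    fix n
    have "c * (1 + norm (nreal n)) ^ p \<le> c * (1 + norm (nreal n)) ^ (p + q)"
      "d * (1 + norm (nreal n)) ^ q \<le> d * (1 + norm (nreal n)) ^ (p + q)"
      using a b by (auto intro!: mult_left_mono power_increasing)
    then show "\<bar>a n + b n\<bar> \<le> (c + d) * (1 + norm (nreal n)) ^ (p + q)"
      using a(2)[of n] b(2)[of n] by (simp add: algebra_simps)
  qed (use a b in auto)
qed

text \<open>Differentiation maps a combination of \<open>\<phi>\<close> and \<open>\<psi>\<close> to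
  another one, with coefficients computed by \<open>step\<close>. All derivatives therefore stay in
  the span of two bounded functions, with coefficients of polynomial growth.\<close>

lemma smooth_kernel_system:
  assumes growth: "poly_growth \<alpha>" "poly_growth \<beta>" "poly_growth \<gamma>" "poly_growth \<delta>"
    and d: "\<And>\<tau> n. ((\<lambda>\<tau>. \<phi> \<tau> n) has_real_derivative (\<alpha> n * \<phi> \<tau> n + \<beta> n * \<psi> \<tau> n)) (at \<tau>)"
      "\<And>\<tau> n. ((\<lambda>\<tau>. \<psi> \<tau> n) has_real_derivative (\<gamma> n * \<phi> \<tau> n + \<delta> n * \<psi> \<tau> n)) (at \<tau>)"
    and bound: "\<And>\<tau> n. \<tau> \<in> {0..T} \<Longrightarrow> \<bar>\<phi> \<tau> n\<bar> \<le> K" "\<And>\<tau> n. \<tau> \<in> {0..T} \<Longrightarrow> \<bar>\<psi> \<tau> n\<bar> \<le> K"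
    and ab: "poly_growth a" "poly_growth b"
  shows "smooth_kernel T (\<lambda>\<tau> n. a n * \<phi> \<tau> n + b n * \<psi> \<tau> n)"
proof -
  define step where "step = (\<lambda>(a, b). (\<lambda>n. a n * \<alpha> n + b n * \<gamma> n, \<lambda>n. a n * \<beta> n + b n * \<delta> n))"
  define A where "A j = (step ^^ j) (a, b)" for j
  have A: "poly_growth (fst (A j)) \<and> poly_growth (snd (A j))" for j
  proof (induction j)
    case 0
    then show ?case using ab by (simp add: A_def)
  next
    case (Suc j)
    then show ?case
      using growth by (simp add: A_def step_def case_prod_beta poly_growth_add poly_growth_mult)
  qed
  define D where "D j \<tau> n = fst (A j) n * \<phi> \<tau> n + snd (A j) n * \<psi> \<tau> n" for j \<tau> n
  have "((\<lambda>\<tau>. D j \<tau> n) has_real_derivative D (Suc j) \<tau> n) (at \<tau>)" for j \<tau> n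
  proof -
    have "((\<lambda>\<tau>. D j \<tau> n) has_real_derivative
        (fst (A j) n * (\<alpha> n * \<phi> \<tau> n + \<beta> n * \<psi> \<tau> n) + snd (A j) n * (\<gamma> n * \<phi> \<tau> n + \<delta> n * \<psi> \<tau> n))) (at \<tau>)"
      unfolding D_def by (intro DERIV_add DERIV_cmult d)
    then show ?thesis by (simp add: D_def A_def step_def case_prod_beta algebra_simps)
  qed
  moreover have "\<exists>c p. 0 \<le> c \<and> (\<forall>\<tau>\<in>{0..T}. \<forall>n. \<bar>D j \<tau> n\<bar> \<le> c * (1 + norm (nreal n)) ^ p)" for j
  proof -
    have "poly_growth (\<lambda>n. (\<bar>fst (A j) n\<bar> + \<bar>snd (A j) n\<bar>) * \<bar>K\<bar>)"
      using A[of j] by (intro poly_growth_mult poly_growth_add poly_growth_const) (simp_all add: poly_growth_def)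
    then obtain c p where c: "0 \<le> c"
      "\<And>n. \<bar>(\<bar>fst (A j) n\<bar> + \<bar>snd (A j) n\<bar>) * \<bar>K\<bar>\<bar> \<le> c * (1 + norm (nreal n)) ^ p"
      unfolding poly_growth_def by blast
    have "\<bar>D j \<tau> n\<bar> \<le> c * (1 + norm (nreal n)) ^ p" if t: "\<tau> \<in> {0..T}" for \<tau> n
    proof -
      have "\<bar>D j \<tau> n\<bar> \<le> \<bar>fst (A j) n\<bar> * \<bar>\<phi> \<tau> n\<bar> + \<bar>snd (A j) n\<bar> * \<bar>\<psi> \<tau> n\<bar>"
        unfolding D_def abs_mult[symmetric] by (rule abs_triangle_ineq)
      also have "\<dots> \<le> \<bar>fst (A j) n\<bar> * \<bar>K\<bar> + \<bar>snd (A j) n\<bar> * \<bar>K\<bar>"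
        using bound[OF t, of n] by (intro add_mono mult_left_mono) auto
      also have "\<dots> = \<bar>(\<bar>fst (A j) n\<bar> + \<bar>snd (A j) n\<bar>) * \<bar>K\<bar>\<bar>" by (simp add: distrib_right)
      finally show ?thesis using c(2)[of n] by linarith
    qed
    then show ?thesis using c(1) by blast
  qed
  moreover have "D 0 = (\<lambda>\<tau> n. a n * \<phi> \<tau> n + b n * \<psi> \<tau> n)"
    by (simp add: D_def A_def fun_eq_iff)
  ultimately show ?thesis unfolding smooth_kernel_def by (intro exI[of _ D]) blast
qed

text \<open>Covers the linear evolution: time derivatives fall on the kernel and the fixed data
  absorb its growth.\<close>

lemma reg_kernel_data:
  assumes "smooth_kernel T \<phi>" "rapid (\<lambda>n. norm (c n))"
  shows "reg T k (\<lambda>t n. \<phi> t n *\<^sub>R c n)"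
  using assms(1)
proof (induction k arbitrary: \<phi>)
  case (0 \<phi>)
  obtain \<phi>' where "smooth_kernel T \<phi>'" and "\<And>n. continuous_on UNIV (\<lambda>\<tau>. \<phi>' \<tau> n)"
    and d: "\<And>n \<tau>. ((\<lambda>\<tau>. \<phi> \<tau> n) has_real_derivative \<phi>' \<tau> n) (at \<tau>)"
    by (fact smooth_kernel_derivative[OF 0])
  obtain K p where K: "0 \<le> K" "\<And>\<tau> n. \<tau> \<in> {0..T} \<Longrightarrow> \<bar>\<phi> \<tau> n\<bar> \<le> K * (1 + norm (nreal n)) ^ p"
    by (fact smooth_kernel_bound[OF 0])
  have "reg0 T (\<lambda>t n. \<phi> t n *\<^sub>R c n)"
  proof (rule reg0I[OF _ rapid_poly[OF assms(2) K(1), of p]])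
    show "continuous_on {0..T} (\<lambda>t. \<phi> t n *\<^sub>R c n)" for n
      by (intro continuous_intros continuous_at_imp_continuous_on ballI DERIV_isCont[OF d])
    show "norm (\<phi> t n *\<^sub>R c n) \<le> K * (1 + norm (nreal n)) ^ p * norm (c n)" if "t \<in> {0..T}" for t n
      unfolding norm_scaleR using K(2)[OF that] by (intro mult_right_mono) auto
  qed
  then show ?case by simp
next
  case (Suc k \<phi>)
  obtain \<phi>' where s: "smooth_kernel T \<phi>'" and "\<And>n. continuous_on UNIV (\<lambda>\<tau>. \<phi>' \<tau> n)"
    and d: "\<And>n \<tau>. ((\<lambda>\<tau>. \<phi> \<tau> n) has_real_derivative \<phi>' \<tau> n) (at \<tau>)"
    by (fact smooth_kernel_derivative[OF Suc.prems])
  show ?case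
  proof (rule reg_SucI[OF reg_imp_reg0[OF Suc.IH[OF Suc.prems]] Suc.IH[OF s]])
    fix t n
    have "((\<lambda>t. \<phi> t n) has_real_derivative \<phi>' t n) (at t within {0..T})"
      by (rule has_field_derivative_at_within[OF d])
    from has_vector_derivative_scaleR[OF this has_vector_derivative_const[of "c n"]]
    show "((\<lambda>t. \<phi> t n *\<^sub>R c n) has_vector_derivative \<phi>' t n *\<^sub>R c n) (at t within {0..T})"
      by simp
  qed
qed

lemma cont_l1_linear:
  fixes z :: "real \<Rightarrow> 'i \<Rightarrow> 'a::banach" and h :: "'a \<Rightarrow> 'b::banach"
  assumes h: "bounded_linear h" "\<And>x. norm (h x) \<le> norm x" and z: "cont_l1 T z"
  shows "cont_l1 T (\<lambda>t n. h (z t n))"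
  unfolding cont_l1_def
proof (intro conjI ballI)
  fix t assume "t \<in> {0..T}"
  then have "l1 (z t)" using z by (simp add: cont_l1_def)
  then show "l1 (\<lambda>n. h (z t n))" by (rule l1norm_leI(1)) (rule h(2))
next
  fix t0 assume t0: "t0 \<in> {0..T}"
  have lim: "((\<lambda>t. l1norm (\<lambda>n. z t n - z t0 n)) \<longlongrightarrow> 0) (at t0 within {0..T})"
    using z t0 by (simp add: cont_l1_def)
  show "((\<lambda>t. l1norm (\<lambda>n. h (z t n) - h (z t0 n))) \<longlongrightarrow> 0) (at t0 within {0..T})"
  proof (rule Lim_null_comparison[OF _ lim])
    show "\<forall>\<^sub>F t in at t0 within {0..T}.
        norm (l1norm (\<lambda>n. h (z t n) - h (z t0 n))) \<le> l1norm (\<lambda>n. z t n - z t0 n)"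
      unfolding eventually_at_filter
    proof (intro always_eventually allI impI)
      fix t assume t: "t \<in> {0..T}"
      have l: "l1 (\<lambda>n. z t n - z t0 n)"
        using z t t0 by (intro abs_summable_diff) (auto simp: cont_l1_def)
      have "l1norm (\<lambda>n. h (z t n) - h (z t0 n)) \<le> (\<Sum>\<^sub>\<infinity>n. norm (z t n - z t0 n))"
        by (rule l1norm_leI(2)[OF l])
           (simp add: linear_diff[OF bounded_linear.linear[OF h(1)], symmetric] h(2))
      then show "norm (l1norm (\<lambda>n. h (z t n) - h (z t0 n))) \<le> l1norm (\<lambda>n. z t n - z t0 n)"
        by (simp add: l1norm_def[of "\<lambda>n. z t n - z t0 n"])
    qed
  qed
qed

lemma cont_l1_Pair:
  fixes y :: "real \<Rightarrow> 'i \<Rightarrow> 'a::banach" and z :: "real \<Rightarrow> 'i \<Rightarrow> 'b::banach"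
  assumes y: "cont_l1 T y" and z: "cont_l1 T z"
  shows "cont_l1 T (\<lambda>t n. (y t n, z t n))"
  unfolding cont_l1_def
proof (intro conjI ballI)
  fix t assume "t \<in> {0..T}"
  then have l: "l1 (y t)" "l1 (z t)" using y z by (simp_all add: cont_l1_def)
  show "l1 (\<lambda>n. (y t n, z t n))"
    by (rule l1norm_leI(1)[OF summable_on_add[OF l] norm_Pair_le])
next
  fix t0 assume t0: "t0 \<in> {0..T}"
  have "((\<lambda>t. l1norm (\<lambda>n. y t n - y t0 n) + l1norm (\<lambda>n. z t n - z t0 n)) \<longlongrightarrow> 0 + 0) (at t0 within {0..T})"
    using y z t0 by (intro tendsto_add) (simp_all add: cont_l1_def)
  then have lim: "((\<lambda>t. l1norm (\<lambda>n. y t n - y t0 n) + l1norm (\<lambda>n. z t n - z t0 n)) \<longlongrightarrow> 0) (at t0 within {0..T})"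
    by simp
  show "((\<lambda>t. l1norm (\<lambda>n. (y t n, z t n) - (y t0 n, z t0 n))) \<longlongrightarrow> 0) (at t0 within {0..T})"
  proof (rule Lim_null_comparison[OF _ lim])
    show "\<forall>\<^sub>F t in at t0 within {0..T}. norm (l1norm (\<lambda>n. (y t n, z t n) - (y t0 n, z t0 n)))
        \<le> l1norm (\<lambda>n. y t n - y t0 n) + l1norm (\<lambda>n. z t n - z t0 n)"
      unfolding eventually_at_filter
    proof (intro always_eventually allI impI)
      fix t assume t: "t \<in> {0..T}"
      have l: "l1 (\<lambda>n. y t n - y t0 n)" "l1 (\<lambda>n. z t n - z t0 n)"
        using y z t t0 by (auto intro!: abs_summable_diff simp: cont_l1_def)
      have "l1norm (\<lambda>n. (y t n - y t0 n, z t n - z t0 n)) \<le> (\<Sum>\<^sub>\<infinity>n. norm (y t n - y t0 n) + norm (z t n - z t0 n))"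
        by (rule l1norm_leI(2)[OF summable_on_add[OF l] norm_Pair_le])
      then show "norm (l1norm (\<lambda>n. (y t n, z t n) - (y t0 n, z t0 n)))
          \<le> l1norm (\<lambda>n. y t n - y t0 n) + l1norm (\<lambda>n. z t n - z t0 n)"
        by (simp add: infsum_add[OF l] l1norm_def[of "\<lambda>n. y t n - y t0 n"] l1norm_def[of "\<lambda>n. z t n - z t0 n"])
    qed
  qed
qed

section \<open>The symbols of the Navier--Stokes--Maxwell system\<close>

lemma complex_scaleR_eq: "r *\<^sub>R (z::complex) = of_real r * z"
  by (rule scaleR_conv_of_real)

lemma cscale_0_right [simp]: "cscale a 0 = 0"
  by (simp add: cscale_def vec_eq_iff)

lemma norm_vec_le_sum: "norm (x :: 'a::real_normed_vector ^ 'n) \<le> (\<Sum>i\<in>UNIV. norm (x $ i))"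
  unfolding norm_vec_def by (rule L2_set_le_sum) simp

lemma norm_component_mult_le: "norm (u $ i * w $ j) \<le> norm u * norm (w :: complex^3)" for u :: "complex^3"
  unfolding norm_mult by (intro mult_mono Finite_Cartesian_Product.norm_nth_le) auto

text \<open>Constants here and in the following symbol bounds are crude; what matters is that they
  do not depend on the frequency.\<close>

lemma norm_cdot_le: "norm (cdot u w) \<le> 3 * (norm u * norm w)"
proof -
  have "norm (cdot u w) \<le> (\<Sum>i\<in>(UNIV::3 set). norm u * norm w)"
    unfolding cdot_def by (intro sum_norm_le norm_component_mult_le)
  then show ?thesis by simp
qed

lemma norm_ccross_le: "norm (ccross u w) \<le> 6 * (norm u * norm w)"
proof -
  have "norm (u $ i * w $ j - u $ k * w $ l) \<le> 2 * (norm u * norm w)" for i j k l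
    using norm_triangle_ineq4[of "u $ i * w $ j" "u $ k * w $ l"]
      norm_component_mult_le[of u i w j] norm_component_mult_le[of u k w l] by linarith
  from this[of 2 3 3 2] this[of 3 1 1 3] this[of 1 2 2 1]
  show ?thesis using norm_vec_le_sum[of "ccross u w"] by (simp add: ccross_def sum_3 vector_3)
qed

lemma bounded_bilinear_ccross: "bounded_bilinear ccross"
proof
  show "\<exists>K. \<forall>a b. norm (ccross a b) \<le> norm a * norm b * K"
    using norm_ccross_le by (intro exI[of _ 6]) (simp add: mult_ac)
qed (simp_all add: ccross_def vec_eq_iff forall_3 vector_3 algebra_simps complex_scaleR_eq)

definition ctensor :: "complex^3 \<Rightarrow> complex^3 \<Rightarrow> (complex^3)^3" where
  "ctensor u w = (\<chi> i. cscale (u $ i) w)"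

lemma bounded_bilinear_ctensor: "bounded_bilinear ctensor"
proof
  have "norm (ctensor a b) = norm a * norm b" for a b
    unfolding norm_vec_def[of "ctensor a b"] norm_vec_def[of a]
    by (simp add: ctensor_def norm_cscale L2_set_left_distrib)
  then show "\<exists>K. \<forall>a b. norm (ctensor a b) \<le> norm a * norm b * K"
    by (intro exI[of _ 1]) simp
qed (simp_all add: ctensor_def cscale_def vec_eq_iff algebra_simps complex_scaleR_eq)

lemma norm_ncplx: "norm (ncplx n) = norm (nreal n)"
  by (simp add: norm_vec_def ncplx_def nreal_def)

lemma nsq_eq: "nsq n = (norm (nreal n))\<^sup>2"
  by (simp add: nsq_def power2_norm_eq_inner)

text \<open>Integrality of the lattice. Staying above 1/4 keeps the wave frequency real and away
  from 0 for n \<noteq> 0.\<close>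

lemma nsq_ge_1:
  assumes "n \<noteq> 0"
  shows "1 \<le> nsq n"
proof -
  have eq: "nsq n = of_int (\<Sum>i\<in>UNIV. n $ i * n $ i)"
    by (simp add: nsq_def nreal_def inner_vec_def)
  obtain i where "n $ i \<noteq> 0" using assms by (auto simp: vec_eq_iff)
  then have "0 < n $ i * n $ i" by (metis not_real_square_gt_zero mult_eq_0_iff zero_less_mult_iff linorder_neqE)
  also have "n $ i * n $ i \<le> (\<Sum>i\<in>UNIV. n $ i * n $ i)" by (intro member_le_sum[of i UNIV "\<lambda>i. n $ i * n $ i"]) auto
  finally have "1 \<le> (\<Sum>i\<in>UNIV. n $ i * n $ i)" by simp
  then show ?thesis unfolding eq by (metis of_int_1_le_iff)
qed

lemma nreal_0 [simp]: "nreal 0 = 0" and ncplx_0 [simp]: "ncplx 0 = 0"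
  by (simp_all add: nreal_def ncplx_def vec_eq_iff)

lemma nsq_0 [simp]: "nsq 0 = 0"
  by (simp add: nsq_def)

lemma norm_gradpart_le: "norm (gradpart n u) \<le> 3 * norm u"
proof (cases "n = 0")
  case True
  then show ?thesis by (simp add: gradpart_def)
next
  case False
  then have pos: "0 < nsq n" using nsq_ge_1[of n] by linarith
  have "norm (gradpart n u) = norm (cdot (ncplx n) u) / nsq n * norm (nreal n)"
    using pos by (simp add: gradpart_def norm_cscale norm_divide norm_ncplx)
  also have "\<dots> \<le> 3 * (norm (nreal n) * norm u) / nsq n * norm (nreal n)"
    using norm_cdot_le[of "ncplx n" u] pos
    by (intro mult_right_mono divide_right_mono) (auto simp: norm_ncplx)
  also have "\<dots> = 3 * norm u" using pos by (auto simp: nsq_eq power2_eq_square)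
  finally show ?thesis .
qed

lemma leray_eq: "leray n u = u - gradpart n u"
  by (simp add: leray_def gradpart_def)

lemma norm_leray_le: "norm (leray n u) \<le> 4 * norm u"
  using norm_triangle_ineq4[of u "gradpart n u"] norm_gradpart_le[of n u] by (simp add: leray_eq)

lemma norm_curl_le: "norm (curl_m n u) \<le> 6 * (norm (nreal n) * norm u)"
  using norm_ccross_le[of "ncplx n" u] by (simp add: curl_m_def norm_cscale norm_ncplx)

lemma bounded_linear_gradpart: "bounded_linear (gradpart n)"
  by (rule bounded_linear_intro[where K=3])
     (use norm_gradpart_le in \<open>simp_all add: gradpart_def cdot_def cscale_def vec_eq_iff sum_3 complex_scaleR_eq
        add_divide_distrib distrib_left distrib_right mult_ac\<close>)

lemma bounded_linear_leray: "bounded_linear (leray n)"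
  using bounded_linear_sub[OF bounded_linear_ident bounded_linear_gradpart[of n]]
  by (simp add: leray_eq[abs_def])

lemma bounded_linear_curl: "bounded_linear (curl_m n)"
  by (rule bounded_linear_intro[where K="6 * norm (nreal n)"])
     (use norm_curl_le[of n] in \<open>simp_all add: curl_m_def ccross_def cscale_def vec_eq_iff forall_3 vector_3
        complex_scaleR_eq algebra_simps\<close>)

text \<open>The divergence of a tensor as a multiplier applied after the convolution; in
  \<open>div_tensor\<close> the frequency stands inside the sum.\<close>

definition tdiv :: "int^3 \<Rightarrow> (complex^3)^3 \<Rightarrow> complex^3" where
  "tdiv n W = cscale \<i> (\<Sum>i\<in>UNIV. cscale (ncplx n $ i) (W $ i))"

lemma norm_tdiv_le: "norm (tdiv n W) \<le> 3 * (norm (nreal n) * norm W)"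
proof -
  have "norm (\<Sum>i\<in>UNIV. cscale (ncplx n $ i) (W $ i)) \<le> (\<Sum>i\<in>(UNIV::3 set). norm (ncplx n) * norm W)"
    by (intro sum_norm_le) (auto simp: norm_cscale intro!: mult_mono Finite_Cartesian_Product.norm_nth_le)
  then show ?thesis by (simp add: tdiv_def norm_cscale norm_ncplx)
qed

lemma bounded_linear_tdiv: "bounded_linear (tdiv n)"
  by (rule bounded_linear_intro[where K="3 * norm (nreal n)"])
     (use norm_tdiv_le[of n] in \<open>simp_all add: tdiv_def cscale_def vec_eq_iff sum_3
        complex_scaleR_eq algebra_simps\<close>)

definition wfreq :: "int^3 \<Rightarrow> real" where
  "wfreq n = sqrt (nsq n - 1/4)"

text \<open>Real form of \<open>Phi1\<close>. At n = 0 the wave frequency is i/2 and the cosine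
  becomes cosh: exp (-t/2) cosh (t/2) = (1 + exp (-t)) / 2. Likewise 2 exp (-t/2) sinh (t/2) = 1 -
  exp (-t) gives the branch of \<open>rPhi2\<close>.\<close>

definition rPhi1 :: "real \<Rightarrow> int^3 \<Rightarrow> real" where
  "rPhi1 t n = (if n = 0 then (1 + exp (- t)) / 2 else exp (- t / 2) * cos (wfreq n * t))"

definition rPhi2 :: "real \<Rightarrow> int^3 \<Rightarrow> real" where
  "rPhi2 t n = (if n = 0 then 1 - exp (- t) else exp (- t / 2) * sin (wfreq n * t) / wfreq n)"

lemma omega_0: "omega 0 = \<i> / 2"
proof -
  have "omega 0 = csqrt (of_real (- (1/4)))" by (simp add: omega_def)
  also have "\<dots> = \<i> * of_real (sqrt \<bar>Re (of_real (- (1/4)))\<bar>)" by (rule csqrt_of_real_nonpos) simp_all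
  also have "sqrt \<bar>Re (of_real (- (1/4)))\<bar> = (1/2::real)" by (rule real_sqrt_unique) (auto simp: power2_eq_square)
  finally show ?thesis by simp
qed

lemma omega_nonzero: "n \<noteq> 0 \<Longrightarrow> omega n = of_real (wfreq n)"
  using nsq_ge_1[of n] by (simp add: omega_def wfreq_def csqrt_of_real_nonneg del: of_real_diff)

lemma Phi_0:
  "Phi1 t 0 = of_real ((1 + exp (- t)) / 2)" "Phi2 t 0 = of_real (1 - exp (- t))"
proof -
  define a :: complex where "a = of_real (exp (t / 2))"
  define b :: complex where "b = of_real (exp (- t / 2))"
  have ab: "b * a = 1" "b * b = of_real (exp (- t))"
    by (simp_all add: a_def b_def flip: of_real_mult exp_add)
  have e1: "exp (\<i> * (omega 0 * of_real t)) = b"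
    unfolding omega_0 b_def by (simp add: exp_of_real[symmetric] mult.assoc[symmetric])
  have e2: "exp (- (\<i> * (omega 0 * of_real t))) = a"
    unfolding omega_0 a_def by (simp add: exp_of_real[symmetric] mult.assoc[symmetric])
  have "Phi1 t 0 = b * ((b + a) / 2)"
    unfolding Phi1_def cos_exp_eq e1 e2 by (simp add: b_def)
  then show "Phi1 t 0 = of_real ((1 + exp (- t)) / 2)"
    by (simp add: distrib_left ab add.commute)
  have "Phi2 t 0 = b * ((b - a) / (2 * \<i>)) / (\<i> / 2)"
    unfolding Phi2_def sin_exp_eq e1 e2 by (simp add: b_def omega_0)
  also have "\<dots> = - (b * b - b * a)" by (simp add: field_simps)
  finally show "Phi2 t 0 = of_real (1 - exp (- t))" by (simp add: ab)
qed

lemma Phi1_real: "Phi1 t n = of_real (rPhi1 t n)"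
proof (cases "n = 0")
  case False
  then show ?thesis by (simp add: Phi1_def rPhi1_def omega_nonzero cos_of_real flip: of_real_mult)
qed (simp add: Phi_0 rPhi1_def)

lemma Phi2_real: "Phi2 t n = of_real (rPhi2 t n)"
proof (cases "n = 0")
  case False
  then show ?thesis by (simp add: Phi2_def rPhi2_def omega_nonzero sin_of_real flip: of_real_mult of_real_divide)
qed (simp add: Phi_0 rPhi2_def)

lemma dPhi2_real: "dPhi2 t n = of_real (rPhi1 t n - rPhi2 t n / 2)"
  by (simp add: dPhi2_def Phi1_real Phi2_real)

text \<open>As |n|^2 is at least 1, |n|^2 - 1/4 is at least |n|^2 / 4. The oscillation frequency
  thus controls |n|, the source of the derivative gained by \<open>rPhi2\<close>.\<close>

lemma wfreq_ge:
  assumes "n \<noteq> 0"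
  shows "norm (nreal n) / 2 \<le> wfreq n" "1/2 \<le> wfreq n" "0 < wfreq n"
proof -
  have 1: "1 \<le> nsq n" by (rule nsq_ge_1[OF assms])
  have sq: "(norm (nreal n) / 2)\<^sup>2 \<le> nsq n - 1/4" "(1/2)\<^sup>2 \<le> nsq n - 1/4"
    using 1 by (simp_all add: power_divide nsq_eq[symmetric])
  show "norm (nreal n) / 2 \<le> wfreq n" unfolding wfreq_def by (rule real_le_rsqrt[OF sq(1)])
  show half: "1/2 \<le> wfreq n" unfolding wfreq_def by (rule real_le_rsqrt[OF sq(2)])
  show "0 < wfreq n" using half by linarith
qed

lemma rPhi1_bound: "0 \<le> t \<Longrightarrow> \<bar>rPhi1 t n\<bar> \<le> 1"
  by (auto simp: rPhi1_def abs_mult intro!: mult_le_one)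

text \<open>Division by the wave frequency compensates one factor |n|; the second bound is what
  offsets a curl.\<close>

lemma rPhi2_bound:
  assumes "0 \<le> t"
  shows "\<bar>rPhi2 t n\<bar> \<le> 2" "norm (nreal n) * \<bar>rPhi2 t n\<bar> \<le> 2"
proof -
  have "\<bar>rPhi2 t n\<bar> \<le> 2 \<and> norm (nreal n) * \<bar>rPhi2 t n\<bar> \<le> 2"
  proof (cases "n = 0")
    case True
    have "\<bar>1 - exp (- t)\<bar> \<le> 1" using assms by simp
    then show ?thesis using True by (simp add: rPhi2_def)
  next
    case False
    note w = wfreq_ge[OF False]
    have "\<bar>exp (- t / 2) * sin (wfreq n * t)\<bar> \<le> 1"
      unfolding abs_mult using assms by (intro mult_le_one) auto
    then have le: "\<bar>rPhi2 t n\<bar> \<le> 1 / wfreq n"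
      using w(3) False by (simp add: rPhi2_def divide_right_mono)
    have "norm (nreal n) * \<bar>rPhi2 t n\<bar> \<le> norm (nreal n) * (1 / wfreq n)"
      using le by (rule mult_left_mono) simp
    also have "\<dots> \<le> 2" using w by (simp add: field_simps)
    finally have 2: "norm (nreal n) * \<bar>rPhi2 t n\<bar> \<le> 2" .
    have "1 / wfreq n \<le> 2" using w by (simp add: field_simps)
    then show ?thesis using le 2 by linarith
  qed
  then show "\<bar>rPhi2 t n\<bar> \<le> 2" "norm (nreal n) * \<bar>rPhi2 t n\<bar> \<le> 2" by auto
qed

text \<open>The damped wave equation as a first-order system with omega^2 = |n|^2 - 1/4, correct at
  n = 0 too, where omega^2 = -1/4. The coefficients are written out to match
  \<open>smooth_kernel_system\<close>.\<close>

lemma rPhi1_deriv: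
  "((\<lambda>t. rPhi1 t n) has_real_derivative (- 1/2 * rPhi1 t n + - (nsq n - 1/4) * rPhi2 t n)) (at t)"
proof (cases "n = 0")
  case True
  then show ?thesis
    unfolding rPhi1_def rPhi2_def by (auto intro!: derivative_eq_intros simp: field_simps)
next
  case False
  have w: "wfreq n * wfreq n = nsq n - 1/4" "wfreq n \<noteq> 0"
    using nsq_ge_1[OF False] wfreq_ge(3)[OF False] by (auto simp: wfreq_def)
  have "- (nsq n - 1/4) * rPhi2 t n = - (exp (- t / 2) * sin (wfreq n * t) * wfreq n)"
    using False w(2) by (simp add: rPhi2_def w(1)[symmetric])
  then show ?thesis
    using False unfolding rPhi1_def by (auto intro!: derivative_eq_intros simp: algebra_simps)
qed

lemma rPhi2_deriv:
  "((\<lambda>t. rPhi2 t n) has_real_derivative (1 * rPhi1 t n + - 1/2 * rPhi2 t n)) (at t)"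
proof (cases "n = 0")
  case True
  then show ?thesis
    unfolding rPhi1_def rPhi2_def by (auto intro!: derivative_eq_intros simp: field_simps)
next
  case False
  then show ?thesis
    using wfreq_ge(3)[OF False] unfolding rPhi1_def rPhi2_def
    by (auto intro!: derivative_eq_intros simp: field_simps)
qed

lemma poly_growth_nsq: "poly_growth nsq"
  by (rule poly_growthI[of 1 _ 2]) (auto simp: nsq_eq intro!: power_mono)

lemma smooth_kernel_exp:
  assumes a: "poly_growth a" "\<And>n. a n \<le> 0"
  shows "smooth_kernel T (\<lambda>\<tau> n. exp (a n * \<tau>))"
proof -
  have "smooth_kernel T (\<lambda>\<tau> n. 1 * exp (a n * \<tau>) + 0 * 0)"
  proof (rule smooth_kernel_system[where \<phi>="\<lambda>\<tau> n. exp (a n * \<tau>)" and \<psi>="\<lambda>_ _. 0" and \<alpha>=a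
        and \<beta>="\<lambda>_. 0" and \<gamma>="\<lambda>_. 0" and \<delta>="\<lambda>_. 0" and a="\<lambda>_. 1" and b="\<lambda>_. 0" and K=1])
    show "((\<lambda>\<tau>. exp (a n * \<tau>)) has_real_derivative a n * exp (a n * \<tau>) + 0 * 0) (at \<tau>)" for \<tau> n
      by (auto intro!: derivative_eq_intros)
    show "\<bar>exp (a n * \<tau>)\<bar> \<le> 1" if "\<tau> \<in> {0..T}" for \<tau> n
      using that a(2) by (simp add: mult_nonpos_nonneg)
  qed (use a(1) in \<open>auto intro: poly_growth_const\<close>)
  then show ?thesis by simp
qed

lemma smooth_kernel_wave:
  assumes "poly_growth a" "poly_growth b"
  shows "smooth_kernel T (\<lambda>\<tau> n. a n * rPhi1 \<tau> n + b n * rPhi2 \<tau> n)"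
proof (rule smooth_kernel_system[OF _ _ _ _ rPhi1_deriv rPhi2_deriv, where K=2])
  have "poly_growth (\<lambda>n. (-1) * nsq n + 1/4)"
    by (intro poly_growth_add poly_growth_mult poly_growth_const poly_growth_nsq)
  then show "poly_growth (\<lambda>n. - (nsq n - 1/4))" by simp
  show "\<bar>rPhi1 \<tau> n\<bar> \<le> 2" "\<bar>rPhi2 \<tau> n\<bar> \<le> 2" if "\<tau> \<in> {0..T}" for \<tau> n
    using that rPhi1_bound[of \<tau> n] rPhi2_bound(1)[of \<tau> n] by auto
qed (auto intro: poly_growth_const assms)

lemma smooth_kernel_wave_consts:
  "smooth_kernel T rPhi1" "smooth_kernel T rPhi2" "smooth_kernel T (\<lambda>\<tau> n. rPhi1 \<tau> n - rPhi2 \<tau> n / 2)"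
  using smooth_kernel_wave[OF poly_growth_const[of 1] poly_growth_const[of 0], of T]
    smooth_kernel_wave[OF poly_growth_const[of 0] poly_growth_const[of 1], of T]
    smooth_kernel_wave[OF poly_growth_const[of 1] poly_growth_const[of "-1/2"], of T]
  by simp_all

section \<open>The coupled system as an abstract Duhamel equation\<close>

type_synonym state = "(complex^3) \<times> (complex^3) \<times> (complex^3)"
text \<open>Slots for the products under the Duhamel integrals: v tensor v, then E x B + (v x B) x
  B, then v x B.\<close>

type_synonym flux = "((complex^3)^3) \<times> (complex^3) \<times> (complex^3)"

definition mhd_quad :: "state \<Rightarrow> state \<Rightarrow> flux" where
  "mhd_quad x y = (ctensor (fst x) (fst y), ccross (snd (snd x)) (fst (snd y)), ccross (fst x) (fst (snd y)))"

text \<open>Used as the first factor of \<open>mhd_outer\<close>, so that the cubic force (v x B) x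
  B arises from two bilinear maps.\<close>

definition mhd_inner :: "state \<Rightarrow> state \<Rightarrow> complex^3" where
  "mhd_inner x y = ccross (fst x) (fst (snd y))"

definition mhd_outer :: "complex^3 \<Rightarrow> state \<Rightarrow> flux" where
  "mhd_outer c y = (0, ccross c (fst (snd y)), 0)"

text \<open>One kernel each for v, for B, and for the divergence-free and the gradient part of E.
  The third is the time derivative of \<open>rPhi2\<close>.\<close>

definition mhd_phi :: "real \<Rightarrow> nat \<Rightarrow> real \<Rightarrow> int^3 \<Rightarrow> real" where
  "mhd_phi \<nu> i = (if i = 0 then (\<lambda>\<tau> n. exp ((- \<nu> * nsq n) * \<tau>)) else if i = 1 then rPhi2
     else if i = 2 then (\<lambda>\<tau> n. rPhi1 \<tau> n - rPhi2 \<tau> n / 2) else (\<lambda>\<tau> n. exp (- 1 * \<tau>)))"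

text \<open>The signs of the Duhamel terms are built in, so that the kernel is a plain sum.\<close>

definition mhd_mult :: "nat \<Rightarrow> int^3 \<Rightarrow> flux \<Rightarrow> state" where
  "mhd_mult i n w = (if i = 0 then (leray n (fst (snd w) - tdiv n (fst w)), 0, 0)
     else if i = 1 then (0, curl_m n (snd (snd w)), 0)
     else if i = 2 then (0, 0, leray n (- snd (snd w)))
     else (0, 0, gradpart n (- snd (snd w))))"

text \<open>No term in v0 x B0 appears: it enters the initial time derivative of E with a minus
  sign, and integration by parts returns it with a plus sign, both times under
  \<open>Phi2\<close>.\<close>

definition mhd_lin :: "real \<Rightarrow> coeffs \<Rightarrow> coeffs \<Rightarrow> coeffs \<Rightarrow> real \<Rightarrow> int^3 \<Rightarrow> state" where
  "mhd_lin \<nu> v0 B0 E0 t n =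
     exp ((- \<nu> * nsq n) * t) *\<^sub>R (v0 n, 0, 0)
   + rPhi1 t n *\<^sub>R (0, B0 n, leray n (E0 n))
   + rPhi2 t n *\<^sub>R (0, (1/2) *\<^sub>R B0 n - curl_m n (E0 n),
       (1/2) *\<^sub>R leray n (E0 n) + leray n (curl_m n (B0 n) - E0 n))
   + exp (- 1 * t) *\<^sub>R (0, 0, gradpart n (E0 n))"

text \<open>The bounds for the four summands of \<open>mhd_lin\<close> add up to 1 + 5 + 62 + 3 =
  71; the factor 100 leaves room.\<close>

definition mhd_data :: "coeffs \<Rightarrow> coeffs \<Rightarrow> coeffs \<Rightarrow> int^3 \<Rightarrow> real" where
  "mhd_data v0 B0 E0 n = 100 * (norm (v0 n) + norm (B0 n) + norm (E0 n))"

lemma bounded_bilinear_Pair: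
  assumes "bounded_bilinear f" "bounded_bilinear g"
  shows "bounded_bilinear (\<lambda>x y. (f x y, g x y))"
proof -
  interpret f: bounded_bilinear f by fact
  interpret g: bounded_bilinear g by fact
  obtain K where K: "\<And>a b. norm (f a b) \<le> norm a * norm b * K" using f.bounded by blast
  obtain L where L: "\<And>a b. norm (g a b) \<le> norm a * norm b * L" using g.bounded by blast
  show ?thesis
  proof
    have "norm (f a b, g a b) \<le> norm a * norm b * (K + L)" for a b
      using norm_Pair_le[of "f a b" "g a b"] K[of a b] L[of a b] by (simp add: distrib_left)
    then show "\<exists>K. \<forall>a b. norm (f a b, g a b) \<le> norm a * norm b * K" by blast
  qed (simp_all add: f.add_left f.add_right g.add_left g.add_right f.scaleR_left f.scaleR_right
      g.scaleR_left g.scaleR_right)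
qed

lemma bounded_bilinear_zero: "bounded_bilinear (\<lambda>x y. 0)"
  by standard (auto intro: exI[of _ 0])

lemma bounded_linear_fst_snd: "bounded_linear (\<lambda>x. fst (snd x))" and bounded_linear_snd_snd: "bounded_linear (\<lambda>x. snd (snd x))"
  by (auto intro: bounded_linear_compose[OF bounded_linear_fst bounded_linear_snd]
      bounded_linear_compose[OF bounded_linear_snd bounded_linear_snd])

lemma bounded_bilinear_mhd:
  "bounded_bilinear mhd_quad" "bounded_bilinear mhd_inner" "bounded_bilinear mhd_outer"
  unfolding mhd_quad_def[abs_def] mhd_inner_def[abs_def] mhd_outer_def[abs_def]
  by (intro bounded_bilinear_Pair bounded_bilinear_zero
      bounded_bilinear.comp[OF bounded_bilinear_ctensor] bounded_bilinear.comp[OF bounded_bilinear_ccross]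
      bounded_linear_fst bounded_linear_fst_snd bounded_linear_snd_snd
      bounded_bilinear.comp[OF bounded_bilinear_ccross bounded_linear_ident])+

lemma bounded_linear_mhd_mult: "bounded_linear (mhd_mult i n)"
proof -
  have 0: "bounded_linear (\<lambda>w :: flux. (leray n (fst (snd w) - tdiv n (fst w)), 0 :: complex^3, 0 :: complex^3))"
    by (intro bounded_linear_Pair bounded_linear_zero bounded_linear_compose[OF bounded_linear_leray]
        bounded_linear_sub bounded_linear_compose[OF bounded_linear_tdiv] bounded_linear_fst bounded_linear_fst_snd)
  have 1: "bounded_linear (\<lambda>w :: flux. (0 :: complex^3, curl_m n (snd (snd w)), 0 :: complex^3))"
    by (intro bounded_linear_Pair bounded_linear_zero bounded_linear_compose[OF bounded_linear_curl] bounded_linear_snd_snd)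
  have 2: "bounded_linear (\<lambda>w :: flux. (0 :: complex^3, 0 :: complex^3, leray n (- snd (snd w))))"
    by (intro bounded_linear_Pair bounded_linear_zero bounded_linear_compose[OF bounded_linear_leray]
        bounded_linear_minus bounded_linear_snd_snd)
  have 3: "bounded_linear (\<lambda>w :: flux. (0 :: complex^3, 0 :: complex^3, gradpart n (- snd (snd w))))"
    by (intro bounded_linear_Pair bounded_linear_zero bounded_linear_compose[OF bounded_linear_gradpart]
        bounded_linear_minus bounded_linear_snd_snd)
  show ?thesis
    unfolding mhd_mult_def[abs_def] using 0 1 2 3 by (cases "i = 0"; cases "i = 1"; cases "i = 2"; simp)
qed

lemma norm_flux:
  "norm (fst w) \<le> norm w" "norm (fst (snd w)) \<le> norm w" "norm (snd (snd w)) \<le> norm (w :: flux)"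
  using norm_fst_le[of "fst w" "snd w"] norm_snd_le[of "snd w" "fst w"]
    norm_fst_le[of "fst (snd w)" "snd (snd w)"] norm_snd_le[of "snd (snd w)" "fst (snd w)"]
  by auto

lemma norm_Pair3: "norm (x, 0, 0) = norm x" "norm (0, x, 0) = norm x" "norm (0, 0, x) = norm x"
  by (simp_all add: norm_Pair)

lemma norm_mhd_mult:
  "norm (mhd_mult 0 n w) \<le> 12 * (1 + norm (nreal n)) * norm w"
  "norm (mhd_mult 1 n w) \<le> 6 * norm (nreal n) * norm w"
  "norm (mhd_mult 2 n w) \<le> 4 * norm w"
  "norm (mhd_mult 3 n w) \<le> 3 * norm w"
proof -
  have "norm (fst (snd w) - tdiv n (fst w)) \<le> norm w + 3 * (norm (nreal n) * norm w)"
    using norm_triangle_ineq4[of "fst (snd w)" "tdiv n (fst w)"] norm_flux[of w] norm_tdiv_le[of n "fst w"]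
      mult_left_mono[OF norm_flux(1)[of w], of "norm (nreal n)"] by simp
  then have "4 * norm (fst (snd w) - tdiv n (fst w)) \<le> 4 * (norm w + 3 * (norm (nreal n) * norm w))"
    by (rule mult_left_mono) simp
  then have "norm (leray n (fst (snd w) - tdiv n (fst w))) \<le> 4 * (norm w + 3 * (norm (nreal n) * norm w))"
    by (rule order_trans[OF norm_leray_le])
  also have "\<dots> \<le> 12 * (1 + norm (nreal n)) * norm w" by (simp add: algebra_simps)
  finally show "norm (mhd_mult 0 n w) \<le> 12 * (1 + norm (nreal n)) * norm w"
    by (simp add: mhd_mult_def norm_Pair3)
  show "norm (mhd_mult 1 n w) \<le> 6 * norm (nreal n) * norm w"
    using norm_curl_le[of n "snd (snd w)"] mult_left_mono[OF norm_flux(3)[of w], of "norm (nreal n)"]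
    by (simp add: mhd_mult_def norm_Pair3)
  show "norm (mhd_mult 2 n w) \<le> 4 * norm w"
    using norm_leray_le[of n "- snd (snd w)"] norm_flux(3)[of w] by (simp add: mhd_mult_def norm_Pair3)
  show "norm (mhd_mult 3 n w) \<le> 3 * norm w"
    using norm_gradpart_le[of n "- snd (snd w)"] norm_flux(3)[of w] by (simp add: mhd_mult_def norm_Pair3)
qed

lemma sum_lessThan_4: "(\<Sum>i<4. f i) = f 0 + f 1 + f 2 + f (3::nat)"
  by (simp add: eval_nat_numeral)

text \<open>Only the heat part keeps a factor |n|, and always together with the exponential; in the
  curl part |n| \<open>rPhi2\<close> is at most 2 in absolute value. The constants 12, 12, 8 and 3
  add up to 35, below 50.\<close>

lemma mhd_kernel_bound:
  assumes "0 < \<nu>" "0 \<le> \<tau>"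
  shows "norm (\<Sum>i<4. mhd_phi \<nu> i \<tau> n *\<^sub>R mhd_mult i n w)
    \<le> 50 * (1 + norm (nreal n) * exp (- \<nu> * \<tau> * (norm (nreal n))\<^sup>2)) * norm w"
proof -
  define x where "x = norm (nreal n)"
  define e where "e = exp (- \<nu> * \<tau> * x\<^sup>2)"
  have e: "0 \<le> e" "e \<le> 1" and x: "0 \<le> x" using assms by (auto simp: e_def x_def)
  have phi: "mhd_phi \<nu> 0 \<tau> n = e" "mhd_phi \<nu> 1 \<tau> n = rPhi2 \<tau> n"
      "mhd_phi \<nu> 2 \<tau> n = rPhi1 \<tau> n - rPhi2 \<tau> n / 2" "mhd_phi \<nu> 3 \<tau> n = exp (- 1 * \<tau>)"
    by (simp_all add: mhd_phi_def e_def x_def nsq_eq mult_ac)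
  have 0: "norm (e *\<^sub>R mhd_mult 0 n w) \<le> 12 * (1 + x * e) * norm w"
  proof -
    have "norm (e *\<^sub>R mhd_mult 0 n w) \<le> e * (12 * (1 + x) * norm w)"
      using norm_mhd_mult(1)[of n w] e by (simp add: x_def mult_left_mono)
    also have "\<dots> = 12 * (e + x * e) * norm w" by (simp add: algebra_simps)
    also have "\<dots> \<le> 12 * (1 + x * e) * norm w" using e by (intro mult_right_mono mult_left_mono) auto
    finally show ?thesis .
  qed
  have 1: "norm (rPhi2 \<tau> n *\<^sub>R mhd_mult 1 n w) \<le> 12 * norm w"
  proof -
    have "norm (rPhi2 \<tau> n *\<^sub>R mhd_mult 1 n w) \<le> \<bar>rPhi2 \<tau> n\<bar> * (6 * x * norm w)"
      unfolding norm_scaleR x_def using norm_mhd_mult(2)[of n w] by (intro mult_left_mono) auto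
    also have "\<dots> = 6 * (x * \<bar>rPhi2 \<tau> n\<bar>) * norm w" by simp
    also have "\<dots> \<le> 6 * 2 * norm w"
      using rPhi2_bound(2)[OF assms(2), of n] by (intro mult_right_mono mult_left_mono) (auto simp: x_def)
    finally show ?thesis by simp
  qed
  have 2: "norm ((rPhi1 \<tau> n - rPhi2 \<tau> n / 2) *\<^sub>R mhd_mult 2 n w) \<le> 8 * norm w"
  proof -
    have "\<bar>rPhi1 \<tau> n - rPhi2 \<tau> n / 2\<bar> \<le> 2"
      using rPhi1_bound[OF assms(2), of n] rPhi2_bound(1)[OF assms(2), of n] by linarith
    then have "\<bar>rPhi1 \<tau> n - rPhi2 \<tau> n / 2\<bar> * norm (mhd_mult 2 n w) \<le> 2 * (4 * norm w)"
      using norm_mhd_mult(3)[of n w] by (intro mult_mono) auto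
    then show ?thesis by simp
  qed
  have 3: "norm (exp (- 1 * \<tau>) *\<^sub>R mhd_mult 3 n w) \<le> 3 * norm w"
  proof -
    have "exp (- 1 * \<tau>) * norm (mhd_mult 3 n w) \<le> 1 * (3 * norm w)"
      using norm_mhd_mult(4)[of n w] assms by (intro mult_mono) auto
    then show ?thesis by simp
  qed
  have "norm (\<Sum>i<4. mhd_phi \<nu> i \<tau> n *\<^sub>R mhd_mult i n w)
      \<le> 12 * (1 + x * e) * norm w + 12 * norm w + 8 * norm w + 3 * norm w"
    unfolding sum_lessThan_4 phi by (intro norm_triangle_mono 0 1 2 3)
  also have "\<dots> \<le> 50 * (1 + x * e) * norm w"
  proof -
    have "0 \<le> x * e * norm w" using e x by simp
    then show ?thesis by (simp add: algebra_simps)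
  qed
  finally show ?thesis by (simp add: e_def x_def)
qed

lemma mhd_phi_smooth:
  assumes "0 < \<nu>"
  shows "smooth_kernel T (mhd_phi \<nu> i)"
proof -
  have "poly_growth (\<lambda>n. - \<nu> * nsq n)" by (intro poly_growth_mult poly_growth_const poly_growth_nsq)
  then have "smooth_kernel T (\<lambda>\<tau> n. exp ((- \<nu> * nsq n) * \<tau>))"
    using assms by (intro smooth_kernel_exp) (auto simp: nsq_eq)
  moreover have "smooth_kernel T (\<lambda>\<tau> n. exp (- 1 * \<tau>))"
    by (rule smooth_kernel_exp[OF poly_growth_const]) simp
  ultimately show ?thesis
    by (simp add: mhd_phi_def smooth_kernel_wave_consts del: mult_minus1)
qed

lemma mhd_data_coeff_bounds:
  fixes v0 B0 E0 :: coeffs and n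
  defines "S \<equiv> norm (v0 n) + norm (B0 n) + norm (E0 n)" and "x \<equiv> norm (nreal n)"
  shows "norm (v0 n, 0::complex^3, 0::complex^3) \<le> S"
    "norm (0::complex^3, B0 n, leray n (E0 n)) \<le> 5 * S"
    "norm (0::complex^3, (1/2) *\<^sub>R B0 n - curl_m n (E0 n),
       (1/2) *\<^sub>R leray n (E0 n) + leray n (curl_m n (B0 n) - E0 n)) \<le> 7 * S + 24 * (x * S)"
    "norm (0::complex^3, 0::complex^3, gradpart n (E0 n)) \<le> 3 * S"
proof -
  have S: "norm (v0 n) \<le> S" "norm (B0 n) \<le> S" "norm (E0 n) \<le> S" and x: "0 \<le> x"
    by (auto simp: S_def x_def)
  have p3: "norm (0::complex^3, y, z) \<le> norm y + norm z" for y z :: "complex^3"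
    using norm_Pair_le[of "0::complex^3" "(y, z)"] norm_Pair_le[of y z] by simp
  show "norm (v0 n, 0::complex^3, 0::complex^3) \<le> S" using S by (simp add: norm_Pair3)
  show "norm (0::complex^3, B0 n, leray n (E0 n)) \<le> 5 * S"
    using p3[of "B0 n" "leray n (E0 n)"] norm_leray_le[of n "E0 n"] S by linarith
  show "norm (0::complex^3, 0::complex^3, gradpart n (E0 n)) \<le> 3 * S"
    using norm_gradpart_le[of n "E0 n"] S by (simp add: norm_Pair3)
  have 1: "norm ((1/2) *\<^sub>R B0 n - curl_m n (E0 n)) \<le> norm (B0 n) / 2 + 6 * (x * norm (E0 n))"
    using norm_triangle_ineq4[of "(1/2) *\<^sub>R B0 n" "curl_m n (E0 n)"] norm_curl_le[of n "E0 n"]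
    by (simp add: x_def)
  have "norm (curl_m n (B0 n) - E0 n) \<le> 6 * (x * norm (B0 n)) + norm (E0 n)"
    using norm_triangle_ineq4[of "curl_m n (B0 n)" "E0 n"] norm_curl_le[of n "B0 n"] by (simp add: x_def)
  then have "norm (leray n (curl_m n (B0 n) - E0 n)) \<le> 24 * (x * norm (B0 n)) + 4 * norm (E0 n)"
    using norm_leray_le[of n "curl_m n (B0 n) - E0 n"] by linarith
  then have 2: "norm ((1/2) *\<^sub>R leray n (E0 n) + leray n (curl_m n (B0 n) - E0 n))
      \<le> 2 * norm (E0 n) + (24 * (x * norm (B0 n)) + 4 * norm (E0 n))"
    using norm_leray_le[of n "E0 n"] by (intro norm_triangle_mono) simp_all
  have xS: "x * S = x * norm (v0 n) + x * norm (B0 n) + x * norm (E0 n)"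
    by (simp add: S_def distrib_left)
  have "0 \<le> x * norm (v0 n)" "0 \<le> x * norm (B0 n)" "0 \<le> x * norm (E0 n)" using x by auto
  then show "norm (0::complex^3, (1/2) *\<^sub>R B0 n - curl_m n (E0 n),
       (1/2) *\<^sub>R leray n (E0 n) + leray n (curl_m n (B0 n) - E0 n)) \<le> 7 * S + 24 * (x * S)"
  proof -
    have "norm (B0 n) / 2 + 6 * (x * norm (E0 n)) + (2 * norm (E0 n) + (24 * (x * norm (B0 n)) + 4 * norm (E0 n)))
        \<le> 7 * S + 24 * (x * S)"
      using \<open>0 \<le> x * norm (v0 n)\<close> \<open>0 \<le> x * norm (B0 n)\<close> \<open>0 \<le> x * norm (E0 n)\<close>
      unfolding xS S_def using norm_ge_zero[of "v0 n"] norm_ge_zero[of "B0 n"] norm_ge_zero[of "E0 n"]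
      by argo
    then show ?thesis using order_trans[OF p3 add_mono[OF 1 2]] by (rule order_trans[rotated])
  qed
qed

lemma mhd_lin_bound:
  assumes "0 < \<nu>" "0 \<le> t"
  shows "norm (mhd_lin \<nu> v0 B0 E0 t n) \<le> mhd_data v0 B0 E0 n"
proof -
  define S where "S = norm (v0 n) + norm (B0 n) + norm (E0 n)"
  define x where "x = norm (nreal n)"
  have S: "0 \<le> S" by (simp add: S_def)
  note b = mhd_data_coeff_bounds[where ?v0.0=v0 and ?B0.0=B0 and ?E0.0=E0 and n=n, folded S_def x_def]
  have "norm (exp ((- \<nu> * nsq n) * t) *\<^sub>R (v0 n, 0::complex^3, 0::complex^3)) \<le> 1 * S"
    unfolding norm_scaleR using b(1) assms by (intro mult_mono) (auto simp: nsq_eq)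
  moreover have "norm (rPhi1 t n *\<^sub>R (0::complex^3, B0 n, leray n (E0 n))) \<le> 1 * (5 * S)"
    unfolding norm_scaleR using b(2) rPhi1_bound[OF assms(2)] by (intro mult_mono) auto
  \<comment> \<open>Here 62 = 2 (7 + 24): terms free of |n| use the plain bound 2 for
    \<open>rPhi2\<close>, and the curls of the data use its bound with the extra factor |n|.\<close>
  moreover have "norm (rPhi2 t n *\<^sub>R (0::complex^3, (1/2) *\<^sub>R B0 n - curl_m n (E0 n),
       (1/2) *\<^sub>R leray n (E0 n) + leray n (curl_m n (B0 n) - E0 n))) \<le> 62 * S"
  proof -
    have "norm (rPhi2 t n *\<^sub>R (0::complex^3, (1/2) *\<^sub>R B0 n - curl_m n (E0 n),
       (1/2) *\<^sub>R leray n (E0 n) + leray n (curl_m n (B0 n) - E0 n))) \<le> \<bar>rPhi2 t n\<bar> * (7 * S + 24 * (x * S))"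
      unfolding norm_scaleR using b(3) by (intro mult_left_mono) auto
    also have "\<dots> = \<bar>rPhi2 t n\<bar> * (7 * S) + (x * \<bar>rPhi2 t n\<bar>) * (24 * S)" by (simp add: algebra_simps)
    also have "\<dots> \<le> 2 * (7 * S) + 2 * (24 * S)"
      using rPhi2_bound[OF assms(2), of n] S by (intro add_mono mult_right_mono) (auto simp: x_def)
    finally show ?thesis by simp
  qed
  moreover have "norm (exp (- 1 * t) *\<^sub>R (0::complex^3, 0::complex^3, gradpart n (E0 n))) \<le> 1 * (3 * S)"
    unfolding norm_scaleR using b(4) assms by (intro mult_mono) auto
  ultimately have "norm (mhd_lin \<nu> v0 B0 E0 t n) \<le> 1 * S + 1 * (5 * S) + 62 * S + 1 * (3 * S)"
    unfolding mhd_lin_def by (intro norm_triangle_mono)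
  then show ?thesis using S unfolding mhd_data_def S_def[symmetric] by linarith
qed

lemma mhd_duhamel:
  assumes nu: "0 < \<nu>" and l1: "l1 v0" "l1 B0" "l1 E0"
    and Q: "bilinear_with mhd_quad Q" "bilinear_with mhd_inner Q" "bilinear_with mhd_outer Q"
  shows "duhamel \<nu> 50 Q {..<4} (mhd_phi \<nu>) mhd_mult mhd_quad mhd_inner mhd_outer
    (mhd_lin \<nu> v0 B0 E0) (mhd_data v0 B0 E0)"
proof (rule duhamel.intro)
  fix i n
  obtain \<phi>' where "smooth_kernel 0 \<phi>'" and c: "\<And>n. continuous_on UNIV (\<lambda>\<tau>. \<phi>' \<tau> n)"
    and d: "\<And>n \<tau>. ((\<lambda>\<tau>. mhd_phi \<nu> i \<tau> n) has_real_derivative \<phi>' \<tau> n) (at \<tau>)"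
    by (fact smooth_kernel_derivative[OF mhd_phi_smooth[OF nu, of 0 i]])
  show "\<exists>f'. continuous_on UNIV f' \<and> (\<forall>\<tau>. ((\<lambda>\<tau>. mhd_phi \<nu> i \<tau> n) has_real_derivative f' \<tau>) (at \<tau>))"
    by (intro exI[of _ "\<lambda>\<tau>. \<phi>' \<tau> n"] conjI c allI d)
next
  fix n
  show "continuous_on {0..} (\<lambda>t. mhd_lin \<nu> v0 B0 E0 t n)"
    unfolding mhd_lin_def
    by (intro continuous_intros continuous_at_imp_continuous_on ballI DERIV_isCont[OF rPhi1_deriv]
        DERIV_isCont[OF rPhi2_deriv])
next
  show "mhd_data v0 B0 E0 summable_on UNIV"
    unfolding mhd_data_def[abs_def] by (intro summable_on_cmult_right summable_on_add l1)
next
  fix \<tau> :: real and n w assume "0 \<le> \<tau>"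
  then show "norm (\<Sum>i<4. mhd_phi \<nu> i \<tau> n *\<^sub>R mhd_mult i n w)
      \<le> 50 * (1 + norm (nreal n) * exp (- \<nu> * \<tau> * (norm (nreal n))\<^sup>2)) * norm w"
    by (rule mhd_kernel_bound[OF nu])
qed (simp_all add: nu Q mhd_lin_bound[OF nu] bounded_linear_mhd_mult)

lemma mhd_constant:
  obtains Q where "bilinear_with mhd_quad Q" "bilinear_with mhd_inner Q" "bilinear_with mhd_outer Q"
proof -
  obtain a where a: "bilinear_with mhd_quad a" by (rule bounded_bilinear_bilinear_with[OF bounded_bilinear_mhd(1)])
  obtain b where b: "bilinear_with mhd_inner b" by (rule bounded_bilinear_bilinear_with[OF bounded_bilinear_mhd(2)])
  obtain c where c: "bilinear_with mhd_outer c" by (rule bounded_bilinear_bilinear_with[OF bounded_bilinear_mhd(3)])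
  show ?thesis
    by (rule that[of "max a (max b c)"]; rule bilinear_with_mono, (rule a b c), simp)
qed

lemma cscale_of_real: "cscale (of_real r) u = r *\<^sub>R u"
  by (simp add: cscale_def vec_eq_iff complex_scaleR_eq)

lemma cscale_half: "cscale (1/2) u = (1/2) *\<^sub>R u"
  using cscale_of_real[of "1/2" u] by simp

lemma bounded_linear_cscale: "bounded_linear (cscale a)"
  by (rule bounded_linear_intro[where K="norm a"])
     (simp_all add: norm_cscale, simp_all add: cscale_def vec_eq_iff complex_scaleR_eq algebra_simps)

text \<open>Multiplication by -i strips the outer factor of \<open>tdiv\<close>, so that moving the
  multiplier into the sum gives literally the series inside \<open>div_tensor\<close>.\<close>

lemma tdiv_convolve:
  assumes "l1 v"
  shows "tdiv n (convolve ctensor v v n) = div_tensor v n"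
proof -
  obtain Q where Q: "bilinear_with ctensor Q"
    by (rule bounded_bilinear_bilinear_with[OF bounded_bilinear_ctensor])
  have inv: "cscale \<i> (cscale (- \<i>) u) = u" "cscale (- \<i>) (cscale \<i> u) = u" for u
    by (simp_all add: cscale_def vec_eq_iff)
  have t: "cscale (- \<i>) (tdiv n (ctensor u w)) = cscale (cdot (ncplx n) u) w" for u w
    unfolding tdiv_def inv
    by (simp add: ctensor_def cdot_def cscale_def vec_eq_iff sum_distrib_left sum_distrib_right mult_ac)
  have "cscale (- \<i>) (tdiv n (convolve ctensor v v n))
      = convolve (\<lambda>u w. cscale (- \<i>) (tdiv n (ctensor u w))) v v n"
    by (rule convolve_linear[OF Q bounded_linear_compose[OF bounded_linear_cscale bounded_linear_tdiv] assms assms])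
  also have "\<dots> = (\<Sum>\<^sub>\<infinity>m. cscale (cdot (ncplx n) (v m)) (v (n - m)))"
    unfolding t convolve_def ..
  finally have "cscale \<i> (cscale (- \<i>) (tdiv n (convolve ctensor v v n))) = div_tensor v n"
    by (simp add: div_tensor_def)
  then show ?thesis by (simp add: inv)
qed

lemma cross_f_convolve: "cross_f f g = convolve ccross f g"
  by (simp add: fun_eq_iff cross_f_def conv_def convolve_def)

text \<open>Each part of the kernel takes values in one component of the state, so its integral can
  be computed in that component.\<close>

lemma integral_inject:
  assumes J: "bounded_linear J" and "continuous_on {0..t} f" "continuous_on {0..t} (x :: real \<Rightarrow> 'a::banach)"
  shows "integral {0..t} (\<lambda>s. f s *\<^sub>R J (x s)) = J (integral {0..t} (\<lambda>s. f s *\<^sub>R x s))"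
proof -
  have "integral {0..t} (J \<circ> (\<lambda>s. f s *\<^sub>R x s)) = J (integral {0..t} (\<lambda>s. f s *\<^sub>R x s))"
    by (intro integral_linear J integrable_continuous_interval continuous_intros assms)
  then show ?thesis by (simp add: o_def linear_scale[OF bounded_linear.linear[OF J]])
qed

lemma cont_X0_iff: "cont_X0 T u \<longleftrightarrow> cont_l1 T u \<and> (\<forall>t\<in>{0..T}. real_field (u t))"
  unfolding cont_X0_def cont_l1_def X0_def X0norm_def l1norm_def by auto

locale mhd =
  fixes \<nu> Q :: real and v0 B0 E0 :: coeffs
  assumes nu: "0 < \<nu>" and l1: "l1 v0" "l1 B0" "l1 E0"
    and bil: "bilinear_with mhd_quad Q" "bilinear_with mhd_inner Q" "bilinear_with mhd_outer Q"
begin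

sublocale duhamel \<nu> 50 Q "{..<4::nat}" "mhd_phi \<nu>" mhd_mult mhd_quad mhd_inner mhd_outer
    "mhd_lin \<nu> v0 B0 E0" "mhd_data v0 B0 E0"
  by (rule mhd_duhamel[OF nu l1 bil])

text \<open>Projections to the slots of the flux are bounded linear, hence pass through the
  convolution sums.\<close>

lemma nonlin_components:
  assumes v: "l1 v" and B: "l1 B" and E: "l1 E"
  shows "tdiv n (fst (nonlin (\<lambda>n. (v n, B n, E n)) n)) = div_tensor v n"
    "fst (snd (nonlin (\<lambda>n. (v n, B n, E n)) n)) = cross_f E B n + cross_f (cross_f v B) B n"
    "snd (snd (nonlin (\<lambda>n. (v n, B n, E n)) n)) = cross_f v B n"
proof -
  let ?z = "\<lambda>n. (v n, B n, E n)"
  have z: "l1 ?z"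
  proof (rule l1norm_leI(1)[OF summable_on_add[OF summable_on_add[OF v B] E]])
    show "norm (?z n) \<le> norm (v n) + norm (B n) + norm (E n)" for n
      using norm_Pair_le[of "v n" "(B n, E n)"] norm_Pair_le[of "B n" "E n"] by simp
  qed
  have inner: "convolve mhd_inner ?z ?z = cross_f v B"
    by (simp add: fun_eq_iff cross_f_convolve convolve_def mhd_inner_def)
  have c: "l1 (cross_f v B)" using convolve_l1(1)[OF bil(2) z z] by (simp add: inner)
  have h: "h (nonlin ?z n) = convolve (\<lambda>x y. h (mhd_quad x y)) ?z ?z n
      + convolve (\<lambda>x y. h (mhd_outer x y)) (cross_f v B) ?z n" if "bounded_linear h" for h :: "flux \<Rightarrow> 'd::banach"
    unfolding nonlin_def inner linear_add[OF bounded_linear.linear[OF that]]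
      convolve_linear[OF bil(1) that z z] convolve_linear[OF bil(3) that c z] ..
  have "fst (nonlin ?z n) = convolve ctensor v v n"
    unfolding h[OF bounded_linear_fst] by (simp add: convolve_def mhd_quad_def mhd_outer_def)
  then show "tdiv n (fst (nonlin ?z n)) = div_tensor v n" by (simp add: tdiv_convolve[OF v])
  show "fst (snd (nonlin ?z n)) = cross_f E B n + cross_f (cross_f v B) B n"
    unfolding h[OF bounded_linear_fst_snd]
    by (simp add: convolve_def mhd_quad_def mhd_outer_def cross_f_convolve)
  show "snd (snd (nonlin ?z n)) = cross_f v B n"
    unfolding h[OF bounded_linear_snd_snd]
    by (simp add: convolve_def mhd_quad_def mhd_outer_def cross_f_convolve)
qed

text \<open>Continuity in l1 makes all integrands continuous, so the vector-valued integral may be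
  split into kernels and components; after that the two formulations agree at each time and
  frequency.\<close>

lemma mild_solution_iff:
  assumes v: "cont_l1 T v" and B: "cont_l1 T B" and E: "cont_l1 T E"
  shows "mild_solution \<nu> T v0 B0 E0 v B E \<longleftrightarrow> solution T (\<lambda>t n. (v t n, B t n, E t n))"
proof -
  let ?z = "\<lambda>t n. (v t n, B t n, E t n)"
  have z: "cont_l1 T ?z" by (intro cont_l1_Pair v B E)
  have "(v t n = cscale (heat \<nu> t n) (v0 n)
          - integral {0..t} (\<lambda>s. cscale (heat \<nu> (t - s) n)
               (leray n (div_tensor (v s) n - cross_f (E s) (B s) n
                          - cross_f (cross_f (v s) (B s)) (B s) n)))
      \<and> B t n = cscale (Phi1 t n) (B0 n)
          + cscale (Phi2 t n) (cscale (1/2) (B0 n) - curl_m n (E0 n))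
          + integral {0..t} (\<lambda>s. cscale (Phi2 (t - s) n) (curl_m n (cross_f (v s) (B s) n)))
      \<and> E t n =
          (cscale (Phi1 t n) (leray n (E0 n))
           + cscale (Phi2 t n) (cscale (1/2) (leray n (E0 n))
               + leray n (curl_m n (B0 n) - E0 n - cross_f v0 B0 n))
           + cscale (Phi2 t n) (leray n (cross_f v0 B0 n))
           - integral {0..t} (\<lambda>s. cscale (dPhi2 (t - s) n) (leray n (cross_f (v s) (B s) n))))
        + (cscale (of_real (exp (-t))) (gradpart n (E0 n))
           - integral {0..t} (\<lambda>s. cscale (of_real (exp (-(t - s)))) (gradpart n (cross_f (v s) (B s) n)))))
    \<longleftrightarrow> ?z t n = Psi ?z t n" if t: "t \<in> {0..T}" for t n
  proof -
    have l: "l1 (v s)" "l1 (B s)" "l1 (E s)" if "s \<in> {0..t}" for s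
      using v B E that t by (auto simp: cont_l1_def)
    have N: "continuous_on {0..t} (\<lambda>s. nonlin (?z s) n)"
      by (rule continuous_on_subset[OF nonlin_cont[OF z]]) (use t in auto)
    have ph: "continuous_on {0..t} (\<lambda>s. mhd_phi \<nu> i (t - s) n)" if "i < 4" for i
      using that by (intro continuous_on_compose2[OF phi_cont[of i UNIV]] continuous_intros) auto
    let ?X = "\<lambda>s. leray n (fst (snd (nonlin (?z s) n)) - tdiv n (fst (nonlin (?z s) n)))"
    let ?Y = "\<lambda>s. snd (snd (nonlin (?z s) n))"
    have cX: "continuous_on {0..t} ?X"
      by (intro bounded_linear.continuous_on[OF bounded_linear_leray] continuous_intros
          bounded_linear.continuous_on[OF bounded_linear_tdiv] N)
    have cY: "continuous_on {0..t} (\<lambda>s. curl_m n (?Y s))" "continuous_on {0..t} (\<lambda>s. leray n (- ?Y s))"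
        "continuous_on {0..t} (\<lambda>s. gradpart n (- ?Y s))"
      by (intro bounded_linear.continuous_on[OF bounded_linear_leray] continuous_intros
          bounded_linear.continuous_on[OF bounded_linear_curl]
          bounded_linear.continuous_on[OF bounded_linear_gradpart] N)+
    have J: "bounded_linear (\<lambda>x :: complex^3. (x, 0 :: complex^3, 0 :: complex^3))"
        "bounded_linear (\<lambda>x :: complex^3. (0 :: complex^3, x, 0 :: complex^3))"
        "bounded_linear (\<lambda>x :: complex^3. (0 :: complex^3, 0 :: complex^3, x))"
      by (intro bounded_linear_Pair bounded_linear_ident bounded_linear_zero)+
    have i0: "integral {0..t} (\<lambda>s. mhd_phi \<nu> 0 (t - s) n *\<^sub>R mhd_mult 0 n (nonlin (?z s) n))
        = (integral {0..t} (\<lambda>s. mhd_phi \<nu> 0 (t - s) n *\<^sub>R ?X s), 0, 0)"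
      unfolding integral_inject[OF J(1) ph cX, of 0, simplified, symmetric] by (simp add: mhd_mult_def)
    have i1: "integral {0..t} (\<lambda>s. mhd_phi \<nu> 1 (t - s) n *\<^sub>R mhd_mult 1 n (nonlin (?z s) n))
        = (0, integral {0..t} (\<lambda>s. mhd_phi \<nu> 1 (t - s) n *\<^sub>R curl_m n (?Y s)), 0)"
      using integral_inject[OF J(2) ph cY(1), of 1] by (simp add: mhd_mult_def)
    have i2: "integral {0..t} (\<lambda>s. mhd_phi \<nu> 2 (t - s) n *\<^sub>R mhd_mult 2 n (nonlin (?z s) n))
        = (0, 0, integral {0..t} (\<lambda>s. mhd_phi \<nu> 2 (t - s) n *\<^sub>R leray n (- ?Y s)))"
      using integral_inject[OF J(3) ph cY(2), of 2] by (simp add: mhd_mult_def)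
    have i3: "integral {0..t} (\<lambda>s. mhd_phi \<nu> 3 (t - s) n *\<^sub>R mhd_mult 3 n (nonlin (?z s) n))
        = (0, 0, integral {0..t} (\<lambda>s. mhd_phi \<nu> 3 (t - s) n *\<^sub>R gradpart n (- ?Y s)))"
      using integral_inject[OF J(3) ph cY(3), of 3] by (simp add: mhd_mult_def)
    note lin = bounded_linear.linear[OF bounded_linear_leray] bounded_linear.linear[OF bounded_linear_gradpart]
    have e0: "integral {0..t} (\<lambda>s. mhd_phi \<nu> 0 (t - s) n *\<^sub>R ?X s)
        = - integral {0..t} (\<lambda>s. cscale (heat \<nu> (t - s) n)
               (leray n (div_tensor (v s) n - cross_f (E s) (B s) n
                          - cross_f (cross_f (v s) (B s)) (B s) n)))"
      unfolding integral_neg[symmetric]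
    proof (rule integral_cong)
      fix s assume s: "s \<in> {0..t}"
      have "?X s = - leray n (div_tensor (v s) n - cross_f (E s) (B s) n - cross_f (cross_f (v s) (B s)) (B s) n)"
        unfolding nonlin_components[OF l[OF s]] linear_neg[OF lin(1), symmetric] by (simp add: algebra_simps)
      moreover have "heat \<nu> (t - s) n = of_real (mhd_phi \<nu> 0 (t - s) n)"
        by (simp add: heat_def mhd_phi_def algebra_simps)
      ultimately show "mhd_phi \<nu> 0 (t - s) n *\<^sub>R ?X s = - cscale (heat \<nu> (t - s) n)
               (leray n (div_tensor (v s) n - cross_f (E s) (B s) n - cross_f (cross_f (v s) (B s)) (B s) n))"
        by (simp add: cscale_of_real)
    qed
    have e1: "integral {0..t} (\<lambda>s. mhd_phi \<nu> 1 (t - s) n *\<^sub>R curl_m n (?Y s))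
        = integral {0..t} (\<lambda>s. cscale (Phi2 (t - s) n) (curl_m n (cross_f (v s) (B s) n)))"
      by (rule integral_cong) (simp add: nonlin_components(3)[OF l] Phi2_real cscale_of_real mhd_phi_def)
    have e2: "integral {0..t} (\<lambda>s. mhd_phi \<nu> 2 (t - s) n *\<^sub>R leray n (- ?Y s))
        = - integral {0..t} (\<lambda>s. cscale (dPhi2 (t - s) n) (leray n (cross_f (v s) (B s) n)))"
      unfolding integral_neg[symmetric]
      by (rule integral_cong)
         (simp add: nonlin_components(3)[OF l] dPhi2_real cscale_of_real mhd_phi_def linear_neg[OF lin(1)] del: of_real_diff)
    have e3: "integral {0..t} (\<lambda>s. mhd_phi \<nu> 3 (t - s) n *\<^sub>R gradpart n (- ?Y s))
        = - integral {0..t} (\<lambda>s. cscale (of_real (exp (-(t - s)))) (gradpart n (cross_f (v s) (B s) n)))"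
      unfolding integral_neg[symmetric]
      by (rule integral_cong)
         (simp add: nonlin_components(3)[OF l] cscale_of_real mhd_phi_def linear_neg[OF lin(2)])
    \<comment> \<open>Isolates the term in v0 x B0 that cancels against the boundary term of the
      integration by parts.\<close>
    have init: "leray n (curl_m n (B0 n) - E0 n - cross_f v0 B0 n) = leray n (curl_m n (B0 n) - E0 n) - leray n (cross_f v0 B0 n)"
      by (rule linear_diff[OF lin(1)])
    have ht: "heat \<nu> t n = of_real (exp ((- \<nu> * nsq n) * t))"
      by (simp add: heat_def mult_ac)
    have "Psi ?z t n = mhd_lin \<nu> v0 B0 E0 t n +
       (- integral {0..t} (\<lambda>s. cscale (heat \<nu> (t - s) n)
               (leray n (div_tensor (v s) n - cross_f (E s) (B s) n
                          - cross_f (cross_f (v s) (B s)) (B s) n))),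
        integral {0..t} (\<lambda>s. cscale (Phi2 (t - s) n) (curl_m n (cross_f (v s) (B s) n))),
        - integral {0..t} (\<lambda>s. cscale (dPhi2 (t - s) n) (leray n (cross_f (v s) (B s) n)))
        - integral {0..t} (\<lambda>s. cscale (of_real (exp (-(t - s)))) (gradpart n (cross_f (v s) (B s) n))))"
      unfolding Psi_def kern_integral_sum[OF N] sum_lessThan_4 i0 i1 i2 i3 e0 e1 e2 e3 by simp
    then show ?thesis
      unfolding mhd_lin_def init Phi1_real Phi2_real ht cscale_of_real cscale_half
      by (simp add: algebra_simps)
  qed
  then show ?thesis unfolding mild_solution_def solution_def using z by simp
qed

end

section \<open>Complex conjugation as a symmetry of the system\<close>

definition vcnj :: "complex^3 \<Rightarrow> complex^3" where
  "vcnj u = (\<chi> i. cnj (u $ i))"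

lemma real_field_iff: "real_field c \<longleftrightarrow> (\<forall>n. c (- n) = vcnj (c n))"
  by (simp add: real_field_def vcnj_def)

lemma bounded_linear_vcnj: "bounded_linear vcnj"
proof (rule bounded_linear_intro[where K=1])
  show "norm (vcnj u) \<le> norm u * 1" for u by (simp add: vcnj_def norm_vec_def)
qed (simp_all add: vcnj_def vec_eq_iff complex_scaleR_eq)

lemmas vcnj_linear = linear_0[OF bounded_linear.linear[OF bounded_linear_vcnj]]
  linear_add[OF bounded_linear.linear[OF bounded_linear_vcnj]]
  linear_diff[OF bounded_linear.linear[OF bounded_linear_vcnj]]
  linear_neg[OF bounded_linear.linear[OF bounded_linear_vcnj]]
  linear_scale[OF bounded_linear.linear[OF bounded_linear_vcnj]]

lemma nsq_minus: "nsq (- n) = nsq n"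
  by (simp add: nsq_def nreal_minus)

lemma ncplx_minus_component: "ncplx (- n) $ i = - (ncplx n $ i)" and cnj_ncplx: "cnj (ncplx n $ i) = ncplx n $ i"
  by (simp_all add: ncplx_def)

lemma ccross_vcnj: "ccross (vcnj u) (vcnj w) = vcnj (ccross u w)"
  by (simp add: ccross_def vcnj_def vec_eq_iff forall_3 vector_3)

lemma gradpart_reflect: "gradpart (- n) (vcnj u) = vcnj (gradpart n u)"
  by (simp add: gradpart_def cscale_def cdot_def vcnj_def vec_eq_iff nsq_minus ncplx_minus_component
      cnj_ncplx sum_negf)

lemma leray_reflect: "leray (- n) (vcnj u) = vcnj (leray n u)"
  by (simp add: leray_eq gradpart_reflect vcnj_linear)

text \<open>The sign produced by n -> -n is cancelled by conjugating the factor i; the same happens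
  in \<open>tdiv_reflect\<close>.\<close>

lemma curl_reflect: "curl_m (- n) (vcnj u) = vcnj (curl_m n u)"
  by (simp add: curl_m_def cscale_def ccross_def vcnj_def vec_eq_iff forall_3 vector_3
      ncplx_minus_component cnj_ncplx algebra_simps)

lemma tdiv_reflect: "tdiv (- n) (\<chi> i. vcnj (W $ i)) = vcnj (tdiv n W)"
  by (simp add: tdiv_def cscale_def vcnj_def vec_eq_iff ncplx_minus_component cnj_ncplx sum_negf)

lemma rPhi_reflect: "rPhi1 t (- n) = rPhi1 t n" "rPhi2 t (- n) = rPhi2 t n"
  by (simp_all add: rPhi1_def rPhi2_def wfreq_def nsq_minus)

definition state_cnj :: "state \<Rightarrow> state" where
  "state_cnj x = (vcnj (fst x), vcnj (fst (snd x)), vcnj (snd (snd x)))"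

definition flux_cnj :: "flux \<Rightarrow> flux" where
  "flux_cnj w = ((\<chi> i. vcnj (fst w $ i)), vcnj (fst (snd w)), vcnj (snd (snd w)))"

lemma bounded_linear_state_cnj: "bounded_linear state_cnj"
  unfolding state_cnj_def[abs_def]
  by (intro bounded_linear_Pair bounded_linear_compose[OF bounded_linear_vcnj] bounded_linear_fst
      bounded_linear_fst_snd bounded_linear_snd_snd)

lemma bounded_linear_flux_cnj: "bounded_linear flux_cnj"
proof -
  have "bounded_linear (\<lambda>W :: (complex^3)^3. \<chi> i. vcnj (W $ i))"
  proof (rule bounded_linear_intro[where K=1])
    show "norm (\<chi> i. vcnj (W $ i)) \<le> norm W * 1" for W :: "(complex^3)^3"
      by (simp add: vcnj_def norm_vec_def)
  qed (simp_all add: vec_eq_iff vcnj_linear)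
  then show ?thesis
    unfolding flux_cnj_def[abs_def]
    by (intro bounded_linear_Pair bounded_linear_compose[OF bounded_linear_vcnj]
        bounded_linear_compose[of "\<lambda>W. \<chi> i. vcnj (W $ i)" fst] bounded_linear_fst
        bounded_linear_fst_snd bounded_linear_snd_snd)
qed

lemma mhd_quad_cnj: "mhd_quad (state_cnj x) (state_cnj y) = flux_cnj (mhd_quad x y)"
  by (simp add: mhd_quad_def state_cnj_def flux_cnj_def ccross_vcnj)
     (simp add: ctensor_def cscale_def vcnj_def vec_eq_iff)

lemma mhd_inner_cnj: "mhd_inner (state_cnj x) (state_cnj y) = vcnj (mhd_inner x y)"
  by (simp add: mhd_inner_def state_cnj_def ccross_vcnj)

lemma mhd_outer_cnj: "mhd_outer (vcnj c) (state_cnj y) = flux_cnj (mhd_outer c y)"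
  by (simp add: mhd_outer_def state_cnj_def flux_cnj_def ccross_vcnj vcnj_linear vec_eq_iff)

lemma mhd_mult_reflect: "mhd_mult i (- n) (flux_cnj w) = state_cnj (mhd_mult i n w)"
  by (simp add: mhd_mult_def flux_cnj_def state_cnj_def tdiv_reflect curl_reflect vcnj_linear(1)
      leray_reflect gradpart_reflect vcnj_linear(3,4)[symmetric])

lemma mhd_phi_reflect: "mhd_phi \<nu> i \<tau> (- n) = mhd_phi \<nu> i \<tau> n"
  by (simp add: mhd_phi_def rPhi_reflect nsq_minus)

lemma mhd_lin_reflect:
  assumes "real_field v0" "real_field B0" "real_field E0"
  shows "mhd_lin \<nu> v0 B0 E0 t (- n) = state_cnj (mhd_lin \<nu> v0 B0 E0 t n)"
proof -
  have d: "v0 (- n) = vcnj (v0 n)" "B0 (- n) = vcnj (B0 n)" "E0 (- n) = vcnj (E0 n)"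
    using assms by (simp_all add: real_field_iff)
  show ?thesis
    unfolding mhd_lin_def nsq_minus rPhi_reflect d leray_reflect curl_reflect gradpart_reflect
      vcnj_linear(3)[symmetric]
    by (simp add: state_cnj_def vcnj_linear(1,2,3,5))
qed

context mhd
begin

lemma kern_reflect: "kern \<tau> (- n) (flux_cnj w) = state_cnj (kern \<tau> n w)"
  unfolding kern_def mhd_mult_reflect mhd_phi_reflect
  by (simp add: linear_sum[OF bounded_linear.linear[OF bounded_linear_state_cnj]]
      linear_scale[OF bounded_linear.linear[OF bounded_linear_state_cnj]])

lemma mhd_lin_reg:
  assumes rv: "rapid (\<lambda>n. norm (v0 n))" and rB: "rapid (\<lambda>n. norm (B0 n))" and rE: "rapid (\<lambda>n. norm (E0 n))"
  shows "reg T k (mhd_lin \<nu> v0 B0 E0)"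
proof -
  define S where "S n = norm (v0 n) + norm (B0 n) + norm (E0 n)" for n
  have S: "rapid S" unfolding S_def by (intro rapid_add rv rB rE)
  have S0: "0 \<le> S n" for n by (simp add: S_def)
  note b = mhd_data_coeff_bounds[where ?v0.0=v0 and ?B0.0=B0 and ?E0.0=E0, folded S_def]
  \<comment> \<open>The 31 is 7 + 24, from the largest of the four coefficient bounds; a common
    rapid majorant then serves all of them.\<close>
  have R: "rapid (\<lambda>n. 31 * (1 + norm (nreal n)) ^ 1 * S n)" by (rule rapid_poly[OF S]) simp
  have x: "0 \<le> norm (nreal n) * S n" for n using S0 by simp
  have up: "c * S n + d * (norm (nreal n) * S n) \<le> 31 * (1 + norm (nreal n)) ^ 1 * S n"
    if "c \<le> 31" "d \<le> 31" for c d :: real and n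
    using mult_right_mono[OF that(1) S0[of n]] mult_right_mono[OF that(2) x[of n]] by (simp add: algebra_simps)
  have "rapid (\<lambda>n. norm (v0 n, 0::complex^3, 0::complex^3))"
    by (rule rapid_mono[OF R norm_ge_zero order_trans[OF b(1)]]) (use up[of 1 0] in simp)
  note 1 = reg_kernel_data[OF mhd_phi_smooth[OF nu, of T 0] this, of k]
  have "rapid (\<lambda>n. norm (0::complex^3, B0 n, leray n (E0 n)))"
    by (rule rapid_mono[OF R norm_ge_zero order_trans[OF b(2)]]) (use up[of 5 0] in simp)
  note 2 = reg_kernel_data[OF smooth_kernel_wave_consts(1)[of T] this, of k]
  have "rapid (\<lambda>n. norm (0::complex^3, (1/2) *\<^sub>R B0 n - curl_m n (E0 n),
       (1/2) *\<^sub>R leray n (E0 n) + leray n (curl_m n (B0 n) - E0 n)))"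
    by (rule rapid_mono[OF R norm_ge_zero order_trans[OF b(3)]]) (use up[of 7 24] in simp)
  note 3 = reg_kernel_data[OF smooth_kernel_wave_consts(2)[of T] this, of k]
  have "rapid (\<lambda>n. norm (0::complex^3, 0::complex^3, gradpart n (E0 n)))"
    by (rule rapid_mono[OF R norm_ge_zero order_trans[OF b(4)]]) (use up[of 3 0] in simp)
  note 4 = reg_kernel_data[OF mhd_phi_smooth[OF nu, of T 3] this, of k]
  have "reg T k (\<lambda>t n. mhd_phi \<nu> 0 t n *\<^sub>R (v0 n, 0, 0) + rPhi1 t n *\<^sub>R (0, B0 n, leray n (E0 n))
      + rPhi2 t n *\<^sub>R (0, (1/2) *\<^sub>R B0 n - curl_m n (E0 n), (1/2) *\<^sub>R leray n (E0 n) + leray n (curl_m n (B0 n) - E0 n))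
      + mhd_phi \<nu> 3 t n *\<^sub>R (0, 0, gradpart n (E0 n)))"
    by (intro reg_add 1 2 3 4)
  then show ?thesis by (simp add: mhd_lin_def[abs_def] mhd_phi_def)
qed

lemma poly_bounded_mhd_mult:
  assumes "i < 4"
  shows "poly_bounded (mhd_mult i)"
  unfolding poly_bounded_def
proof (intro conjI allI bounded_linear_mhd_mult exI[of _ "12::real"] exI[of _ "1::nat"])
  fix n and w :: flux
  let ?b = "12 * (1 + norm (nreal n)) ^ 1 * norm w"
  have "0 \<le> norm (nreal n) * norm w" "0 \<le> norm w" by simp_all
  then have le: "6 * norm (nreal n) * norm w \<le> ?b" "4 * norm w \<le> ?b" "3 * norm w \<le> ?b"
    unfolding power_one_right by argo+
  note m = norm_mhd_mult[where n=n and w=w]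
  consider "i = 0" | "i = 1" | "i = 2" | "i = 3" using assms by linarith
  then show "norm (mhd_mult i n w) \<le> ?b"
    using m(1) order_trans[OF m(2) le(1)] order_trans[OF m(3) le(2)] order_trans[OF m(4) le(3)]
    by cases simp_all
qed simp

lemma existence:
  assumes real: "real_field v0" "real_field B0" "real_field E0"
  obtains T z where "0 < T" "solution T z"
    "\<And>t n. t \<in> {0..T} \<Longrightarrow> z t (- n) = state_cnj (z t n)"
    "\<And>k. rapid (\<lambda>n. norm (v0 n)) \<Longrightarrow> rapid (\<lambda>n. norm (B0 n)) \<Longrightarrow> rapid (\<lambda>n. norm (E0 n)) \<Longrightarrow> reg T k z"
proof -
  \<comment> \<open>The extra 1 is the reserve that the flattened weights consume in
    \<open>Ulim_rapid\<close>; it also makes \<open>l\<close> positive.\<close>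
  define l where "l = (\<Sum>\<^sub>\<infinity>n. mhd_data v0 B0 E0 n) + 1"
  have l: "1 \<le> l" using infsum_nonneg[of UNIV "mhd_data v0 B0 E0"] L_nonneg by (simp add: l_def)
  define c where "c = Q * (2 * l)\<^sup>2 + Q\<^sup>2 * (2 * l) ^ 3"
  have c: "0 \<le> c" using Q_nonneg l by (simp add: c_def)
  \<comment> \<open>With radius 2 \<open>l\<close> the nonlinear contribution 3
    \<open>eps mu\<close> c has to fit into the remaining half \<open>l\<close>; c + 1 again avoids
    division by 0.\<close>
  obtain mu where mu: "0 < mu" "eps mu \<le> l / (3 * (c + 1))"
    using eps_small[of "l / (3 * (c + 1))"] l c by auto
  \<comment> \<open>Makes mu T = 1, which keeps exp (mu t) below 3 on the interval.\<close>
  define T where "T = 1 / mu"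
  have T: "0 < T" using mu by (simp add: T_def)
  have "3 * eps mu * c \<le> 3 * (l / (3 * (c + 1))) * (c + 1)"
    using mu c eps_nonneg[OF mu(1)] by (intro mult_mono mult_left_mono) auto
  also have "\<dots> = l" using c by (simp add: field_simps)
  finally have small: "l + 3 * eps mu * c \<le> 2 * l" by simp
  interpret duhamel_small \<nu> 50 Q "{..<4::nat}" "mhd_phi \<nu>" mhd_mult mhd_quad mhd_inner mhd_outer
    "mhd_lin \<nu> v0 B0 E0" "mhd_data v0 B0 E0" T mu l "2 * l"
  proof unfold_locales
    show "l + 3 * eps mu * (Q * (2 * l)\<^sup>2 + Q\<^sup>2 * (2 * l) ^ 3) \<le> 2 * l" using small by (simp add: c_def)
  qed (use mu T l in \<open>auto simp: T_def l_def\<close>)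
  obtain z where z: "solution T z" "\<And>t n. t \<in> {0..T} \<Longrightarrow> norm (z t n) \<le> Ulim n"
    "\<And>t n. t \<in> {0..T} \<Longrightarrow> (\<lambda>j. picard j t n) \<longlonglongrightarrow> z t n"
    by (fact picard_limit)
  have sym: "z t (- n) = state_cnj (z t n)" if t: "t \<in> {0..T}" for t n
  proof (rule LIMSEQ_unique[OF z(3)[OF t]])
    have "picard j t (- n) = state_cnj (picard j t n)" for j
      by (rule picard_reflect[OF bounded_linear_state_cnj bounded_linear_flux_cnj bounded_linear_vcnj
            mhd_quad_cnj mhd_inner_cnj mhd_outer_cnj kern_reflect mhd_lin_reflect[OF real] t])
    then show "(\<lambda>j. picard j t (- n)) \<longlonglongrightarrow> state_cnj (z t n)"
      by (simp add: bounded_linear.tendsto[OF bounded_linear_state_cnj z(3)[OF t]])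
  qed
  have reg: "reg T k z"
    if r: "rapid (\<lambda>n. norm (v0 n))" "rapid (\<lambda>n. norm (B0 n))" "rapid (\<lambda>n. norm (E0 n))" for k
  proof -
    have "rapid (mhd_data v0 B0 E0)"
      unfolding mhd_data_def[abs_def] by (intro rapid_cmult rapid_add r) simp
    then have "rapid Ulim" by (rule Ulim_rapid) (simp add: l_def)
    then show ?thesis
    proof (rule solution_reg[OF z(1) less_imp_le[OF T] _ z(2)])
      show "reg T k (mhd_lin \<nu> v0 B0 E0)" for k by (rule mhd_lin_reg[OF r])
      show "poly_bounded (mhd_mult i)" if "i \<in> {..<4}" for i using that by (intro poly_bounded_mhd_mult) simp
      show "smooth_kernel T (mhd_phi \<nu> i)" for i by (rule mhd_phi_smooth[OF nu])
    qed
  qed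
  show ?thesis by (rule that[OF T z(1) sym reg])
qed

end

lemma state_component:
  "bounded_linear (\<lambda>x :: state. fst x)" "bounded_linear (\<lambda>x :: state. fst (snd x))" "bounded_linear (\<lambda>x :: state. snd (snd x))"
  "norm (fst x) \<le> norm (x :: state)" "norm (fst (snd x)) \<le> norm x" "norm (snd (snd x)) \<le> norm x"
  using norm_fst_le[of "fst x" "snd x"] norm_snd_le[of "snd x" "fst x"]
    norm_fst_le[of "fst (snd x)" "snd (snd x)"] norm_snd_le[of "snd (snd x)" "fst (snd x)"]
  by (auto intro: bounded_linear_fst bounded_linear_fst_snd bounded_linear_snd_snd)

lemma poly_bounded_contraction:
  assumes "bounded_linear h" "\<And>x. norm (h x) \<le> norm x"
  shows "poly_bounded (\<lambda>_. h)"
  unfolding poly_bounded_def using assms by (intro conjI allI exI[of _ 1] exI[of _ 0]) auto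

theorem theorem1p2:
  fixes \<nu> :: real and v0 B0 E0 :: coeffs
  assumes "\<nu> > 0"
    and "v0 \<in> X0" and "B0 \<in> X0" and "E0 \<in> X0"
    and "real_field v0" and "real_field B0" and "real_field E0"
    and "div_free v0" and "div_free B0"
    and "B0 0 = 0"
  shows "\<exists>T>0. \<exists>v B E.
     cont_X0 T v \<and> cont_X0 T B \<and> cont_X0 T E \<and> mild_solution \<nu> T v0 B0 E0 v B E
     \<and> (\<forall>v' B' E'. cont_X0 T v' \<and> cont_X0 T B' \<and> cont_X0 T E'
           \<and> mild_solution \<nu> T v0 B0 E0 v' B' E'
           \<longrightarrow> (\<forall>t\<in>{0..T}. v' t = v t \<and> B' t = B t \<and> E' t = E t))
     \<and> (smooth_on UNIV (realize v0) \<and> smooth_on UNIV (realize B0) \<and> smooth_on UNIV (realize E0)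
        \<longrightarrow> smooth_on ({0..T} \<times> UNIV) (\<lambda>(t::real, x::real^3). realize (v t) x)
          \<and> smooth_on ({0..T} \<times> UNIV) (\<lambda>(t::real, x::real^3). realize (B t) x)
          \<and> smooth_on ({0..T} \<times> UNIV) (\<lambda>(t::real, x::real^3). realize (E t) x))"
proof -
  have l: "l1 v0" "l1 B0" "l1 E0" using assms(2-4) by (simp_all add: X0_def)
  obtain Q where Q: "bilinear_with mhd_quad Q" "bilinear_with mhd_inner Q" "bilinear_with mhd_outer Q"
    by (rule mhd_constant)
  interpret mhd \<nu> Q v0 B0 E0
    by unfold_locales (use assms(1) l Q in auto)
  obtain T z where T: "0 < T" and z: "solution T z"
    and sym: "\<And>t n. t \<in> {0..T} \<Longrightarrow> z t (- n) = state_cnj (z t n)"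
    and reg: "\<And>k. rapid (\<lambda>n. norm (v0 n)) \<Longrightarrow> rapid (\<lambda>n. norm (B0 n)) \<Longrightarrow> rapid (\<lambda>n. norm (E0 n)) \<Longrightarrow> reg T k z"
    by (fact existence[OF assms(5-7)])
  define v where "v t n = fst (z t n)" for t n
  define B where "B t n = fst (snd (z t n))" for t n
  define E where "E t n = snd (snd (z t n))" for t n
  have zeq: "(\<lambda>t n. (v t n, B t n, E t n)) = z" by (simp add: v_def B_def E_def)
  have cz: "cont_l1 T z" using z by (simp add: solution_def)
  note h = state_component
  have c: "cont_l1 T v" "cont_l1 T B" "cont_l1 T E"
    using cont_l1_linear[OF h(1,4) cz] cont_l1_linear[OF h(2,5) cz] cont_l1_linear[OF h(3,6) cz]
    by (simp_all add: v_def[abs_def] B_def[abs_def] E_def[abs_def])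
  have "real_field (v t)" "real_field (B t)" "real_field (E t)" if "t \<in> {0..T}" for t
    using sym[OF that] by (simp_all add: real_field_iff v_def B_def E_def state_cnj_def)
  then have cX: "cont_X0 T v" "cont_X0 T B" "cont_X0 T E" using c by (simp_all add: cont_X0_iff)
  have mild: "mild_solution \<nu> T v0 B0 E0 v B E"
    unfolding mild_solution_iff[OF c] zeq by (rule z)
  have uniq: "\<forall>t\<in>{0..T}. v' t = v t \<and> B' t = B t \<and> E' t = E t"
    if "cont_X0 T v' \<and> cont_X0 T B' \<and> cont_X0 T E' \<and> mild_solution \<nu> T v0 B0 E0 v' B' E'" for v' B' E'
  proof
    fix t assume t: "t \<in> {0..T}"
    have c': "cont_l1 T v'" "cont_l1 T B'" "cont_l1 T E'" using that by (simp_all add: cont_X0_iff)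
    have "solution T (\<lambda>t n. (v' t n, B' t n, E' t n))"
      using that mild_solution_iff[OF c'] by simp
    from solution_unique[OF this z t]
    show "v' t = v t \<and> B' t = B t \<and> E' t = E t"
      unfolding fun_eq_iff v_def B_def E_def by (metis fst_conv snd_conv)
  qed
  \<comment> \<open>The interval was fixed by the viscosity, the constant \<open>Q\<close> and the
    l1 norms of the data; smoothness of the data only adds decay on that same interval.\<close>
  have smooth: "smooth_on ({0..T} \<times> UNIV) (\<lambda>(t::real, x::real^3). realize (v t) x)
      \<and> smooth_on ({0..T} \<times> UNIV) (\<lambda>(t::real, x::real^3). realize (B t) x)
      \<and> smooth_on ({0..T} \<times> UNIV) (\<lambda>(t::real, x::real^3). realize (E t) x)"
    if "smooth_on UNIV (realize v0) \<and> smooth_on UNIV (realize B0) \<and> smooth_on UNIV (realize E0)"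
  proof -
    have r: "reg T k z" for k
      by (intro reg smooth_rapid l assms(5-7)) (simp_all add: that)
    have rk: "reg T k v" "reg T k B" "reg T k E" for k
      unfolding v_def[abs_def] B_def[abs_def] E_def[abs_def]
      by (intro reg_linear[OF poly_bounded_contraction r] h)+
    show ?thesis unfolding smooth_on_def by (intro conjI allI reg_realize_Ck rk)
  qed
  show ?thesis
  proof (rule exI[of _ T], rule conjI[OF T], rule exI[of _ v], rule exI[of _ B], rule exI[of _ E], intro conjI cX mild)
    show "\<forall>v' B' E'. cont_X0 T v' \<and> cont_X0 T B' \<and> cont_X0 T E' \<and> mild_solution \<nu> T v0 B0 E0 v' B' E'
        \<longrightarrow> (\<forall>t\<in>{0..T}. v' t = v t \<and> B' t = B t \<and> E' t = E t)"
      by (intro allI impI) (rule uniq)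
  qed (rule impI, rule smooth)
qed

end
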